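(* Let $A=\mathrm{diag}(a_0,a_1,a_2)$ with either $0<a_0<a_1<a_2$ (collared case) or $a_1<0<a_0<a_2$ (transverse case). Consider a billiard trajectory in the collared or transverse $\mathcal H$-ellipse with caustic $\mathcal C_\nu$, where $\nu\in\mathbb R$ and $0,a_0,a_1,a_2,\nu$ are distinct, and put $\varepsilon=\mathrm{sgn}(a_1\nu)$. The trajectory is $n$-periodic with period $n=2m\ge4$ if and only if $$\det\begin{pmatrix} B_3 & B_4 & \cdots & B_{m+1} \\ B_4 & B_5 & \cdots & B_{m+2} \\ \vdots & \vdots & & \vdots \\ B_{m+1} & B_{m+2} & \cdots & B_{2m-1} \end{pmatrix}=0 .$$ The trajectory is $n$-periodic with period $n=2m+1\ge3$ if and only if $$\det\begin{pmatrix} D_2 & D_3 & \cdots & D_{m+1} \\ D_3 & D_4 & \cdots & D_{m+2} \\ \vdots & \vdots & & \vdots \\ D_{m+1} & D_{m+2} & \cdots & D_{2m} \end{pmatrix}=0 .$$ Here $$\sqrt{\varepsilon(X-a_0)(X-a_1)(X-a_2)(X-\nu)}=B_0+B_1X+B_2X^2+\cdots$$ and $$\sqrt{\frac{\varepsilon(X-a_0)(X-a_1)(X-a_2)}{X-\nu}}=D_0+D_1X+D_2X^2+\cdots$$ are the Taylor expansions around $X=0$. Furthermore, the only $2$-periodic trajectories are contained in the planes of symmetry.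
   Context: $\mathbf M^3$ is $\mathbb R^3$ with coordinates $(x_0,x_1,x_2)$ and the form $\langle x,y\rangle=-x_0y_0+x_1y_1+x_2y_2$; $\mathcal H=\{x:\langle x,x\rangle=1\}$ with the restricted Lorentz metric. Geodesics of $\mathcal H$ are (connected components of) intersections of $\mathcal H$ with planes through the origin; they are space-, time- or light-like according to whether $\langle v,v\rangle>0,<0,=0$ for their tangent vectors $v$. The cone $\langle A^{-1}x,x\rangle=-\frac{x_0^2}{a_0}+\frac{x_1^2}{a_1}+\frac{x_2^2}{a_2}=0$ cuts $\mathcal H$ in boundary curves. In the collared case they are two closed curves, the collared $\mathcal H$-ellipse, bounding the compact domain $\{x\in\mathcal H:\langle A^{-1}x,x\rangle\ge0\}$. In the transverse case they form the transverse $\mathcal H$-ellipse; of the two compact domains one takes $\{x\in\mathcal H:\langle A^{-1}x,x\rangle\ge0,\ x_2>0\}$. The planes of symmetry are coordinate planes. Billiard: the particle moves along geodesic arcs of $\mathcal H$ inside the domain (space-like segments being length-minimizing arcs); on hitting the boundary at $p$ with velocity $v\in T_p\mathcal H$, its velocity becomes $v-2\frac{\langle v,n\rangle}{\langle n,n\rangle}n$, where $n=A^{-1}p\in T_p\mathcal H$ is normal to the boundary curve. At the four points of the transverse $\mathcal H$-ellipse with light-like tangent the reflection is counted twice (limit of two consecutive reflections, the particle returning along the incoming segment). In the collared case one also considers (space-like) billiard motion on $\mathcal H$ outside the compact domain, reflecting off one boundary component. Caustic: the planes through the origin containing the segments of a trajectory (not light-like) are all tangent to one cone $-\frac{x_0^2}{a_0-\nu}+\frac{x_1^2}{a_1-\nu}+\frac{x_2^2}{a_2-\nu}=0$;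 the corresponding conic $\mathcal C_\nu$ is the caustic. Interpretation of periods: $n$-periodic means the trajectory closes after $n$ reflections. In the collared case with $n$ odd, the condition for $n=2m+1$ corresponds to a trajectory of period $2(2m+1)$ for motion inside the collared $\mathcal H$-ellipse and of period $2m+1$ for motion outside; both have period $2m+1$ after the projection $(x_0,x_1,x_2)\mapsto(x_1/x_0,x_2/x_0)$, which identifies antipodal points. *)

theory Defs
  imports "Jordan_Normal_Form.Determinant" "HOL-Analysis.Analysis"
begin

no_notation Matrix.vec_index (infixl "$" 100)

section \<open>Minkowski space and the hyperboloid\<close>

text \<open>
  Points of Minkowski space are vectors of type \<^typ>\<open>real^3\<close>. The index type \<^typ>\<open>3\<close> consists of the
  residues 0, 1, 2, so the coordinates are \<open>x $ 0\<close>, \<open>x $ 1\<close>, \<open>x $ 2\<close> (with \<open>x $ 3 = x $ 0\<close>).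
\<close>

definition lorentz :: "real^3 \<Rightarrow> real^3 \<Rightarrow> real" where
  "lorentz x y = - x $ 0 * y $ 0 + x $ 1 * y $ 1 + x $ 2 * y $ 2"

definition hyperboloid :: "(real^3) set" where
  "hyperboloid = {x. lorentz x x = 1}"

text \<open>A vector \<open>a\<close> stands for the matrix \<open>A = diag(a $ 0, a $ 1, a $ 2)\<close>.\<close>

definition diag_inv :: "real^3 \<Rightarrow> real^3 \<Rightarrow> real^3" where
  "diag_inv a x = (\<chi> i. x $ i / a $ i)"

definition cone_form :: "real^3 \<Rightarrow> real^3 \<Rightarrow> real" where
  "cone_form a x = lorentz (diag_inv a x) x"

section \<open>Geodesics\<close>

definition geodesics :: "(real^3) set set" where
  "geodesics = {C. \<exists>P. subspace P \<and> dim P = 2 \<and> C \<in> components (hyperboloid \<inter> P)}"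

text \<open>
  The uniform (affinely parametrised) motion along the geodesic through \<open>p\<close> with initial velocity
  \<open>v\<close>, for \<open>p\<close> on the hyperboloid and \<open>v\<close> tangent to it at \<open>p\<close>, that is, \<open>lorentz p v = 0\<close>. The
  lemmas below show that it sweeps out the member of \<^const>\<open>geodesics\<close> through \<open>p\<close> in the plane
  spanned by \<open>p\<close> and \<open>v\<close>, has velocity \<open>v\<close> at time \<open>0\<close>, and has no acceleration tangent to the
  hyperboloid.
\<close>

definition geodesic :: "real^3 \<Rightarrow> real^3 \<Rightarrow> real \<Rightarrow> real^3" where
  "geodesic p v t =
     (let s = lorentz v v in
      if s > 0 then cos (sqrt s * t) *\<^sub>R p + (sin (sqrt s * t) / sqrt s) *\<^sub>R v
      else if s < 0 then cosh (sqrt (- s) * t) *\<^sub>R p + (sinh (sqrt (- s) * t) / sqrt (- s)) *\<^sub>R v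
      else p + t *\<^sub>R v)"

definition velocity :: "real^3 \<Rightarrow> real^3 \<Rightarrow> real \<Rightarrow> real^3" where
  "velocity p v t = vector_derivative (geodesic p v) (at t)"

lemma lorentz_commute: "lorentz x y = lorentz y x"
  by (simp add: lorentz_def algebra_simps)

lemma lorentz_lincomb:
  "lorentz (c *\<^sub>R p + d *\<^sub>R v) (c' *\<^sub>R p + d' *\<^sub>R v) =
     c * c' * lorentz p p + (c * d' + d * c') * lorentz p v + d * d' * lorentz v v"
  by (simp add: lorentz_def algebra_simps)

definition geodesic_vel :: "real^3 \<Rightarrow> real^3 \<Rightarrow> real \<Rightarrow> real^3" where
  "geodesic_vel p v t =
     (let s = lorentz v v in
      if s > 0 then (- sqrt s * sin (sqrt s * t)) *\<^sub>R p + cos (sqrt s * t) *\<^sub>R v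
      else if s < 0 then (sqrt (- s) * sinh (sqrt (- s) * t)) *\<^sub>R p + cosh (sqrt (- s) * t) *\<^sub>R v
      else v)"

lemma geodesic_has_vector_derivative:
  "(geodesic p v has_vector_derivative geodesic_vel p v t) (at t)"
proof -
  consider "lorentz v v > 0" | "lorentz v v < 0" | "lorentz v v = 0" by linarith
  then show ?thesis
  proof cases
    case 1
    define r where "r = sqrt (lorentz v v)"
    have r: "r > 0" using 1 by (simp add: r_def)
    have g: "geodesic p v = (\<lambda>t. cos (r * t) *\<^sub>R p + (sin (r * t) / r) *\<^sub>R v)"
      using 1 by (simp add: geodesic_def Let_def fun_eq_iff r_def)
    have u: "geodesic_vel p v t = (- r * sin (r * t)) *\<^sub>R p + cos (r * t) *\<^sub>R v"
      using 1 by (simp add: geodesic_vel_def Let_def r_def)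
    show ?thesis unfolding g u using r
      by (auto simp: mult_ac intro!: derivative_eq_intros)
  next
    case 2
    define r where "r = sqrt (- lorentz v v)"
    have r: "r > 0" using 2 by (simp add: r_def)
    have g: "geodesic p v = (\<lambda>t. cosh (r * t) *\<^sub>R p + (sinh (r * t) / r) *\<^sub>R v)"
      using 2 by (simp add: geodesic_def Let_def fun_eq_iff r_def)
    have u: "geodesic_vel p v t = (r * sinh (r * t)) *\<^sub>R p + cosh (r * t) *\<^sub>R v"
      using 2 by (simp add: geodesic_vel_def Let_def r_def)
    show ?thesis unfolding g u using r
      by (auto simp: mult_ac intro!: derivative_eq_intros)
  next
    case 3
    then have "geodesic p v = (\<lambda>t. p + t *\<^sub>R v)"
      by (auto simp: geodesic_def Let_def fun_eq_iff)
    with 3 show ?thesis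
      by (auto simp: geodesic_vel_def Let_def intro!: derivative_eq_intros)
  qed
qed

lemma velocity_eq: "velocity p v t = geodesic_vel p v t"
  unfolding velocity_def by (rule vector_derivative_at[OF geodesic_has_vector_derivative])

lemma geodesic_0 [simp]: "geodesic p v 0 = p"
  by (simp add: geodesic_def Let_def)

lemma velocity_0 [simp]: "velocity p v 0 = v"
  by (simp add: velocity_eq geodesic_vel_def Let_def)

lemma velocity_has_vector_derivative:
  assumes "lorentz p v = 0"
  shows "(velocity p v has_vector_derivative - (lorentz v v *\<^sub>R geodesic p v t)) (at t)"
proof -
  have eq: "velocity p v = geodesic_vel p v"
    by (simp add: velocity_eq fun_eq_iff)
  consider "lorentz v v > 0" | "lorentz v v < 0" | "lorentz v v = 0" by linarith
  then show ?thesis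
  proof cases
    case 1
    then have *: "geodesic_vel p v = (\<lambda>t. (- sqrt (lorentz v v) * sin (sqrt (lorentz v v) * t)) *\<^sub>R p
                + cos (sqrt (lorentz v v) * t) *\<^sub>R v)"
      by (simp add: geodesic_vel_def Let_def fun_eq_iff)
    define r where "r = sqrt (lorentz v v)"
    have r: "r > 0" "lorentz v v = r * r" using 1 by (auto simp: r_def)
    have g: "geodesic p v t = cos (r * t) *\<^sub>R p + (sin (r * t) / r) *\<^sub>R v"
      using 1 by (simp add: geodesic_def Let_def r_def)
    show ?thesis unfolding eq * g unfolding r_def[symmetric] unfolding r(2) using r(1)
      by (auto simp: scaleR_add_right mult_ac intro!: derivative_eq_intros)
  next
    case 2
    then have *: "geodesic_vel p v = (\<lambda>t. (sqrt (- lorentz v v) * sinh (sqrt (- lorentz v v) * t)) *\<^sub>R p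
                + cosh (sqrt (- lorentz v v) * t) *\<^sub>R v)"
      by (auto simp: geodesic_vel_def Let_def fun_eq_iff)
    define r where "r = sqrt (- lorentz v v)"
    have r: "r > 0" "lorentz v v = - (r * r)" using 2 by (auto simp: r_def)
    have g: "geodesic p v t = cosh (r * t) *\<^sub>R p + (sinh (r * t) / r) *\<^sub>R v"
      using 2 by (simp add: geodesic_def Let_def r_def)
    show ?thesis unfolding eq * g unfolding r_def[symmetric] unfolding r(2) using r(1)
      by (auto simp: scaleR_add_right mult_ac intro!: derivative_eq_intros)
  next
    case 3
    then have "geodesic_vel p v = (\<lambda>t. v)"
      by (auto simp: geodesic_vel_def Let_def fun_eq_iff)
    with 3 show ?thesis unfolding eq by auto
  qed
qed

lemma independent_point_tangent:
  assumes "p \<in> hyperboloid" "lorentz p v = 0" "v \<noteq> 0"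
  shows "p \<notin> span {v}" "dim (span {p, v}) = 2"
proof -
  show *: "p \<notin> span {v}"
  proof
    assume "p \<in> span {v}"
    then obtain k where "p = k *\<^sub>R v" by (auto simp: span_singleton)
    then have "lorentz p p = k * lorentz p v" by (simp add: lorentz_def algebra_simps)
    with assms show False by (simp add: hyperboloid_def)
  qed
  then have "p \<noteq> v" by (auto simp: span_base)
  moreover have "independent {p, v}"
    using * assms(3) by (simp add: independent_insert)
  ultimately show "dim (span {p, v}) = 2"
    by (simp add: dim_eq_card_independent)
qed

lemma range_geodesic:
  assumes p: "p \<in> hyperboloid" and v: "lorentz p v = 0" "v \<noteq> 0"
  shows "range (geodesic p v) = connected_component_set (hyperboloid \<inter> span {p, v}) p"
proof
  let ?S = "hyperboloid \<inter> span {p, v}"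
  have pp: "lorentz p p = 1" using p by (simp add: hyperboloid_def)
  have mem: "c *\<^sub>R p + d *\<^sub>R v \<in> ?S \<longleftrightarrow> c\<^sup>2 + d\<^sup>2 * lorentz v v = 1" for c d
  proof -
    have "c *\<^sub>R p + d *\<^sub>R v \<in> span {p, v}"
      by (intro span_add span_mul span_base) auto
    then show ?thesis
      using lorentz_lincomb[of c p d v c d] pp v
      by (simp add: hyperboloid_def power2_eq_square)
  qed
  have "geodesic p v t \<in> ?S" for t
  proof -
    consider "lorentz v v > 0" | "lorentz v v < 0" | "lorentz v v = 0" by linarith
    then show ?thesis
    proof cases
      case 1
      then show ?thesis by (simp add: geodesic_def Let_def mem[unfolded Int_iff] power_divide)
    next
      case 2
      then show ?thesis
        using cosh_square_eq[of "sqrt (- lorentz v v) * t"]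
        by (simp add: geodesic_def Let_def mem[unfolded Int_iff] power_divide)
    next
      case 3
      then show ?thesis using mem[of 1 t] by (simp add: geodesic_def)
    qed
  qed
  moreover have "connected (range (geodesic p v))"
    by (intro connected_continuous_image continuous_at_imp_continuous_on ballI
        has_vector_derivative_continuous[OF geodesic_has_vector_derivative]) auto
  moreover have "p \<in> range (geodesic p v)" by (metis geodesic_0 rangeI)
  ultimately show "range (geodesic p v) \<subseteq> connected_component_set ?S p"
    using connected_component_maximal[of p "range (geodesic p v)" ?S] by blast
  show "connected_component_set ?S p \<subseteq> range (geodesic p v)"
  proof
    fix x assume x: "x \<in> connected_component_set ?S p"
    then have xS: "x \<in> ?S" using connected_component_subset by blast
    obtain c d where cd: "x = c *\<^sub>R p + d *\<^sub>R v"
    proof -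
      from xS obtain k where "x - k *\<^sub>R p \<in> span {v}" by (auto simp: span_insert)
      then obtain d where "x - k *\<^sub>R p = d *\<^sub>R v" by (auto simp: span_singleton)
      then show ?thesis using that[of k d] by (simp add: algebra_simps)
    qed
    have c1: "c\<^sup>2 + d\<^sup>2 * lorentz v v = 1" using xS cd mem by simp
    have cpos: "c > 0" if le: "lorentz v v \<le> 0"
    proof (rule ccontr)
      assume "\<not> c > 0"
      let ?f = "lorentz p"
      let ?C = "connected_component_set ?S p"
      have "connected (?f ` ?C)"
        by (intro connected_continuous_image connected_connected_component)
           (auto simp: lorentz_def[abs_def] intro!: continuous_intros)
      moreover have "?f x \<in> ?f ` ?C" "?f p \<in> ?f ` ?C"
        using x p by (auto intro!: imageI simp: span_base)
      moreover have "?f x = c"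
        using lorentz_lincomb[of 1 p 0 v c d] cd pp v by simp
      ultimately have "0 \<in> ?f ` ?C"
        using connectedD_interval[of "?f ` ?C" c 1 0] \<open>\<not> c > 0\<close> pp by simp
      then obtain y where y: "y \<in> ?C" "lorentz p y = 0" by auto
      then have yS: "y \<in> ?S" using connected_component_subset by blast
      then obtain k where "y - k *\<^sub>R p \<in> span {v}" by (auto simp: span_insert)
      then obtain e where "y - k *\<^sub>R p = e *\<^sub>R v" by (auto simp: span_singleton)
      then have ye: "y = k *\<^sub>R p + e *\<^sub>R v" by (simp add: algebra_simps)
      then have "k = 0" using lorentz_lincomb[of 1 p 0 v k e] y pp v by simp
      with ye yS mem[of k e] have "e\<^sup>2 * lorentz v v = 1" by simp
      moreover have "e\<^sup>2 * lorentz v v \<le> 0" using le by (simp add: mult_nonneg_nonpos)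
      ultimately show False by simp
    qed
    consider "lorentz v v > 0" | "lorentz v v < 0" | "lorentz v v = 0" by linarith
    then have "\<exists>t. x = geodesic p v t"
    proof cases
      case 1
      define r where "r = sqrt (lorentz v v)"
      have r: "r > 0" "lorentz v v = r\<^sup>2" using 1 by (auto simp: r_def)
      with c1 have "c\<^sup>2 + (d * r)\<^sup>2 = 1" by (simp add: power_mult_distrib)
      then obtain t where t: "c = cos t" "d * r = sin t" by (metis sincos_total_2pi)
      have "d = sin t / r" using t(2) r(1) by (simp add: field_simps)
      then have "x = geodesic p v (t / r)"
        using 1 r(1) t cd by (simp add: geodesic_def Let_def flip: r_def)
      then show ?thesis ..
    next
      case 2
      define r where "r = sqrt (- lorentz v v)"
      have r: "r > 0" "lorentz v v = - r\<^sup>2" using 2 by (auto simp: r_def)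
      define t where "t = arsinh (d * r)"
      have s: "sinh t = d * r" by (simp add: t_def)
      have "(cosh t)\<^sup>2 = c\<^sup>2" using c1 r cosh_square_eq[of t] s
        by (simp add: power_mult_distrib)
      then have "cosh t = c" using cpos 2 by (simp add: power2_eq_iff_nonneg)
      then have "x = geodesic p v (t / r)"
        using 2 r(1) s cd by (simp add: geodesic_def Let_def flip: r_def)
      then show ?thesis ..
    next
      case 3
      then have "c = 1" using c1 cpos by (auto simp: power2_eq_1_iff)
      then have "x = geodesic p v d" using 3 cd by (simp add: geodesic_def)
      then show ?thesis ..
    qed
    then show "x \<in> range (geodesic p v)" by auto
  qed
qed

lemma range_geodesic_in_geodesics:
  assumes "p \<in> hyperboloid" "lorentz p v = 0" "v \<noteq> 0"
  shows "range (geodesic p v) \<in> geodesics"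
  unfolding geodesics_def range_geodesic[OF assms] components_def
  using assms(1) independent_point_tangent(2)[OF assms]
  by (intro CollectI exI[of _ "span {p, v}"]) (auto simp: span_base)

section \<open>Billiard tables\<close>

definition collared :: "real^3 \<Rightarrow> bool" where
  "collared a \<longleftrightarrow> 0 < a $ 0 \<and> a $ 0 < a $ 1 \<and> a $ 1 < a $ 2"

definition transverse :: "real^3 \<Rightarrow> bool" where
  "transverse a \<longleftrightarrow> a $ 1 < 0 \<and> 0 < a $ 0 \<and> a $ 0 < a $ 2"

definition collar :: "real^3 \<Rightarrow> (real^3) set" where
  "collar a = {x \<in> hyperboloid. cone_form a x \<ge> 0}"

definition collar_exterior :: "real^3 \<Rightarrow> (real^3) set" where
  "collar_exterior a = {x \<in> hyperboloid. cone_form a x \<le> 0}"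

definition transverse_domain :: "real^3 \<Rightarrow> (real^3) set" where
  "transverse_domain a = {x \<in> hyperboloid. cone_form a x \<ge> 0 \<and> x $ 2 > 0}"

definition table_boundary :: "real^3 \<Rightarrow> (real^3) set \<Rightarrow> (real^3) set" where
  "table_boundary a M = {x \<in> M. cone_form a x = 0}"

section \<open>Billiard trajectories\<close>

text \<open>The tangent to the boundary curve at \<open>p\<close> is orthogonal to \<open>p\<close> and to the normal \<open>diag_inv a p\<close>.\<close>

definition lightlike_tangent :: "real^3 \<Rightarrow> real^3 \<Rightarrow> bool" where
  "lightlike_tangent a p \<longleftrightarrow>
     (\<exists>w. w \<noteq> 0 \<and> lorentz w p = 0 \<and> lorentz w (diag_inv a p) = 0 \<and> lorentz w w = 0)"

definition reflect :: "real^3 \<Rightarrow> real^3 \<Rightarrow> real^3 \<Rightarrow> real^3" where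
  "reflect a p u =
     (let n = diag_inv a p in
      if lightlike_tangent a p then - u else u - (2 * lorentz u n / lorentz n n) *\<^sub>R n)"

text \<open>
  The particle leaves the boundary point \<open>p\<close> with velocity \<open>v\<close>, moves inside the table \<open>M\<close> and arrives
  at the next boundary point \<open>q\<close> with velocity \<open>u\<close>. A complete space-like geodesic is a closed curve of
  length \<open>2 * pi\<close>, so that its length-minimizing arcs are those of length at most \<open>pi\<close>.
\<close>

definition billiard_segment ::
  "real^3 \<Rightarrow> (real^3) set \<Rightarrow> real^3 \<Rightarrow> real^3 \<Rightarrow> real^3 \<Rightarrow> real^3 \<Rightarrow> bool" where
  "billiard_segment a M p v q u \<longleftrightarrow>
     (\<exists>T>0. (\<forall>t. 0 < t \<and> t < T \<longrightarrow> geodesic p v t \<in> M - table_boundary a M) \<and>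
        geodesic p v T = q \<and> q \<in> table_boundary a M \<and> velocity p v T = u \<and>
        (lorentz v v > 0 \<longrightarrow> T * sqrt (lorentz v v) \<le> pi))"

text \<open>
  \<open>p k\<close> is the \<open>k\<close>-th point of reflection and \<open>v k\<close> the velocity right after the reflection there.
  The condition \<open>lorentz (v k) (diag_inv a (p k)) \<noteq> 0\<close> says that the particle hits the boundary rather
  than grazing it: segments tangent to the boundary curve are excluded.
\<close>

definition billiard_trajectory ::
  "real^3 \<Rightarrow> (real^3) set \<Rightarrow> (nat \<Rightarrow> real^3) \<Rightarrow> (nat \<Rightarrow> real^3) \<Rightarrow> bool" where
  "billiard_trajectory a M p v \<longleftrightarrow>
     (\<forall>k. p k \<in> table_boundary a M \<and> lorentz (p k) (v k) = 0 \<and>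
        lorentz (v k) (diag_inv a (p k)) \<noteq> 0 \<and>
        (\<exists>u. billiard_segment a M (p k) (v k) (p (Suc k)) u \<and>
             v (Suc k) = reflect a (p (Suc k)) u))"

definition collared_trajectory :: "real^3 \<Rightarrow> (nat \<Rightarrow> real^3) \<Rightarrow> (nat \<Rightarrow> real^3) \<Rightarrow> bool" where
  "collared_trajectory a p v \<longleftrightarrow> collared a \<and> billiard_trajectory a (collar a) p v"

definition exterior_trajectory :: "real^3 \<Rightarrow> (nat \<Rightarrow> real^3) \<Rightarrow> (nat \<Rightarrow> real^3) \<Rightarrow> bool" where
  "exterior_trajectory a p v \<longleftrightarrow>
     collared a \<and> billiard_trajectory a (collar_exterior a) p v \<and> (\<forall>k. lorentz (v k) (v k) > 0)"

definition transverse_trajectory :: "real^3 \<Rightarrow> (nat \<Rightarrow> real^3) \<Rightarrow> (nat \<Rightarrow> real^3) \<Rightarrow> bool" where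
  "transverse_trajectory a p v \<longleftrightarrow> transverse a \<and> billiard_trajectory a (transverse_domain a) p v"

section \<open>Caustics\<close>

definition confocal :: "real^3 \<Rightarrow> real \<Rightarrow> real^3" where
  "confocal a \<nu> = (\<chi> i. a $ i - \<nu>)"

text \<open>
  A plane is tangent to the cone \<open>cone_form b x = 0\<close> if it is the tangent plane of the cone at one of
  its points other than the origin.
\<close>

definition tangent_to_cone :: "real^3 \<Rightarrow> (real^3) set \<Rightarrow> bool" where
  "tangent_to_cone b P \<longleftrightarrow>
     (\<exists>x. x \<noteq> 0 \<and> cone_form b x = 0 \<and> P = {y. lorentz (diag_inv b x) y = 0})"

definition has_caustic :: "real^3 \<Rightarrow> real \<Rightarrow> (nat \<Rightarrow> real^3) \<Rightarrow> (nat \<Rightarrow> real^3) \<Rightarrow> bool" where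
  "has_caustic a \<nu> p v \<longleftrightarrow>
     (\<forall>k. lorentz (v k) (v k) \<noteq> 0 \<and> tangent_to_cone (confocal a \<nu>) (span {p k, v k}))"

section \<open>Periodicity\<close>

text \<open>The number of reflections at \<open>p 1, \<dots>, p N\<close>, those at points with light-like tangent counted twice.\<close>

definition reflections :: "real^3 \<Rightarrow> (nat \<Rightarrow> real^3) \<Rightarrow> nat \<Rightarrow> nat" where
  "reflections a p N = (\<Sum>k=1..N. if lightlike_tangent a (p k) then 2 else 1)"

definition periodic :: "real^3 \<Rightarrow> (nat \<Rightarrow> real^3) \<Rightarrow> (nat \<Rightarrow> real^3) \<Rightarrow> nat \<Rightarrow> bool" where
  "periodic a p v n \<longleftrightarrow> (\<exists>N. reflections a p N = n \<and> p N = p 0 \<and> v N = v 0)"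

definition proj :: "real^3 \<Rightarrow> real \<times> real" where
  "proj x = (x $ 1 / x $ 0, x $ 2 / x $ 0)"

definition proj_velocity :: "real^3 \<Rightarrow> real^3 \<Rightarrow> real \<times> real" where
  "proj_velocity p v = vector_derivative (\<lambda>t. proj (geodesic p v t)) (at 0)"

text \<open>
  The projected trajectory closes after \<open>n\<close> reflections. This is used in the collared case only, where
  \<open>p k $ 0 \<noteq> 0\<close> at all boundary points.
\<close>

definition proj_periodic :: "real^3 \<Rightarrow> (nat \<Rightarrow> real^3) \<Rightarrow> (nat \<Rightarrow> real^3) \<Rightarrow> nat \<Rightarrow> bool" where
  "proj_periodic a p v n \<longleftrightarrow>
     (\<exists>N. reflections a p N = n \<and> proj (p N) = proj (p 0) \<and>
          proj_velocity (p N) (v N) = proj_velocity (p 0) (v 0))"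

definition in_symmetry_plane :: "(nat \<Rightarrow> real^3) \<Rightarrow> (nat \<Rightarrow> real^3) \<Rightarrow> bool" where
  "in_symmetry_plane p v \<longleftrightarrow> (\<exists>i. \<forall>k t. geodesic (p k) (v k) t $ i = 0)"

section \<open>The determinants\<close>

text \<open>The determinant of the \<open>k \<times> k\<close> matrix whose rows are
  \<open>c s, \<dots>, c (s + k - 1)\<close>; \<open>c (s + 1), \<dots>, c (s + k)\<close>; and so on.\<close>

definition hankel_det :: "(nat \<Rightarrow> real) \<Rightarrow> nat \<Rightarrow> nat \<Rightarrow> real" where
  "hankel_det c s k = Determinant.det (Matrix.mat k k (\<lambda>(i, j). c (s + i + j)))"

end

theory Submission
  imports
    Defs
    "HOL-Computational_Algebra.Polynomial_Factorial"
    "HOL-Computational_Algebra.Field_as_Ring"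
    "HOL-Computational_Algebra.Polynomial_FPS"
begin

text \<open>
The planes of the segments of a trajectory are lines of the projective plane, the points of
reflection lie on the conic \<open>\<langle>A\<^sup>-\<^sup>1x, x\<rangle> = 0\<close>, and all these lines touch the caustic, so that
closing after \<open>n\<close> reflections is a Poncelet problem. The Cayley-type condition is derived here
by linear algebra over \<open>\<real>[X]\<close> and \<open>\<real>[[X]]\<close>, in the spirit of the Lax representation of Moser and
Veselov, and no elliptic curve appears.

A state consists of a boundary point \<open>p\<close> and the velocity \<open>v\<close> there. Let \<open>N(X)\<close> be the Gram matrix
of \<open>(p, v)\<close> for the form \<open>\<Prod>(a\<^sub>i - X) \<langle>(A - X)\<^sup>-\<^sup>1x, y\<rangle>\<close> (\<open>gram_poly\<close>). Its entries are polynomials of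
degree at most \<open>2\<close>; tangency to the caustic says that \<open>det N\<close> is a constant times
\<open>P = (X - a\<^sub>0)(X - a\<^sub>1)(X - a\<^sub>2)(X - \<nu>)\<close> (\<open>caustic_discriminant\<close>); and at \<open>X = a\<^sub>i\<close> the matrix \<open>N\<close> is a
multiple of \<open>(p\<^sub>i, v\<^sub>i)\<^sup>T(p\<^sub>i, v\<^sub>i)\<close>. Moving along a segment is a constant change of basis, and a
reflection is a shear \<open>v \<mapsto> v - (\<mu>/X) p\<close> as far as \<open>N\<close> can see. After clearing denominators, a
reflection is therefore a polynomial matrix of determinant \<open>X\<^sup>2\<close>. At a light-like tangent the
shear has a pole of order \<open>2\<close> and the determinant is \<open>X\<^sup>4\<close>: this is why such a reflection counts
twice. These matrices multiply to a transfer matrix \<open>\<Theta>\<close> of determinant \<open>X\<^sup>2\<^sup>n\<close>, where \<open>n\<close> is the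
number of reflections (\<open>step_transfer\<close>, \<open>transfer_trans\<close>).

If the trajectory closes up to a sign \<open>\<tau>\<close>, then \<open>\<Theta>\<close> preserves \<open>N\<close> up to the factor \<open>X\<^sup>2\<^sup>n\<close>, and at
\<open>X = a\<^sub>i\<close> it has the double eigenvalue \<open>\<tau> a\<^sub>i\<^sup>n\<close>. For \<open>f\<close>, half the trace of \<open>\<Theta>\<close>, the polynomials
\<open>f - \<tau> X\<^sup>n\<close> and \<open>f + \<tau> X\<^sup>n\<close> are coprime, the first one vanishes at \<open>a\<^sub>0, a\<^sub>1, a\<^sub>2\<close>, and their product
is a constant times \<open>P\<close> times the square of a rational function. Unique factorisation makes
each of them a square times a part of \<open>P\<close>, which is a Pell equation \<open>S q\<^sup>2 - T r\<^sup>2 = c X\<^sup>n\<close>, with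
\<open>S = 1\<close> for even and \<open>S = X - \<nu>\<close> for odd \<open>n\<close>, and \<open>T = \<epsilon> P / S\<close> (\<open>closed_imp_pell\<close>, up to scaling \<open>q\<close>
and \<open>r\<close>). With \<open>F = \<surd>(T/S)\<close> the left-hand side is \<open>S (q - F r)(q + F r)\<close>, and only one of the two
last factors can vanish at \<open>0\<close>; so \<open>q \<plusminus> F r = O(X\<^sup>n)\<close>. As the degrees of \<open>q\<close> and \<open>r\<close> are bounded,
this is a linear system for \<open>r\<close> whose matrix is the Hankel matrix (\<open>hankel_det_eq_0_iff\<close>).

Conversely, a kernel vector gives \<open>q\<close> and \<open>r\<close>, hence polynomials \<open>f\<close>, \<open>g\<close> such that the matrix
\<open>\<Theta>' = f + g J N\<close>, with \<open>J\<close> the rotation by a right angle, has determinant \<open>X\<^sup>2\<^sup>n\<close> and commutes with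
\<open>J N\<close> (\<open>pell_polynomials\<close>). Near \<open>X = 0\<close> the form \<open>N\<close> has two null directions over \<open>\<real>[[X]]\<close>. The
matrix \<open>\<Theta>'\<close> scales them, the inverse of \<open>\<Theta>\<close> carries them to the null directions at the end of
the trajectory, and the powers of \<open>X\<close> involved cancel, which shows that \<open>\<Theta>'\<close> is \<open>\<Theta>\<close> times a
constant matrix (\<open>factor_through_transfer\<close>). Evaluation at \<open>X = a\<^sub>i\<close> recovers each coordinate and
shows that the trajectory closes up to a sign (\<open>transfer_closes\<close>). A count that falls in the
middle of a double reflection is excluded by the same comparison (\<open>transfer_skip_impossible\<close>).

The sign is invisible to the projection to the plane. On the hyperboloid it is decided by
the sign of a coordinate: of \<open>x\<^sub>2\<close> on the transverse domain, and of \<open>x\<^sub>0\<close> in the collared case,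
where a segment inside the collar joins the two boundary curves and a segment outside
returns to the same one. A trajectory of period \<open>2\<close> meets the boundary orthogonally at both
ends of a segment; the plane of that segment is then invariant under \<open>A\<^sup>-\<^sup>1\<close>, hence a coordinate
plane (\<open>two_periodic_in_symmetry_plane\<close>).
\<close>

section \<open>Polynomials and power series\<close>

text \<open>
Two coprime factors of a square are squares up to constants. The factor \<open>h\<^sup>2\<close> on the left
allows the square to be the square of a rational function.
\<close>

lemma coprime_part_of_square:
  fixes x y g h :: "real poly"
  assumes co: "coprime x y" and eq: "x * y * h\<^sup>2 = smult e (g\<^sup>2)" and "e \<noteq> 0" "h \<noteq> 0"
  shows "\<exists>d s. d \<noteq> 0 \<and> x = smult d (s\<^sup>2)"
proof -
  have "h\<^sup>2 dvd g\<^sup>2"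
    using eq \<open>e \<noteq> 0\<close> by (metis dvd_smult_cancel dvd_triv_right)
  then have "h dvd g" by simp
  then obtain g' where g': "g = h * g'" by (auto elim: dvdE)
  have xy: "x * y = smult e (g'\<^sup>2)"
  proof -
    have "h\<^sup>2 * (x * y) = h\<^sup>2 * smult e (g'\<^sup>2)"
      using eq g' by (simp add: power_mult_distrib mult_ac)
    then show ?thesis using \<open>h \<noteq> 0\<close> by (simp del: mult_smult_right)
  qed
  \<comment> \<open>Coprimality gives \<open>gcd(x, g')\<^sup>2 = gcd(x\<^sup>2, x y) = x\<close> up to a unit.\<close>
  define s where "s = gcd x g'"
  have a: "g'\<^sup>2 dvd x * y" "x * y dvd g'\<^sup>2"
    using xy \<open>e \<noteq> 0\<close> by (simp_all add: dvd_smult smult_dvd_iff)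
  have "s\<^sup>2 = gcd (x\<^sup>2) (g'\<^sup>2)" by (simp add: s_def gcd_exp)
  also have "\<dots> = gcd (x * x) (x * y)"
    using associatedI[OF a] by (metis gcd.normalize_right_idem power2_eq_square)
  also have "\<dots> = normalize x"
    using co by (simp add: gcd_mult_left)
  finally have "normalize x = s\<^sup>2" ..
  then have "unit_factor x * s\<^sup>2 = x" by (metis unit_factor_mult_normalize)
  moreover have "unit_factor x = [:lead_coeff x:]"
    by (simp add: unit_factor_poly_def unit_factor_real_def)
  ultimately have x: "x = smult (lead_coeff x) (s\<^sup>2)" by simp
  show ?thesis
  proof (cases "x = 0")
    case True
    then show ?thesis by (intro exI[of _ 1] exI[of _ 0]) simp
  next
    case False
    then show ?thesis using x by (metis leading_coeff_0_iff)
  qed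
qed

lemma fps_X_power_dvd_iff:
  fixes F :: "'a :: comm_ring_1 fps"
  shows "fps_X ^ n dvd F \<longleftrightarrow> (\<forall>i<n. fps_nth F i = 0)"
proof
  assume "\<forall>i<n. fps_nth F i = 0"
  then have "F = fps_X ^ n * fps_shift n F"
    by (intro fps_ext) (auto simp: fps_X_power_mult_nth)
  then show "fps_X ^ n dvd F" by (metis dvd_triv_left)
qed (auto elim!: dvdE simp: fps_X_power_mult_nth)

lemma fps_X_power_dvd_fps_of_poly_iff:
  fixes p :: "'a :: comm_ring_1 poly"
  shows "fps_X ^ n dvd fps_of_poly p \<longleftrightarrow> monom 1 n dvd p"
  by (simp add: fps_X_power_dvd_iff monom_1_dvd_iff')

text \<open>
Since \<open>q\<close> can be used to cancel the low coefficients of \<open>F r\<close>, the divisibility only asks for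
the vanishing of its \<open>k\<close> coefficients of index \<open>s + k - 1, \<dots>, s + 2 k - 2\<close>. These are linear in
the \<open>k\<close> coefficients of \<open>r\<close>, with the Hankel matrix as matrix of the system.
\<close>

lemma hankel_det_eq_0_iff:
  fixes F :: "real fps"
  assumes "k \<ge> 1" "s \<ge> 1"
  shows "hankel_det (fps_nth F) s k = 0 \<longleftrightarrow>
    (\<exists>q r. r \<noteq> 0 \<and> degree r < k \<and> degree q < s + k - 1 \<and>
       fps_X ^ (s + 2 * k - 1) dvd fps_of_poly q + F * fps_of_poly r)"
proof -
  define M where "M = Matrix.mat k k (\<lambda>(i, j). fps_nth F (s + i + j))"
  have M: "M \<in> carrier_mat k k" by (simp add: M_def)
  have coeff_prod: "fps_nth (F * fps_of_poly r) (s + k - 1 + i) =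
      (\<Sum>j<k. fps_nth F (s + i + j) * coeff r (k - 1 - j))" if "degree r < k" for r i
  proof -
    have "fps_nth (F * fps_of_poly r) (s + k - 1 + i) =
        (\<Sum>l=0..s + k - 1 + i. coeff r l * fps_nth F (s + k - 1 + i - l))"
      by (simp add: mult.commute[of F] fps_mult_nth)
    also have "\<dots> = (\<Sum>l<k. coeff r l * fps_nth F (s + k - 1 + i - l))"
      using that assms by (intro sum.mono_neutral_right) (auto simp: coeff_eq_0)
    also have "\<dots> = (\<Sum>j<k. fps_nth F (s + i + j) * coeff r (k - 1 - j))"
      using assms by (intro sum.reindex_bij_witness[of _ "\<lambda>j. k - 1 - j" "\<lambda>j. k - 1 - j"])
        (auto simp: mult_ac intro!: arg_cong2[where f="(*)"] arg_cong[where f="fps_nth F"])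
    finally show ?thesis .
  qed
  have Mx: "M *\<^sub>v x = 0\<^sub>v k \<longleftrightarrow> (\<forall>i<k. (\<Sum>j<k. fps_nth F (s + i + j) * Matrix.vec_index x j) = 0)"
    if "x \<in> carrier_vec k" for x
    using that by (auto simp: M_def Matrix.vec_eq_iff scalar_prod_def lessThan_atLeast0)
  have "hankel_det (fps_nth F) s k = 0 \<longleftrightarrow> (\<exists>x. x \<in> carrier_vec k \<and> x \<noteq> 0\<^sub>v k \<and> M *\<^sub>v x = 0\<^sub>v k)"
    unfolding hankel_det_def M_def[symmetric] by (rule det_0_iff_vec_prod_zero[OF M])
  also have "\<dots> \<longleftrightarrow> (\<exists>r. r \<noteq> 0 \<and> degree r < k \<and>
      (\<forall>i<k. fps_nth (F * fps_of_poly r) (s + k - 1 + i) = 0))"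
  proof safe
    fix x assume x: "x \<in> carrier_vec k" "x \<noteq> 0\<^sub>v k" "M *\<^sub>v x = 0\<^sub>v k"
    \<comment> \<open>The kernel vector is read backwards, which turns the Hankel product into a convolution.\<close>
    define r where "r = (\<Sum>j<k. monom (Matrix.vec_index x (k - 1 - j)) j)"
    have cr: "coeff r j = (if j < k then Matrix.vec_index x (k - 1 - j) else 0)" for j
      by (simp add: r_def coeff_sum)
    have deg: "degree r < k"
      using assms by (intro degree_lessI) (auto simp: cr)
    moreover have "r \<noteq> 0"
    proof
      assume "r = 0"
      then have "Matrix.vec_index x j = 0" if "j < k" for j
        using cr[of "k - 1 - j"] that by simp
      then have "x = 0\<^sub>v k" using x(1) by (intro eq_vecI) auto
      with x show False by blast
    qed
    moreover have "fps_nth (F * fps_of_poly r) (s + k - 1 + i) = 0" if "i < k" for i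
    proof -
      have "fps_nth (F * fps_of_poly r) (s + k - 1 + i) =
          (\<Sum>j<k. fps_nth F (s + i + j) * Matrix.vec_index x j)"
        unfolding coeff_prod[OF deg] by (intro sum.cong) (auto simp: cr)
      moreover have "\<dots> = 0" using Mx[OF x(1)] x(3) that by blast
      ultimately show ?thesis by simp
    qed
    ultimately show "\<exists>r. r \<noteq> 0 \<and> degree r < k \<and>
      (\<forall>i<k. fps_nth (F * fps_of_poly r) (s + k - 1 + i) = 0)" by blast
  next
    fix r :: "real poly"
    assume r: "r \<noteq> 0" "degree r < k" "\<forall>i<k. fps_nth (F * fps_of_poly r) (s + k - 1 + i) = 0"
    define x where "x = Matrix.vec k (\<lambda>j. coeff r (k - 1 - j))"
    have "Matrix.vec_index x (k - 1 - degree r) \<noteq> 0"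
      using r by (simp add: x_def)
    then have "x \<noteq> 0\<^sub>v k" using r by auto
    moreover have "M *\<^sub>v x = 0\<^sub>v k"
    proof -
      have "(\<Sum>j<k. fps_nth F (s + i + j) * Matrix.vec_index x j) =
          fps_nth (F * fps_of_poly r) (s + k - 1 + i)" for i
        unfolding coeff_prod[OF r(2)] by (intro sum.cong) (auto simp: x_def)
      moreover have "x \<in> carrier_vec k" by (simp add: x_def)
      ultimately show ?thesis using r(3) Mx by auto
    qed
    ultimately show "\<exists>x. x \<in> carrier_vec k \<and> x \<noteq> 0\<^sub>v k \<and> M *\<^sub>v x = 0\<^sub>v k"
      by (intro exI[of _ x]) (auto simp: x_def)
  qed
  also have "\<dots> \<longleftrightarrow> (\<exists>q r. r \<noteq> 0 \<and> degree r < k \<and> degree q < s + k - 1 \<and>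
       fps_X ^ (s + 2 * k - 1) dvd fps_of_poly q + F * fps_of_poly r)"
  proof safe
    fix r :: "real poly"
    assume r: "r \<noteq> 0" "degree r < k" "\<forall>i<k. fps_nth (F * fps_of_poly r) (s + k - 1 + i) = 0"
    define q where "q = - truncate_fps (s + k - 1) (F * fps_of_poly r)"
    have "degree q < s + k - 1"
      using assms by (simp add: q_def degree_truncate_fps)
    moreover have "fps_nth (fps_of_poly q + F * fps_of_poly r) j = 0" if "j < s + 2 * k - 1" for j
    proof (cases "j < s + k - 1")
      case True
      then show ?thesis by (simp add: q_def coeff_truncate_fps)
    next
      case False
      define i where "i = j - (s + k - 1)"
      have "j = s + k - 1 + i" "i < k" using that False by (auto simp: i_def)
      then have "fps_nth (F * fps_of_poly r) j = 0" using r(3) by blast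
      then show ?thesis using False by (simp add: q_def coeff_truncate_fps)
    qed
    ultimately show "\<exists>q r. r \<noteq> 0 \<and> degree r < k \<and> degree q < s + k - 1 \<and>
       fps_X ^ (s + 2 * k - 1) dvd fps_of_poly q + F * fps_of_poly r"
      using r by (auto simp: fps_X_power_dvd_iff)
  next
    fix q r :: "real poly"
    assume r: "r \<noteq> 0" "degree r < k" "degree q < s + k - 1"
      "fps_X ^ (s + 2 * k - 1) dvd fps_of_poly q + F * fps_of_poly r"
    have "fps_nth (F * fps_of_poly r) (s + k - 1 + i) = 0" if "i < k" for i
    proof -
      have "fps_nth (fps_of_poly q + F * fps_of_poly r) (s + k - 1 + i) = 0"
        using r(4) that assms unfolding fps_X_power_dvd_iff by auto
      moreover have "coeff q (s + k - 1 + i) = 0" using r(3) by (intro coeff_eq_0) auto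
      ultimately show ?thesis by simp
    qed
    then show "\<exists>r. r \<noteq> 0 \<and> degree r < k \<and>
      (\<forall>i<k. fps_nth (F * fps_of_poly r) (s + k - 1 + i) = 0)" using r by blast
  qed
  finally show ?thesis .
qed

text \<open>
If \<open>F\<close> were not zero, dividing it by \<open>X\<^sup>d\<close> with \<open>d\<close> its order would give a function that is
continuous and nonzero at \<open>0\<close>, but zero at all nearby points.
\<close>

lemma zero_has_fps_expansion_imp_eq_0:
  fixes F :: "real fps"
  assumes "(\<lambda>_. 0) has_fps_expansion F"
  shows "F = 0"
proof (rule ccontr)
  assume "F \<noteq> 0"
  define d where "d = subdegree F"
  define G where "G = fps_shift d F"
  have r: "fps_conv_radius F > 0" and ev: "eventually (\<lambda>z. eval_fps F z = 0) (nhds 0)"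
    using assms by (auto simp: has_fps_expansion_def)
  have rG: "fps_conv_radius G = fps_conv_radius F" by (simp add: G_def)
  have "isCont (eval_fps G) 0"
    using r rG by (intro continuous_eval_fps) (simp add: zero_ereal_def)
  moreover have "eval_fps G 0 \<noteq> 0"
    using \<open>F \<noteq> 0\<close> by (simp add: G_def d_def eval_fps_at_0)
  ultimately have "eventually (\<lambda>z. eval_fps G z \<noteq> 0) (at 0)"
    unfolding isCont_def by (rule tendsto_imp_eventually_ne)
  moreover have "eventually (\<lambda>z. eval_fps F z = 0) (at 0)"
    using ev by (simp add: eventually_nhds_conv_at)
  moreover have "eventually (\<lambda>z::real. z \<in> eball 0 (fps_conv_radius F)) (nhds 0)"
    using r by (intro eventually_nhds_in_open) (auto simp: zero_ereal_def)
  then have "eventually (\<lambda>z::real. z \<in> eball 0 (fps_conv_radius F)) (at 0)"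
    by (simp add: eventually_nhds_conv_at)
  moreover have "eventually (\<lambda>z::real. z \<noteq> 0) (at 0)"
    by (simp add: eventually_at_filter)
  ultimately have "eventually (\<lambda>z::real. False) (at 0)"
    by eventually_elim (auto simp: G_def d_def eval_fps_shift in_eball_iff)
  then show False by simp
qed

lemma has_fps_expansion_unique:
  fixes F G :: "real fps"
  assumes "f has_fps_expansion F" "f has_fps_expansion G"
  shows "F = G"
  using zero_has_fps_expansion_imp_eq_0[of "F - G"] has_fps_expansion_diff[OF assms] by simp

lemma has_fps_expansion_poly:
  fixes p :: "'a :: {banach, real_normed_div_algebra, comm_ring_1} poly"
  shows "poly p has_fps_expansion fps_of_poly p"
proof (induction p)
  case 0
  then show ?case by simp
next
  case (pCons c p)
  have "(\<lambda>x. c + x * poly p x) has_fps_expansion (fps_const c + fps_X * fps_of_poly p)"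
    by (intro fps_expansion_intros pCons)
  then show ?case by (simp add: fps_of_poly_pCons mult_ac add_ac)
qed

text \<open>
All that is used later of the two Taylor series in question is that their square is \<open>T / S\<close>
and that their constant term does not vanish.
\<close>

lemma sqrt_expansion:
  fixes F :: "real fps" and g :: "real \<Rightarrow> real" and S T :: "real poly"
  assumes F: "(\<lambda>x. sqrt (g x)) has_fps_expansion F"
    and g: "eventually (\<lambda>x. poly S x * g x = poly T x) (nhds 0)"
    and cont: "isCont g 0" and pos: "g 0 > 0"
  shows "fps_of_poly S * F\<^sup>2 = fps_of_poly T" "fps_nth F 0 > 0"
proof -
  have "eventually (\<lambda>x. g x > 0) (at 0)"
    using order_tendstoD(1)[OF cont[unfolded isCont_def] pos] .
  then have ev: "eventually (\<lambda>x. g x > 0) (nhds 0)"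
    using pos by (simp add: eventually_nhds_conv_at)
  have "(\<lambda>x. poly S x * (sqrt (g x) * sqrt (g x))) has_fps_expansion fps_of_poly S * (F * F)"
    by (intro has_fps_expansion_mult has_fps_expansion_poly F)
  moreover have "eventually (\<lambda>x. poly S x * (sqrt (g x) * sqrt (g x)) = poly T x) (nhds 0)"
    using g ev by eventually_elim simp
  ultimately have "poly T has_fps_expansion fps_of_poly S * (F * F)"
    unfolding has_fps_expansion_def by (auto elim: eventually_elim2)
  then show "fps_of_poly S * F\<^sup>2 = fps_of_poly T"
    unfolding power2_eq_square by (rule has_fps_expansion_unique) (rule has_fps_expansion_poly)
  have "sqrt (g 0) = fps_nth F 0"
    using F by (auto simp: has_fps_expansion_def eval_fps_at_0 dest: eventually_nhds_x_imp_x)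
  then show "fps_nth F 0 > 0" using pos by (metis real_sqrt_gt_zero)
qed

section \<open>Polynomial matrices and null directions\<close>

lemma fps_X_power_dvd_mult_unit:
  fixes u F :: "real fps"
  assumes "fps_X ^ k dvd u * F" "fps_nth F 0 \<noteq> 0"
  shows "fps_X ^ k dvd u"
  using assms by (metis dvd_mult_unit_iff fps_is_unit_iff)

text \<open>
With \<open>Y\<^sup>2 = - det N\<close>, the vectors \<open>(1, H)\<close> and \<open>(Z, 1)\<close> are null vectors of the binary quadratic
form with matrix \<open>N\<close>. Written with the denominator \<open>N12 + Y\<close>, which is a unit of \<open>\<real>[[X]]\<close> for the
right choice of the sign of \<open>Y\<close>, they have power series as coordinates.
\<close>

lemma null_vectors:
  fixes N11 N12 N22 Y H Z :: "real fps"
  assumes Y: "Y\<^sup>2 = N12\<^sup>2 - N11 * N22" and u: "fps_nth (N12 + Y) 0 \<noteq> 0"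
    and H: "(N12 + Y) * H = - N11" and Z: "(N12 + Y) * Z = - N22"
  shows "N11 + N12 * H = - Y * H" "N12 + N22 * H = Y" "N11 * Z + N12 = Y" "N12 * Z + N22 = - Y * Z"
proof -
  have u0: "N12 + Y \<noteq> 0" using u by (metis fps_zero_nth)
  have "N11 + N12 * H = N11 + (N12 + Y) * H - Y * H" "N12 * Z + N22 = N22 + (N12 + Y) * Z - Y * Z"
    by (simp_all add: algebra_simps)
  then show "N11 + N12 * H = - Y * H" "N12 * Z + N22 = - Y * Z"
    unfolding H Z by simp_all
  have "(N12 + Y) * (N12 + N22 * H - Y) = N12\<^sup>2 - Y\<^sup>2 + N22 * ((N12 + Y) * H)"
    by (simp add: algebra_simps power2_eq_square)
  also have "\<dots> = 0" unfolding H Y by (simp add: algebra_simps)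
  finally show "N12 + N22 * H = Y" using u0 by simp
  have "(N12 + Y) * (N11 * Z + N12 - Y) = N12\<^sup>2 - Y\<^sup>2 + N11 * ((N12 + Y) * Z)"
    by (simp add: algebra_simps power2_eq_square)
  also have "\<dots> = 0" unfolding Z Y by (simp add: algebra_simps)
  finally show "N11 * Z + N12 = Y" using u0 by simp
qed

text \<open>
A matrix that turns the form \<open>N\<close> into \<open>\<Delta> M\<close> maps null directions of \<open>M\<close> to null directions of \<open>N\<close>,
and its adjugate maps them back. Null directions are eigendirections of \<open>J N\<close>, and the
eigenvalue \<open>\<plusminus>Y\<close> tells which direction goes to which.
\<close>

lemma null_vectors_transported:
  fixes A B C D N11 N12 N22 M11 M12 M22 Y H Z H' Z' :: "real fps"
  assumes det: "A * D - B * C = \<Delta>" "\<Delta> \<noteq> 0"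
    and form: "A\<^sup>2 * N11 + 2 * A * C * N12 + C\<^sup>2 * N22 = \<Delta> * M11"
      "A * B * N11 + (A * D + B * C) * N12 + C * D * N22 = \<Delta> * M12"
      "B\<^sup>2 * N11 + 2 * B * D * N12 + D\<^sup>2 * N22 = \<Delta> * M22"
    and nullH: "N11 + N12 * H = - Y * H" "N12 + N22 * H = Y"
    and nullZ: "N11 * Z + N12 = Y" "N12 * Z + N22 = - Y * Z"
    and u': "fps_nth (M12 + Y) 0 \<noteq> 0"
    and H': "(M12 + Y) * H' = - M11" and Z': "(M12 + Y) * Z' = - M22"
  shows "A * H - C = (D - B * H) * H'" "D * Z - B = (A - C * Z) * Z'"
proof -
  have u0: "M12 + Y \<noteq> 0" using u' by (metis fps_zero_nth)
  have "\<Delta> * ((D - B * H) * M11 + (A * H - C) * (M12 + Y)) =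
     (D - B * H) * (\<Delta> * M11) + (A * H - C) * (\<Delta> * M12) + \<Delta> * Y * (A * H - C)"
    by (simp add: algebra_simps)
  also have "\<dots> = (A * D - B * C) * (A * (N11 + N12 * H) + C * (N12 + N22 * H)) + \<Delta> * Y * (A * H - C)"
    unfolding form[symmetric] by (simp add: algebra_simps power2_eq_square)
  also have "\<dots> = 0" unfolding nullH det by (simp add: algebra_simps)
  finally have "(D - B * H) * M11 + (A * H - C) * (M12 + Y) = 0" using det by simp
  then have "(M12 + Y) * (A * H - C - (D - B * H) * H') = - (D - B * H) * (M11 + (M12 + Y) * H')"
    by (simp add: algebra_simps add_eq_0_iff)
  also have "\<dots> = 0" unfolding H' by simp
  finally show "A * H - C = (D - B * H) * H'" using u0 by simp
  have "\<Delta> * ((D * Z - B) * (M12 + Y) + (A - C * Z) * M22) =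
     (D * Z - B) * (\<Delta> * M12) + (A - C * Z) * (\<Delta> * M22) + \<Delta> * Y * (D * Z - B)"
    by (simp add: algebra_simps)
  also have "\<dots> = (A * D - B * C) * (B * (N11 * Z + N12) + D * (N12 * Z + N22)) + \<Delta> * Y * (D * Z - B)"
    unfolding form[symmetric] by (simp add: algebra_simps power2_eq_square)
  also have "\<dots> = 0" unfolding nullZ det by (simp add: algebra_simps)
  finally have "(D * Z - B) * (M12 + Y) + (A - C * Z) * M22 = 0" using det by simp
  then have "(M12 + Y) * (D * Z - B - (A - C * Z) * Z') = - (A - C * Z) * (M22 + (M12 + Y) * Z')"
    by (simp add: algebra_simps add_eq_0_iff)
  also have "\<dots> = 0" unfolding Z' by simp
  finally show "D * Z - B = (A - C * Z) * Z'" using u0 by simp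
qed

lemma ex_fps_quotient:
  fixes u x :: "real fps"
  assumes "fps_nth u 0 \<noteq> 0"
  shows "\<exists>q. u * q = x"
proof -
  have "u dvd x" using assms by (metis fps_is_unit_iff unit_imp_dvd)
  then show ?thesis by (auto elim!: dvdE)
qed

text \<open>
The matrix \<open>\<Theta>\<close> with entries \<open>A, B, C, D\<close> carries \<open>N\<close> to \<open>X\<^sup>2\<^sup>l M\<close>, and \<open>\<Theta>' = f + g J N\<close> commutes with
\<open>J N\<close>. The conclusion \<open>\<Theta>' = \<Theta> W\<close> with a polynomial matrix \<open>W\<close> says that the adjugate of \<open>\<Theta>\<close> times \<open>\<Theta>'\<close>
is divisible by \<open>X\<^sup>2\<^sup>l\<close>, and this can be tested on the basis \<open>(1, H), (Z, 1)\<close> of null vectors over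
\<open>\<real>[[X]]\<close>: on \<open>(1, H)\<close> the matrix \<open>\<Theta>'\<close> is multiplication by \<open>f - g Y = O(X\<^sup>2\<^sup>n)\<close>; on \<open>(Z, 1)\<close> the
adjugate contributes the factor \<open>X\<^sup>2\<^sup>l\<close>, because its determinant is \<open>X\<^sup>2\<^sup>l\<close> and \<open>D(0) \<noteq> 0\<close> makes it a
unit on \<open>(1, H)\<close>. The remaining conclusions keep the information about \<open>W\<close> on the two null
vectors.
\<close>

lemma factor_through_transfer:
  fixes A B C D f g N11 N12 N22 M11 M12 M22 :: "real poly" and Y :: "real fps"
  assumes det: "A * D - B * C = monom 1 (2 * l)" and D0: "poly D 0 \<noteq> 0"
    and form: "A\<^sup>2 * N11 + 2 * A * C * N12 + C\<^sup>2 * N22 = monom 1 (2 * l) * M11"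
      "A * B * N11 + (A * D + B * C) * N12 + C * D * N22 = monom 1 (2 * l) * M12"
      "B\<^sup>2 * N11 + 2 * B * D * N12 + D\<^sup>2 * N22 = monom 1 (2 * l) * M22"
    and N0: "poly N11 0 = 0" "poly N12 0 \<noteq> 0" and M0: "poly M11 0 = 0" "poly M12 0 = poly N12 0"
    and Y: "Y\<^sup>2 = fps_of_poly (N12\<^sup>2 - N11 * N22)" "fps_nth Y 0 = poly N12 0"
    and fg: "fps_X ^ (2 * n) dvd fps_of_poly f - fps_of_poly g * Y"
    and deg: "degree A \<le> l" "degree B \<le> l" "degree C \<le> l" "degree D \<le> l"
      "degree (f - g * N12) \<le> n" "degree (g * N11) \<le> n" "degree (g * N22) \<le> n" "degree (f + g * N12) \<le> n"
    and "l \<le> n"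
  obtains W11 W12 W21 W22 :: "real poly" and H Z H' Z' :: "real fps" where
    "degree W11 \<le> n - l" "degree W12 \<le> n - l" "degree W21 \<le> n - l" "degree W22 \<le> n - l"
    "f - g * N12 = A * W11 + B * W21" "- g * N22 = A * W12 + B * W22"
    "g * N11 = C * W11 + D * W21" "f + g * N12 = C * W12 + D * W22"
    "(fps_of_poly N12 + Y) * H = - fps_of_poly N11" "fps_nth H' 0 = 0"
    "fps_X ^ (2 * (n - l)) dvd fps_of_poly W11 + fps_of_poly W12 * H"
    "fps_of_poly W21 + fps_of_poly W22 * H = (fps_of_poly W11 + fps_of_poly W12 * H) * H'"
    "fps_of_poly W11 * Z + fps_of_poly W12 = (fps_of_poly W21 * Z + fps_of_poly W22) * Z'"
proof -
  let ?F = "fps_of_poly :: real poly \<Rightarrow> real fps"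
  let ?X = "fps_X ^ (2 * l) :: real fps"
  note F = fps_of_poly_add fps_of_poly_diff fps_of_poly_uminus fps_of_poly_mult fps_of_poly_power
    fps_of_poly_monom'
  have nth0: "fps_nth (?F p) 0 = poly p 0" for p by (simp add: poly_0_coeff_0)
  have u: "fps_nth (?F N12 + Y) 0 \<noteq> 0" "fps_nth (?F M12 + Y) 0 \<noteq> 0"
    using N0 M0 Y by (simp_all add: nth0 del: fps_of_poly_nth)
  obtain H Z H' Z' where H: "(?F N12 + Y) * H = - ?F N11" and Z: "(?F N12 + Y) * Z = - ?F N22"
    and H': "(?F M12 + Y) * H' = - ?F M11" and Z': "(?F M12 + Y) * Z' = - ?F M22"
    using ex_fps_quotient[OF u(1)] ex_fps_quotient[OF u(2)] by metis
  have "fps_nth ((?F N12 + Y) * H) 0 = 0" "fps_nth ((?F M12 + Y) * H') 0 = 0"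
    unfolding H H' using N0 M0 by (simp_all add: nth0 del: fps_of_poly_nth)
  then have H0: "fps_nth H 0 = 0" "fps_nth H' 0 = 0" using u by simp_all
  have form': "(?F A)\<^sup>2 * ?F N11 + 2 * ?F A * ?F C * ?F N12 + (?F C)\<^sup>2 * ?F N22 = ?X * ?F M11"
    "?F A * ?F B * ?F N11 + (?F A * ?F D + ?F B * ?F C) * ?F N12 + ?F C * ?F D * ?F N22 = ?X * ?F M12"
    "(?F B)\<^sup>2 * ?F N11 + 2 * ?F B * ?F D * ?F N12 + (?F D)\<^sup>2 * ?F N22 = ?X * ?F M22"
    using form[THEN arg_cong[where f="?F"]] by (simp_all add: F)
  have det': "?F A * ?F D - ?F B * ?F C = ?X"
    using det[THEN arg_cong[where f="?F"]] by (simp add: F)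
  have Y': "Y\<^sup>2 = (?F N12)\<^sup>2 - ?F N11 * ?F N22" using Y by (simp add: F)
  note null = null_vectors[OF Y' u(1) H Z]
  have tr: "?F A * H - ?F C = (?F D - ?F B * H) * H'" "?F D * Z - ?F B = (?F A - ?F C * Z) * Z'"
    using null_vectors_transported[OF det' _ form' null u(2) H' Z'] by auto
  \<comment> \<open>The adjugate of \<open>\<Theta>\<close> maps \<open>(1, H)\<close> to \<open>c (1, H')\<close> and \<open>(Z, 1)\<close> to \<open>c2 (Z', 1)\<close>.\<close>
  define c where "c = ?F D - ?F B * H"
  define c2 where "c2 = ?F A - ?F C * Z"
  have c0: "fps_nth c 0 \<noteq> 0" using D0 H0 by (simp add: c_def nth0 del: fps_of_poly_nth)
  \<comment> \<open>The entries of the adjugate of \<open>\<Theta>\<close> times \<open>\<Theta>'\<close>.\<close>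
  define E11 where "E11 = D * (f - g * N12) - B * (g * N11)"
  define E12 where "E12 = - (D * (g * N22)) - B * (f + g * N12)"
  define E21 where "E21 = A * (g * N11) - C * (f - g * N12)"
  define E22 where "E22 = C * (g * N22) + A * (f + g * N12)"
  have EH: "?F E11 + ?F E12 * H = (?F f - ?F g * Y) * c"
    "?F E21 + ?F E22 * H = (?F f - ?F g * Y) * (c * H')"
  proof -
    have "?F E11 + ?F E12 * H = ?F f * c - ?F g * (?F D * (?F N12 + ?F N22 * H) + ?F B * (?F N11 + ?F N12 * H))"
      by (simp add: E11_def E12_def F c_def algebra_simps)
    also have "\<dots> = (?F f - ?F g * Y) * c"
      unfolding null by (simp add: c_def algebra_simps)
    finally show "?F E11 + ?F E12 * H = (?F f - ?F g * Y) * c" .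
    have "?F E21 + ?F E22 * H = ?F f * (?F A * H - ?F C) +
        ?F g * (?F C * (?F N12 + ?F N22 * H) + ?F A * (?F N11 + ?F N12 * H))"
      by (simp add: E21_def E22_def F algebra_simps)
    also have "\<dots> = (?F f - ?F g * Y) * (?F A * H - ?F C)"
      unfolding null by (simp add: algebra_simps)
    finally show "?F E21 + ?F E22 * H = (?F f - ?F g * Y) * (c * H')"
      unfolding tr by (simp add: c_def)
  qed
  have EZ: "?F E11 * Z + ?F E12 = (?F f + ?F g * Y) * (c2 * Z')"
    "?F E21 * Z + ?F E22 = (?F f + ?F g * Y) * c2"
  proof -
    have "?F E11 * Z + ?F E12 = ?F f * (?F D * Z - ?F B) -
        ?F g * (?F D * (?F N12 * Z + ?F N22) + ?F B * (?F N11 * Z + ?F N12))"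
      by (simp add: E11_def E12_def F algebra_simps)
    also have "\<dots> = (?F f + ?F g * Y) * (?F D * Z - ?F B)"
      unfolding null by (simp add: algebra_simps)
    finally show "?F E11 * Z + ?F E12 = (?F f + ?F g * Y) * (c2 * Z')"
      unfolding tr by (simp add: c2_def)
    have "?F E21 * Z + ?F E22 = ?F f * c2 +
        ?F g * (?F C * (?F N12 * Z + ?F N22) + ?F A * (?F N11 * Z + ?F N12))"
      by (simp add: E21_def E22_def F c2_def algebra_simps)
    also have "\<dots> = (?F f + ?F g * Y) * c2"
      unfolding null by (simp add: c2_def algebra_simps)
    finally show "?F E21 * Z + ?F E22 = (?F f + ?F g * Y) * c2" .
  qed
  have X2n: "?X dvd ?F f - ?F g * Y"
    using fg \<open>l \<le> n\<close> by (meson dvd_trans le_imp_power_dvd mult_le_mono2)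
  have Xc2: "?X dvd c2"
  proof -
    have "c2 * (c * (1 - H' * Z')) = (?F D - ?F B * H) * (?F A - ?F C * Z) - ((?F A - ?F C * Z) * Z') * ((?F D - ?F B * H) * H')"
      by (simp add: c_def c2_def algebra_simps)
    also have "\<dots> = (?F A * ?F D - ?F B * ?F C) * (1 - H * Z)"
      unfolding tr[symmetric] by (simp add: algebra_simps)
    finally have "?X dvd c2 * (c * (1 - H' * Z'))" unfolding det' by simp
    then show ?thesis using c0 H0 by (elim fps_X_power_dvd_mult_unit) simp
  qed
  have u3: "fps_nth (1 - H * Z) 0 \<noteq> 0" using H0 by simp
  have XE: "?X dvd ?F E12" "?X dvd ?F E22"
  proof -
    have "?F E12 * (1 - H * Z) = (?F E11 * Z + ?F E12) - Z * (?F E11 + ?F E12 * H)"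
      by (simp add: algebra_simps)
    then have "?X dvd ?F E12 * (1 - H * Z)" unfolding EZ EH using X2n Xc2
      by (metis dvd_diff dvd_mult dvd_mult2)
    then show "?X dvd ?F E12" using u3 by (rule fps_X_power_dvd_mult_unit)
    have "?F E22 * (1 - H * Z) = (?F E21 * Z + ?F E22) - Z * (?F E21 + ?F E22 * H)"
      by (simp add: algebra_simps)
    then have "?X dvd ?F E22 * (1 - H * Z)" unfolding EZ EH using X2n Xc2
      by (metis dvd_diff dvd_mult dvd_mult2)
    then show "?X dvd ?F E22" using u3 by (rule fps_X_power_dvd_mult_unit)
  qed
  have XE': "?X dvd ?F E11" "?X dvd ?F E21"
  proof -
    have "?F E11 = (?F f - ?F g * Y) * c - ?F E12 * H" unfolding EH[symmetric] by simp
    then show "?X dvd ?F E11" using X2n XE by (metis dvd_diff dvd_mult2)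
    have "?F E21 = (?F f - ?F g * Y) * (c * H') - ?F E22 * H" unfolding EH[symmetric] by simp
    then show "?X dvd ?F E21" using X2n XE by (metis dvd_diff dvd_mult2)
  qed
  obtain W11 W12 W21 W22 where W: "E11 = monom 1 (2 * l) * W11" "E12 = monom 1 (2 * l) * W12"
      "E21 = monom 1 (2 * l) * W21" "E22 = monom 1 (2 * l) * W22"
    using XE XE' unfolding fps_X_power_dvd_fps_of_poly_iff by (auto elim!: dvdE)
  have degW: "degree W \<le> n - l" if "monom 1 (2 * l) * W = E" "degree E \<le> l + n" for W E :: "real poly"
  proof (cases "W = 0")
    case False
    then have "degree E = 2 * l + degree W"
      using that(1) by (auto simp: degree_mult_eq degree_monom_eq)
    then show ?thesis using that(2) by simp
  qed simp
  have dm: "degree (x * y) \<le> l + n" if "degree x \<le> l" "degree y \<le> n" for x y :: "real poly"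
    using degree_mult_le[of x y] that by linarith
  have degE: "degree E11 \<le> l + n" "degree E12 \<le> l + n" "degree E21 \<le> l + n" "degree E22 \<le> l + n"
    unfolding E11_def E12_def E21_def E22_def
    by (intro degree_diff_le degree_add_le dm deg; simp add: dm deg)+
  have cancel: "x = y" if "monom 1 (2 * l) * x = monom 1 (2 * l) * y" for x y :: "real poly"
    using that by simp
  have "monom 1 (2 * l) * (A * W11 + B * W21) = monom 1 (2 * l) * (f - g * N12)"
    "monom 1 (2 * l) * (A * W12 + B * W22) = monom 1 (2 * l) * (- g * N22)"
    "monom 1 (2 * l) * (C * W11 + D * W21) = monom 1 (2 * l) * (g * N11)"
    "monom 1 (2 * l) * (C * W12 + D * W22) = monom 1 (2 * l) * (f + g * N12)"
  proof -
    have "monom 1 (2 * l) * (A * W11 + B * W21) = A * E11 + B * E21"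
      "monom 1 (2 * l) * (A * W12 + B * W22) = A * E12 + B * E22"
      "monom 1 (2 * l) * (C * W11 + D * W21) = C * E11 + D * E21"
      "monom 1 (2 * l) * (C * W12 + D * W22) = C * E12 + D * E22"
      unfolding W by (simp_all add: algebra_simps)
    then show "monom 1 (2 * l) * (A * W11 + B * W21) = monom 1 (2 * l) * (f - g * N12)"
      "monom 1 (2 * l) * (A * W12 + B * W22) = monom 1 (2 * l) * (- g * N22)"
      "monom 1 (2 * l) * (C * W11 + D * W21) = monom 1 (2 * l) * (g * N11)"
      "monom 1 (2 * l) * (C * W12 + D * W22) = monom 1 (2 * l) * (f + g * N12)"
      unfolding det[symmetric] E11_def E12_def E21_def E22_def by (simp_all add: algebra_simps)
  qed
  note MW = this[THEN cancel]
  have FW: "?F E11 = ?X * ?F W11" "?F E12 = ?X * ?F W12" "?F E21 = ?X * ?F W21" "?F E22 = ?X * ?F W22"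
    unfolding W by (simp_all add: F)
  have Xcancel: "x = y" if "?X * x = ?X * y" for x y :: "real fps"
    using that by simp
  have WH: "?F W21 + ?F W22 * H = (?F W11 + ?F W12 * H) * H'"
  proof (rule Xcancel)
    have "?X * (?F W21 + ?F W22 * H) = ?F E21 + ?F E22 * H"
      unfolding FW by (simp only: algebra_simps)
    also have "\<dots> = (?F E11 + ?F E12 * H) * H'" unfolding EH by (simp only: mult.assoc)
    also have "\<dots> = ?X * ((?F W11 + ?F W12 * H) * H')"
      unfolding FW by (simp only: algebra_simps)
    finally show "?X * (?F W21 + ?F W22 * H) = ?X * ((?F W11 + ?F W12 * H) * H')" .
  qed
  have WZ: "?F W11 * Z + ?F W12 = (?F W21 * Z + ?F W22) * Z'"
  proof (rule Xcancel)
    have "?X * (?F W11 * Z + ?F W12) = ?F E11 * Z + ?F E12"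
      unfolding FW by (simp only: algebra_simps)
    also have "\<dots> = (?F E21 * Z + ?F E22) * Z'" unfolding EZ by (simp only: mult.assoc)
    also have "\<dots> = ?X * ((?F W21 * Z + ?F W22) * Z')"
      unfolding FW by (simp only: algebra_simps)
    finally show "?X * (?F W11 * Z + ?F W12) = ?X * ((?F W21 * Z + ?F W22) * Z')" .
  qed
  have "fps_X ^ (2 * (n - l)) dvd ?F W11 + ?F W12 * H"
  proof -
    have "?X * (?F W11 + ?F W12 * H) = (?F f - ?F g * Y) * c"
      unfolding EH[symmetric] FW by (simp add: algebra_simps)
    moreover have "2 * n = 2 * l + 2 * (n - l)" using \<open>l \<le> n\<close> by simp
    ultimately have "?X * fps_X ^ (2 * (n - l)) dvd ?X * (?F W11 + ?F W12 * H)"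
      using fg by (metis dvd_mult2 power_add)
    then show ?thesis by simp
  qed
  with MW WH WZ H H0 show ?thesis
    using degW[OF W(1)[symmetric] degE(1)] degW[OF W(2)[symmetric] degE(2)]
      degW[OF W(3)[symmetric] degE(3)] degW[OF W(4)[symmetric] degE(4)]
    by (intro that[of W11 W12 W21 W22 H H' Z Z']) simp_all
qed

section \<open>The confocal Gram matrix\<close>

lemma all_3: "(\<forall>i::3. P i) \<longleftrightarrow> P 0 \<and> P 1 \<and> P 2"
proof -
  have *: "(3::3) = 0" by simp
  show ?thesis unfolding forall_3 * by blast
qed

lemma vec3_eq_iff: "(x :: real^3) = y \<longleftrightarrow> x $ 0 = y $ 0 \<and> x $ 1 = y $ 1 \<and> x $ 2 = y $ 2"
  by (simp add: Finite_Cartesian_Product.vec_eq_iff all_3)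

lemma diag_inv_nth [simp]: "diag_inv a x $ i = x $ i / a $ i"
  by (simp add: diag_inv_def)

lemma lorentz_diag_inv_commute: "lorentz x (diag_inv a y) = lorentz (diag_inv a x) y"
  by (simp add: lorentz_def)

text \<open>
The form \<open>det(A - X) \<langle>(A - X)\<^sup>-\<^sup>1x, y\<rangle>\<close>. Multiplying by the determinant makes it polynomial in
\<open>X\<close>; its zeros in \<open>x = y\<close> at \<open>X = \<nu>\<close> are the points of the confocal cone with parameter \<open>\<nu>\<close>.
\<close>

definition gram_poly :: "real^3 \<Rightarrow> real^3 \<Rightarrow> real^3 \<Rightarrow> real poly" where
  "gram_poly a x y =
     smult (- (x $ 0 * y $ 0)) ([:a $ 1, -1:] * [:a $ 2, -1:]) +
     smult (x $ 1 * y $ 1) ([:a $ 0, -1:] * [:a $ 2, -1:]) +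
     smult (x $ 2 * y $ 2) ([:a $ 0, -1:] * [:a $ 1, -1:])"

lemma poly_gram_poly:
  "poly (gram_poly a x y) t = - (x $ 0 * y $ 0) * ((a $ 1 - t) * (a $ 2 - t)) +
     x $ 1 * y $ 1 * ((a $ 0 - t) * (a $ 2 - t)) + x $ 2 * y $ 2 * ((a $ 0 - t) * (a $ 1 - t))"
  unfolding gram_poly_def poly_add poly_smult poly_mult by simp

lemma gram_poly_pCons: "\<exists>c d. gram_poly a x y = [:c, d, lorentz x y:]"
proof -
  have "gram_poly a x y =
    [:- (x $ 0 * y $ 0) * (a $ 1 * a $ 2) + x $ 1 * y $ 1 * (a $ 0 * a $ 2) + x $ 2 * y $ 2 * (a $ 0 * a $ 1),
      x $ 0 * y $ 0 * (a $ 1 + a $ 2) - x $ 1 * y $ 1 * (a $ 0 + a $ 2) - x $ 2 * y $ 2 * (a $ 0 + a $ 1),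
      lorentz x y:]"
    by (simp add: gram_poly_def lorentz_def algebra_simps)
  then show ?thesis by blast
qed

lemma degree_gram_poly: "degree (gram_poly a x y) \<le> 2"
proof -
  obtain c d where e: "gram_poly a x y = [:c, d, lorentz x y:]" using gram_poly_pCons by blast
  show ?thesis unfolding e by (rule degree_le) (simp add: coeff_pCons split: nat.splits)
qed

lemma poly_gram_poly_0:
  assumes "\<forall>i. a $ i \<noteq> 0"
  shows "poly (gram_poly a x y) 0 = a $ 0 * a $ 1 * a $ 2 * lorentz x (diag_inv a y)"
proof -
  define z where "z = diag_inv a y"
  have "y $ i = a $ i * z $ i" for i using assms by (simp add: z_def)
  then show ?thesis unfolding z_def[symmetric] by (simp add: poly_gram_poly lorentz_def algebra_simps)
qed

text \<open>
The linear coefficient vanishes exactly at the points with light-like tangent. There the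
polynomial is \<open>X\<^sup>2\<close>, which is the algebraic reason for counting such reflections twice.
\<close>

lemma gram_poly_boundary_point:
  assumes a: "\<forall>i. a $ i \<noteq> 0" and p: "lorentz p p = 1" "lorentz p (diag_inv a p) = 0"
  shows "gram_poly a p p = [:0, a $ 0 * a $ 1 * a $ 2 * lorentz (diag_inv a p) (diag_inv a p), 1:]"
proof -
  obtain c d where cd: "gram_poly a p p = [:c, d, 1:]" using gram_poly_pCons p by metis
  have c: "c = 0" using poly_gram_poly_0[OF a, of p p] p cd by simp
  have "c + d + 1 = poly (gram_poly a p p) 1" by (simp add: cd)
  moreover have "c - d + 1 = poly (gram_poly a p p) (-1)" by (simp add: cd)
  ultimately have "2 * d = poly (gram_poly a p p) 1 - poly (gram_poly a p p) (- 1)" by simp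
  also have "\<dots> = -2 * (- (p $ 0)\<^sup>2 * (a $ 1 + a $ 2) + (p $ 1)\<^sup>2 * (a $ 0 + a $ 2) + (p $ 2)\<^sup>2 * (a $ 0 + a $ 1))"
    unfolding poly_gram_poly by (simp add: algebra_simps power2_eq_square)
  finally have d: "d = - (- (p $ 0)\<^sup>2 * (a $ 1 + a $ 2) + (p $ 1)\<^sup>2 * (a $ 0 + a $ 2) + (p $ 2)\<^sup>2 * (a $ 0 + a $ 1))"
    by simp
  define x where "x i = p $ i / a $ i" for i
  have x: "p $ i = a $ i * x i" for i using a by (simp add: x_def)
  have p2: "- (a $ 0 * (x 0)\<^sup>2) + a $ 1 * (x 1)\<^sup>2 + a $ 2 * (x 2)\<^sup>2 = 0"
    using p(2) a unfolding lorentz_def diag_inv_nth x by (simp add: power2_eq_square mult_ac)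
  have "lorentz (diag_inv a p) (diag_inv a p) = - (x 0)\<^sup>2 + (x 1)\<^sup>2 + (x 2)\<^sup>2"
    by (simp add: lorentz_def x_def power2_eq_square)
  moreover have "d - a $ 0 * a $ 1 * a $ 2 * (- (x 0)\<^sup>2 + (x 1)\<^sup>2 + (x 2)\<^sup>2) =
     - (a $ 0 * a $ 1 + a $ 0 * a $ 2 + a $ 1 * a $ 2) * (- (a $ 0 * (x 0)\<^sup>2) + a $ 1 * (x 1)\<^sup>2 + a $ 2 * (x 2)\<^sup>2)"
    unfolding d x by (simp add: algebra_simps power2_eq_square)
  ultimately have "d = a $ 0 * a $ 1 * a $ 2 * lorentz (diag_inv a p) (diag_inv a p)"
    using p2 by simp
  then show ?thesis using cd c by simp
qed

text \<open>
The Euclidean cross product, with coordinates numbered from \<open>0\<close> as in the rest of the theory.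
\<close>

definition cross :: "real^3 \<Rightarrow> real^3 \<Rightarrow> real^3" where
  "cross x y = (\<chi> i. if i = 0 then x $ 1 * y $ 2 - x $ 2 * y $ 1
     else if i = 1 then x $ 2 * y $ 0 - x $ 0 * y $ 2 else x $ 0 * y $ 1 - x $ 1 * y $ 0)"

lemma cross_nth [simp]:
  "cross x y $ 0 = x $ 1 * y $ 2 - x $ 2 * y $ 1"
  "cross x y $ 1 = x $ 2 * y $ 0 - x $ 0 * y $ 2"
  "cross x y $ 2 = x $ 0 * y $ 1 - x $ 1 * y $ 0"
  by (simp_all add: cross_def)

lemma lorentz_cross: "lorentz (cross x y) (cross x y) = (lorentz x y)\<^sup>2 - lorentz x x * lorentz y y"
  by (simp add: lorentz_def algebra_simps power2_eq_square)

text \<open>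
The Gram determinant of two vectors for a diagonal form is, up to the sign, the value of the
adjugate form at their cross product (Cauchy and Binet).
\<close>

lemma gram_det:
  "poly ((gram_poly a x y)\<^sup>2 - gram_poly a x x * gram_poly a y y) t =
   (a $ 0 - t) * (a $ 1 - t) * (a $ 2 - t) *
     (- (cross x y $ 0)\<^sup>2 * (a $ 0 - t) + (cross x y $ 1)\<^sup>2 * (a $ 1 - t) + (cross x y $ 2)\<^sup>2 * (a $ 2 - t))"
proof -
  define b0 b1 b2 where "b0 = a $ 0 - t" "b1 = a $ 1 - t" "b2 = a $ 2 - t"
  show ?thesis unfolding poly_diff poly_mult poly_power poly_gram_poly cross_nth b0_b1_b2_def[symmetric]
    by (simp add: algebra_simps power2_eq_square)
qed

lemma parallel_to_cross:
  assumes "x $ 0 * y $ 0 + x $ 1 * y $ 1 + x $ 2 * y $ 2 = 0" "x $ 0 * z $ 0 + x $ 1 * z $ 1 + x $ 2 * z $ 2 = 0"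
    and "x \<noteq> 0"
  shows "\<exists>r. cross y z = r *\<^sub>R x"
proof -
  let ?w = "cross y z"
  have *: "?w $ i * x $ j = ?w $ j * x $ i" for i j
  proof -
    let ?xy = "x $ 0 * y $ 0 + x $ 1 * y $ 1 + x $ 2 * y $ 2" and ?xz = "x $ 0 * z $ 0 + x $ 1 * z $ 1 + x $ 2 * z $ 2"
    have "?w $ 0 * x $ 1 - ?w $ 1 * x $ 0 = z $ 2 * ?xy - y $ 2 * ?xz"
      "?w $ 0 * x $ 2 - ?w $ 2 * x $ 0 = y $ 1 * ?xz - z $ 1 * ?xy"
      "?w $ 1 * x $ 2 - ?w $ 2 * x $ 1 = z $ 0 * ?xy - y $ 0 * ?xz"
      unfolding cross_nth by (simp_all add: algebra_simps)
    then have "?w $ 0 * x $ 1 = ?w $ 1 * x $ 0" "?w $ 0 * x $ 2 = ?w $ 2 * x $ 0" "?w $ 1 * x $ 2 = ?w $ 2 * x $ 1"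
      unfolding assms by simp_all
    then have "\<forall>i j. ?w $ i * x $ j = ?w $ j * x $ i"
      unfolding all_3 by auto
    then show ?thesis by blast
  qed
  obtain i where "x $ i \<noteq> 0" using assms(3) by (auto simp: Finite_Cartesian_Product.vec_eq_iff)
  then have "?w = (?w $ i / x $ i) *\<^sub>R x"
    using *[of _ i] by (simp add: Finite_Cartesian_Product.vec_eq_iff field_simps)
  then show ?thesis ..
qed

text \<open>
By \<open>gram_det\<close> the discriminant is \<open>\<Prod>(a\<^sub>i - X)\<close> times a polynomial that is linear in \<open>X\<close>, and
tangency of the plane to the cone with parameter \<open>\<nu>\<close> says that this linear polynomial vanishes
at \<open>\<nu>\<close>.
\<close>

lemma caustic_discriminant:
  assumes p: "lorentz p p = 1" "lorentz p v = 0"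
    and tan: "tangent_to_cone (confocal a \<nu>) (span {p, v})"
    and nu: "\<forall>i. a $ i \<noteq> \<nu>"
  shows "(gram_poly a p v)\<^sup>2 - gram_poly a p p * gram_poly a v v =
     smult (- lorentz v v) ([:- a $ 0, 1:] * [:- a $ 1, 1:] * [:- a $ 2, 1:] * [:- \<nu>, 1:])"
proof -
  obtain x where x: "x \<noteq> 0" "cone_form (confocal a \<nu>) x = 0"
    "span {p, v} = {y. lorentz (diag_inv (confocal a \<nu>) x) y = 0}"
    using tan by (auto simp: tangent_to_cone_def)
  define W where "W = diag_inv (confocal a \<nu>) x"
  \<comment> \<open>With the sign of the time component changed, Lorentz orthogonality becomes Euclidean orthogonality.\<close>
  define W' :: "real^3" where "W' = (\<chi> i. if i = 0 then - W $ i else W $ i)"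
  have W'n: "W' $ 0 = - W $ 0" "W' $ 1 = W $ 1" "W' $ 2 = W $ 2" by (simp_all add: W'_def)
  have "lorentz W p = 0" "lorentz W v = 0"
    using x(3) span_base[of p "{p, v}"] span_base[of v "{p, v}"] by (auto simp: W_def)
  moreover have xW: "x $ i = (a $ i - \<nu>) * W $ i" for i
    using nu by (simp add: W_def confocal_def)
  have "W' \<noteq> 0"
    using x(1) xW W'n by (auto simp: vec3_eq_iff)
  ultimately obtain r where r: "cross p v = r *\<^sub>R W'"
    using parallel_to_cross[of W' p v] by (auto simp: W'n lorentz_def)
  have cone: "- (W $ 0)\<^sup>2 * (a $ 0 - \<nu>) + (W $ 1)\<^sup>2 * (a $ 1 - \<nu>) + (W $ 2)\<^sup>2 * (a $ 2 - \<nu>) = 0"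
    using x(2) unfolding cone_form_def W_def[symmetric] by (simp add: lorentz_def xW power2_eq_square mult_ac)
  have L: "- lorentz v v = lorentz (cross p v) (cross p v)" using lorentz_cross[of p v] p by simp
  also have "\<dots> = r\<^sup>2 * (- (W $ 0)\<^sup>2 + (W $ 1)\<^sup>2 + (W $ 2)\<^sup>2)"
    by (simp only: lorentz_def r vector_scaleR_component W'n) (simp add: power2_eq_square algebra_simps)
  finally have L: "- lorentz v v = r\<^sup>2 * (- (W $ 0)\<^sup>2 + (W $ 1)\<^sup>2 + (W $ 2)\<^sup>2)" .
  show ?thesis
  proof (rule poly_eq_poly_eq_iff[THEN iffD1], rule ext)
    fix t
    have "- (cross p v $ 0)\<^sup>2 * (a $ 0 - t) + (cross p v $ 1)\<^sup>2 * (a $ 1 - t) + (cross p v $ 2)\<^sup>2 * (a $ 2 - t)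
      = r\<^sup>2 * (- (W $ 0)\<^sup>2 * (a $ 0 - \<nu>) + (W $ 1)\<^sup>2 * (a $ 1 - \<nu>) + (W $ 2)\<^sup>2 * (a $ 2 - \<nu>)) -
         (t - \<nu>) * (r\<^sup>2 * (- (W $ 0)\<^sup>2 + (W $ 1)\<^sup>2 + (W $ 2)\<^sup>2))"
      by (simp only: r vector_scaleR_component W'n) (simp add: power2_eq_square algebra_simps)
    also have "\<dots> = (t - \<nu>) * lorentz v v" unfolding cone L[symmetric] by simp
    finally have *: "- (cross p v $ 0)\<^sup>2 * (a $ 0 - t) + (cross p v $ 1)\<^sup>2 * (a $ 1 - t) +
       (cross p v $ 2)\<^sup>2 * (a $ 2 - t) = (t - \<nu>) * lorentz v v" .
    have "poly (smult (- lorentz v v) ([:- a $ 0, 1:] * [:- a $ 1, 1:] * [:- a $ 2, 1:] * [:- \<nu>, 1:])) t =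
        - lorentz v v * ((t - a $ 0) * (t - a $ 1) * (t - a $ 2) * (t - \<nu>))"
      unfolding poly_smult poly_mult by simp
    also have "\<dots> = (a $ 0 - t) * (a $ 1 - t) * (a $ 2 - t) * ((t - \<nu>) * lorentz v v)"
      by (simp add: algebra_simps)
    finally show "poly ((gram_poly a p v)\<^sup>2 - gram_poly a p p * gram_poly a v v) t =
      poly (smult (- lorentz v v) ([:- a $ 0, 1:] * [:- a $ 1, 1:] * [:- a $ 2, 1:] * [:- \<nu>, 1:])) t"
      unfolding gram_det * ..
  qed
qed

section \<open>Transfer matrices\<close>

text \<open>
The matrix with rows \<open>(A, B)\<close> and \<open>(C, D)\<close> takes the Gram matrix of \<open>(p, v)\<close> to \<open>X\<^sup>2\<^sup>n\<close> times that of
\<open>(p', v')\<close>. The equations at \<open>X = a\<^sub>i\<close> are not implied by this: the Gram matrices do not change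
when the \<open>i\<close>-th coordinates of a point and its velocity change sign together, and it is these
equations that see the signs. By \<open>C(0) = 0\<close> and \<open>D(0) \<noteq> 0\<close> the matrix at \<open>X = 0\<close> is not zero, so
that no power of \<open>X\<close> can be divided out and \<open>n\<close> is the true count.
\<close>

definition transfer ::
  "real^3 \<Rightarrow> real^3 \<Rightarrow> real^3 \<Rightarrow> real^3 \<Rightarrow> real^3 \<Rightarrow> nat \<Rightarrow>
   real poly \<Rightarrow> real poly \<Rightarrow> real poly \<Rightarrow> real poly \<Rightarrow> bool" where
  "transfer a p v p' v' n A B C D \<longleftrightarrow>
     degree A \<le> n \<and> degree B \<le> n \<and> degree C \<le> n \<and> degree D \<le> n \<and>
     A * D - B * C = monom 1 (2 * n) \<and> poly C 0 = 0 \<and> poly D 0 \<noteq> 0 \<and>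
     A\<^sup>2 * gram_poly a p p + 2 * A * C * gram_poly a p v + C\<^sup>2 * gram_poly a v v
       = monom 1 (2 * n) * gram_poly a p' p' \<and>
     A * B * gram_poly a p p + (A * D + B * C) * gram_poly a p v + C * D * gram_poly a v v
       = monom 1 (2 * n) * gram_poly a p' v' \<and>
     B\<^sup>2 * gram_poly a p p + 2 * B * D * gram_poly a p v + D\<^sup>2 * gram_poly a v v
       = monom 1 (2 * n) * gram_poly a v' v' \<and>
     poly (gram_poly a p' v') 0 = poly (gram_poly a p v) 0 \<and>
     (\<forall>i. poly A (a $ i) * p $ i + poly C (a $ i) * v $ i = a $ i ^ n * p' $ i \<and>
          poly B (a $ i) * p $ i + poly D (a $ i) * v $ i = a $ i ^ n * v' $ i)"

lemma transfer_refl: "transfer a p v p v 0 1 0 0 1"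
  by (simp add: transfer_def)

lemma transfer_trans:
  assumes 1: "transfer a p v p' v' n A B C D" and 2: "transfer a p' v' p'' v'' n' A' B' C' D'"
  shows "transfer a p v p'' v'' (n + n') (A * A' + B * C') (A * B' + B * D')
           (C * A' + D * C') (C * B' + D * D')"
proof -
  have deg: "degree (x * y + z * w) \<le> n + n'"
    if "degree x \<le> n" "degree y \<le> n'" "degree z \<le> n" "degree w \<le> n'" for x y z w :: "real poly"
    using that degree_mult_le[of x y] degree_mult_le[of z w] by (intro degree_add_le) linarith+
  have X: "monom 1 (2 * (n + n')) = monom 1 (2 * n) * (monom 1 (2 * n') :: real poly)"
    by (simp add: mult_monom)
  note T1 = 1[unfolded transfer_def] and T2 = 2[unfolded transfer_def]
  define N11 N12 N22 where N: "N11 = gram_poly a p p" "N12 = gram_poly a p v" "N22 = gram_poly a v v"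
  define M11 M12 M22 where M: "M11 = gram_poly a p' p'" "M12 = gram_poly a p' v'" "M22 = gram_poly a v' v'"
  define X where X': "X = (monom 1 (2 * n) :: real poly)"
  have f1: "A\<^sup>2 * N11 + 2 * A * C * N12 + C\<^sup>2 * N22 = X * M11"
    "A * B * N11 + (A * D + B * C) * N12 + C * D * N22 = X * M12"
    "B\<^sup>2 * N11 + 2 * B * D * N12 + D\<^sup>2 * N22 = X * M22"
    using T1 unfolding N M X' by blast+
  have f2: "X * (A'\<^sup>2 * M11 + 2 * A' * C' * M12 + C'\<^sup>2 * M22) = monom 1 (2 * (n + n')) * gram_poly a p'' p''"
    "X * (A' * B' * M11 + (A' * D' + B' * C') * M12 + C' * D' * M22) = monom 1 (2 * (n + n')) * gram_poly a p'' v''"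
    "X * (B'\<^sup>2 * M11 + 2 * B' * D' * M12 + D'\<^sup>2 * M22) = monom 1 (2 * (n + n')) * gram_poly a v'' v''"
    using T2 unfolding M X X' by (simp_all only: mult.assoc)
  have "(A * A' + B * C') * (C * B' + D * D') - (A * B' + B * D') * (C * A' + D * C') =
      (A * D - B * C) * (A' * D' - B' * C')" by (simp add: algebra_simps)
  then have det: "(A * A' + B * C') * (C * B' + D * D') - (A * B' + B * D') * (C * A' + D * C') =
      monom 1 (2 * (n + n'))" unfolding X using T1 T2 by simp
  have g1: "(A * A' + B * C')\<^sup>2 * N11 + 2 * (A * A' + B * C') * (C * A' + D * C') * N12 +
      (C * A' + D * C')\<^sup>2 * N22 = monom 1 (2 * (n + n')) * gram_poly a p'' p''"
  proof -
    have "(A * A' + B * C')\<^sup>2 * N11 + 2 * (A * A' + B * C') * (C * A' + D * C') * N12 + (C * A' + D * C')\<^sup>2 * N22 =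
      A'\<^sup>2 * (A\<^sup>2 * N11 + 2 * A * C * N12 + C\<^sup>2 * N22) +
      2 * A' * C' * (A * B * N11 + (A * D + B * C) * N12 + C * D * N22) +
      C'\<^sup>2 * (B\<^sup>2 * N11 + 2 * B * D * N12 + D\<^sup>2 * N22)"
      by (simp add: algebra_simps power2_eq_square)
    then show ?thesis unfolding f1 f2[symmetric] by (simp add: algebra_simps)
  qed
  have g2: "(A * A' + B * C') * (A * B' + B * D') * N11 +
      ((A * A' + B * C') * (C * B' + D * D') + (A * B' + B * D') * (C * A' + D * C')) * N12 +
      (C * A' + D * C') * (C * B' + D * D') * N22 = monom 1 (2 * (n + n')) * gram_poly a p'' v''"
  proof -
    have "(A * A' + B * C') * (A * B' + B * D') * N11 +
      ((A * A' + B * C') * (C * B' + D * D') + (A * B' + B * D') * (C * A' + D * C')) * N12 +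
      (C * A' + D * C') * (C * B' + D * D') * N22 =
      A' * B' * (A\<^sup>2 * N11 + 2 * A * C * N12 + C\<^sup>2 * N22) +
      (A' * D' + B' * C') * (A * B * N11 + (A * D + B * C) * N12 + C * D * N22) +
      C' * D' * (B\<^sup>2 * N11 + 2 * B * D * N12 + D\<^sup>2 * N22)"
      by (simp add: algebra_simps power2_eq_square)
    then show ?thesis unfolding f1 f2[symmetric] by (simp add: algebra_simps)
  qed
  have g3: "(A * B' + B * D')\<^sup>2 * N11 + 2 * (A * B' + B * D') * (C * B' + D * D') * N12 +
      (C * B' + D * D')\<^sup>2 * N22 = monom 1 (2 * (n + n')) * gram_poly a v'' v''"
  proof -
    have "(A * B' + B * D')\<^sup>2 * N11 + 2 * (A * B' + B * D') * (C * B' + D * D') * N12 + (C * B' + D * D')\<^sup>2 * N22 =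
      B'\<^sup>2 * (A\<^sup>2 * N11 + 2 * A * C * N12 + C\<^sup>2 * N22) +
      2 * B' * D' * (A * B * N11 + (A * D + B * C) * N12 + C * D * N22) +
      D'\<^sup>2 * (B\<^sup>2 * N11 + 2 * B * D * N12 + D\<^sup>2 * N22)"
      by (simp add: algebra_simps power2_eq_square)
    then show ?thesis unfolding f1 f2[symmetric] by (simp add: algebra_simps)
  qed
  have rows: "poly (A * A' + B * C') (a $ i) * p $ i + poly (C * A' + D * C') (a $ i) * v $ i = a $ i ^ (n + n') * p'' $ i \<and>
      poly (A * B' + B * D') (a $ i) * p $ i + poly (C * B' + D * D') (a $ i) * v $ i = a $ i ^ (n + n') * v'' $ i" for i
  proof -
    have r1: "poly A (a $ i) * p $ i + poly C (a $ i) * v $ i = a $ i ^ n * p' $ i"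
      "poly B (a $ i) * p $ i + poly D (a $ i) * v $ i = a $ i ^ n * v' $ i" using T1 by blast+
    have r2: "poly A' (a $ i) * p' $ i + poly C' (a $ i) * v' $ i = a $ i ^ n' * p'' $ i"
      "poly B' (a $ i) * p' $ i + poly D' (a $ i) * v' $ i = a $ i ^ n' * v'' $ i" using T2 by blast+
    have "poly (A * A' + B * C') (a $ i) * p $ i + poly (C * A' + D * C') (a $ i) * v $ i =
        poly A' (a $ i) * (a $ i ^ n * p' $ i) + poly C' (a $ i) * (a $ i ^ n * v' $ i)"
      "poly (A * B' + B * D') (a $ i) * p $ i + poly (C * B' + D * D') (a $ i) * v $ i =
        poly B' (a $ i) * (a $ i ^ n * p' $ i) + poly D' (a $ i) * (a $ i ^ n * v' $ i)"
      unfolding r1[symmetric] by (simp_all add: algebra_simps)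
    moreover have "poly A' (a $ i) * (a $ i ^ n * p' $ i) + poly C' (a $ i) * (a $ i ^ n * v' $ i) =
        a $ i ^ n * (a $ i ^ n' * p'' $ i)"
      "poly B' (a $ i) * (a $ i ^ n * p' $ i) + poly D' (a $ i) * (a $ i ^ n * v' $ i) =
        a $ i ^ n * (a $ i ^ n' * v'' $ i)"
      unfolding r2[symmetric] by (simp_all add: algebra_simps)
    ultimately show ?thesis by (simp add: power_add)
  qed
  have "poly (C * A' + D * C') 0 = 0" "poly (C * B' + D * D') 0 \<noteq> 0"
    "poly (gram_poly a p'' v'') 0 = poly (gram_poly a p v) 0"
    using T1 T2 by simp_all
  moreover have "degree (A * A' + B * C') \<le> n + n'" "degree (A * B' + B * D') \<le> n + n'"
    "degree (C * A' + D * C') \<le> n + n'" "degree (C * B' + D * D') \<le> n + n'"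
    using T1 T2 deg by blast+
  ultimately show ?thesis
    unfolding transfer_def using det g1[unfolded N] g2[unfolded N] g3[unfolded N] rows by blast
qed

definition boundary_state :: "real^3 \<Rightarrow> real^3 \<Rightarrow> real^3 \<Rightarrow> bool" where
  "boundary_state a p v \<longleftrightarrow> lorentz p p = 1 \<and> lorentz p (diag_inv a p) = 0 \<and> lorentz p v = 0 \<and>
     lorentz v (diag_inv a p) \<noteq> 0"

text \<open>
A tangent vector \<open>w\<close> of the boundary curve spans the orthogonal complement of \<open>p\<close> and of the
normal \<open>n\<close>, so \<open>\<langle>w, w\<rangle>\<close> and \<open>\<langle>n, n\<rangle>\<close> vanish together, by the formula for the norm of a cross
product.
\<close>

lemma lightlike_tangent_iff:
  assumes "lorentz p p = 1" "lorentz p (diag_inv a p) = 0" and a: "\<forall>i. a $ i \<noteq> 0"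
  shows "lightlike_tangent a p \<longleftrightarrow> lorentz (diag_inv a p) (diag_inv a p) = 0"
proof
  let ?n = "diag_inv a p"
  assume "lorentz ?n ?n = 0"
  moreover have "?n \<noteq> 0"
    using assms by (auto simp: vec3_eq_iff all_3 lorentz_def)
  ultimately show "lightlike_tangent a p"
    using assms(2) unfolding lightlike_tangent_def by (intro exI[of _ ?n]) (auto simp: lorentz_commute)
next
  let ?n = "diag_inv a p"
  assume "lightlike_tangent a p"
  then obtain w where w: "w \<noteq> 0" "lorentz w p = 0" "lorentz w ?n = 0" "lorentz w w = 0"
    by (auto simp: lightlike_tangent_def)
  define w' :: "real^3" where "w' = (\<chi> i. if i = 0 then - w $ i else w $ i)"
  have w'n: "w' $ 0 = - w $ 0" "w' $ 1 = w $ 1" "w' $ 2 = w $ 2" by (simp_all add: w'_def)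
  have "w' \<noteq> 0" using w(1) w'n by (auto simp: vec3_eq_iff)
  then obtain r where r: "cross p ?n = r *\<^sub>R w'"
    using parallel_to_cross[of w' p ?n] w(2,3) by (auto simp: w'n lorentz_def)
  have "lorentz (r *\<^sub>R w') (r *\<^sub>R w') = r\<^sup>2 * lorentz w w"
    by (simp add: lorentz_def w'n power2_eq_square algebra_simps)
  then have "lorentz (cross p ?n) (cross p ?n) = 0"
    unfolding r using w(4) by simp
  then show "lorentz ?n ?n = 0" using lorentz_cross[of p ?n] assms by simp
qed

definition bounces :: "real^3 \<Rightarrow> real^3 \<Rightarrow> nat" where
  "bounces a p = (if lightlike_tangent a p then 2 else 1)"

lemma reflect_props:
  fixes a q u :: "real^3"
  assumes a: "\<forall>i. a $ i \<noteq> 0" and q: "lorentz q q = 1" "lorentz q (diag_inv a q) = 0" and u: "lorentz q u = 0"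
  shows "lorentz q (reflect a q u) = 0"
    "lorentz (reflect a q u) (diag_inv a q) = - lorentz u (diag_inv a q)"
proof -
  let ?n = "diag_inv a q" and ?w = "reflect a q u"
  have "lorentz q ?w = 0 \<and> lorentz ?w ?n = - lorentz u ?n"
  proof (cases "lightlike_tangent a q")
    case True
    then have "?w = - u" by (simp add: reflect_def Let_def)
    then show ?thesis using u by (simp add: lorentz_def)
  next
    case False
    define m where "m = 2 * lorentz u ?n / lorentz ?n ?n"
    have nn: "lorentz ?n ?n \<noteq> 0" using False lightlike_tangent_iff[OF q a] by simp
    have w: "?w = u - m *\<^sub>R ?n" using False by (simp add: reflect_def Let_def m_def)
    have m: "m * lorentz ?n ?n = 2 * lorentz u ?n" using nn by (simp add: m_def)
    have lin: "lorentz x (u - m *\<^sub>R ?n) = lorentz x u - m * lorentz x ?n" for x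
      by (simp add: lorentz_def algebra_simps)
    show ?thesis
      using lin[of ?n] lin[of q] m q u unfolding w by (simp add: lorentz_commute)
  qed
  then show "lorentz q ?w = 0" "lorentz ?w ?n = - lorentz u ?n" by auto
qed

lemma gram_poly_lincomb:
  "poly (gram_poly a x (c *\<^sub>R y + d *\<^sub>R z)) t = c * poly (gram_poly a x y) t + d * poly (gram_poly a x z) t"
  "poly (gram_poly a (c *\<^sub>R y + d *\<^sub>R z) x) t = c * poly (gram_poly a y x) t + d * poly (gram_poly a z x) t"
  unfolding poly_gram_poly by (simp_all add: algebra_simps)

text \<open>
The form has rank one at \<open>X = a\<^sub>i\<close>. This is how single coordinates of points and velocities are
recovered from matrices that depend on \<open>X\<close>.
\<close>

lemma gram_poly_at_eigenvalue:
  "\<exists>k. \<forall>x y. poly (gram_poly a x y) (a $ i) = k * (x $ i * y $ i)"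
proof -
  have "\<forall>i. \<exists>k. \<forall>x y. poly (gram_poly a x y) (a $ i) = k * (x $ i * y $ i)"
    unfolding all_3 poly_gram_poly
    by (intro conjI exI[of _ "- ((a $ 1 - a $ 0) * (a $ 2 - a $ 0))"]
      exI[of _ "(a $ 0 - a $ 1) * (a $ 2 - a $ 1)"] exI[of _ "(a $ 0 - a $ 2) * (a $ 1 - a $ 2)"]) simp_all
  then show ?thesis by blast
qed

lemma gram_poly_commute: "gram_poly a x y = gram_poly a y x"
  by (simp add: gram_poly_def mult.commute)

text \<open>
The vector on the left is \<open>(t - A) A\<^sup>-\<^sup>1x\<close>, and the factor \<open>A - t\<close> cancels the inverse in the
form.
\<close>

lemma gram_poly_shifted:
  assumes "\<forall>i. a $ i \<noteq> 0"
  shows "poly (gram_poly a (t *\<^sub>R diag_inv a x - x) y) t = - ((a $ 0 - t) * (a $ 1 - t) * (a $ 2 - t)) * lorentz (diag_inv a x) y"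
proof -
  define n where "n = diag_inv a x"
  have "t *\<^sub>R n - x = (\<chi> i. (t - a $ i) * n $ i)"
    using assms by (simp add: n_def vec3_eq_iff all_3 field_simps)
  then show ?thesis unfolding n_def[symmetric]
    by (simp add: poly_gram_poly lorentz_def algebra_simps)
qed

text \<open>
For the confocal forms, reflection at \<open>q\<close> cannot be told from the shear \<open>u \<mapsto> u + (\<xi>/X\<^sup>d) q\<close>. The
resulting vectors differ, but they have the same Gram matrix with \<open>q\<close>.
\<close>

lemma reflection_transfer:
  fixes a q u :: "real^3"
  assumes a: "\<forall>i. a $ i \<noteq> 0" and q: "lorentz q q = 1" "lorentz q (diag_inv a q) = 0"
    and u: "lorentz q u = 0" "lorentz u (diag_inv a q) \<noteq> 0"
  defines "d \<equiv> bounces a q" and "w \<equiv> reflect a q u"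
  obtains \<xi> where "degree \<xi> \<le> d" "poly \<xi> 0 \<noteq> 0"
    "\<And>t. poly (gram_poly a q (poly \<xi> t *\<^sub>R q + t ^ d *\<^sub>R u)) t = t ^ d * poly (gram_poly a q w) t"
    "\<And>t. poly (gram_poly a (poly \<xi> t *\<^sub>R q + t ^ d *\<^sub>R u) (poly \<xi> t *\<^sub>R q + t ^ d *\<^sub>R u)) t
        = t ^ (2 * d) * poly (gram_poly a w w) t"
    "\<And>i. poly \<xi> (a $ i) * q $ i + a $ i ^ d * u $ i = a $ i ^ d * w $ i"
proof (cases "lightlike_tangent a q")
  case False
  let ?n = "diag_inv a q"
  define m where "m = 2 * lorentz u ?n / lorentz ?n ?n"
  have nn: "lorentz ?n ?n \<noteq> 0" using False lightlike_tangent_iff[OF q a] by simp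
  have w: "w = u - m *\<^sub>R ?n" using False by (simp add: w_def reflect_def Let_def m_def)
  have m0: "m \<noteq> 0" using nn u by (simp add: m_def)
  have d: "d = 1" using False by (simp add: d_def bounces_def)
  note wp = reflect_props[OF a q u(1), folded w_def]
  show ?thesis
  \<comment> \<open>The difference of \<open>t w\<close> and \<open>t u - m q\<close> is \<open>- m (t - A) n\<close>, and \<open>gram_poly_shifted\<close> applies.\<close>
  proof (rule that[of "[:- m:]"])
    fix t
    let ?y = "poly [:- m:] t *\<^sub>R q + t ^ d *\<^sub>R u"
    have y: "t *\<^sub>R w = ?y + (- m) *\<^sub>R (t *\<^sub>R ?n - q)" by (simp add: w d algebra_simps)
    let ?G = "\<lambda>x y. poly (gram_poly a x y) t"
    have lin: "?G x (t *\<^sub>R w) = t * ?G x w" "?G (t *\<^sub>R w) x = t * ?G w x" for x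
      unfolding poly_gram_poly by (simp_all add: algebra_simps)
    have lin2: "?G x (t *\<^sub>R w) = ?G x ?y - m * ?G (t *\<^sub>R ?n - q) x" for x
      unfolding y using gram_poly_lincomb(1)[of a x 1 ?y "- m" "t *\<^sub>R ?n - q" t]
      by (simp add: gram_poly_commute[of a x "t *\<^sub>R ?n - q"])
    have "?G (t *\<^sub>R ?n - q) q = 0" using gram_poly_shifted[OF a, of t q q] q by (simp add: lorentz_commute)
    then show "?G q ?y = t ^ d * ?G q w" using lin2[of q] lin(1)[of q] d by simp
    have s: "lorentz ?n (t *\<^sub>R w) + lorentz ?n ?y = t * lorentz w ?n + t * lorentz u ?n - m * lorentz q ?n"
      by (simp add: d lorentz_def algebra_simps)
    also have "\<dots> = 0" using wp q by simp
    finally have s: "lorentz ?n (t *\<^sub>R w) + lorentz ?n ?y = 0" .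
    have s0: "?G (t *\<^sub>R ?n - q) (t *\<^sub>R w) + ?G (t *\<^sub>R ?n - q) ?y = 0"
      unfolding gram_poly_shifted[OF a] distrib_left[symmetric] s by simp
    have "?G ?y (t *\<^sub>R w) = ?G (t *\<^sub>R w) ?y" by (simp only: gram_poly_commute)
    then have "?G (t *\<^sub>R w) (t *\<^sub>R w) = ?G ?y ?y - m * (?G (t *\<^sub>R ?n - q) (t *\<^sub>R w) + ?G (t *\<^sub>R ?n - q) ?y)"
      using lin2[of "t *\<^sub>R w"] lin2[of ?y] unfolding distrib_left by linarith
    then have "?G ?y ?y = ?G (t *\<^sub>R w) (t *\<^sub>R w)" unfolding s0 by simp
    also have "\<dots> = t ^ (2 * d) * ?G w w" unfolding lin by (simp add: d power2_eq_square)
    finally show "?G ?y ?y = t ^ (2 * d) * ?G w w" .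
  qed (use m0 a in \<open>auto simp: d w field_simps\<close>)
next
  case True
  let ?n = "diag_inv a q"
  have nn: "lorentz ?n ?n = 0" using True lightlike_tangent_iff[OF q a] by simp
  have w: "w = - u" using True by (simp add: w_def reflect_def)
  have d: "d = 2" using True by (simp add: d_def bounces_def)
  have Gqq: "gram_poly a q q = [:0, 0, 1:]" using gram_poly_boundary_point[OF a q] nn by simp
  have Gqq': "poly (gram_poly a q q) t = t\<^sup>2" for t by (simp add: Gqq power2_eq_square)
  show ?thesis
  \<comment> \<open>As \<open>q\<close> has norm \<open>X\<^sup>2\<close>, adding \<open>-2 \<langle>q, u\<rangle> X\<^sup>-\<^sup>2 q\<close> to \<open>u\<close> reverses the sign of \<open>\<langle>q, u\<rangle>\<close>.\<close>
  proof (rule that[of "smult (-2) (gram_poly a q u)"])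
    show "degree (smult (-2) (gram_poly a q u)) \<le> d"
      using degree_gram_poly[of a q u] by (simp add: d)
    show "poly (smult (-2) (gram_poly a q u)) 0 \<noteq> 0"
      using u a by (simp add: poly_gram_poly_0[OF a] lorentz_diag_inv_commute[of q] lorentz_commute)
  next
    fix t
    let ?G = "\<lambda>x y. poly (gram_poly a x y) t"
    let ?y = "poly (smult (-2) (gram_poly a q u)) t *\<^sub>R q + t ^ d *\<^sub>R u"
    have wG: "?G x w = - ?G x u" "?G w x = - ?G u x" for x
      unfolding w poly_gram_poly by (simp_all add: algebra_simps)
    have 1: "?G q ?y = - t\<^sup>2 * ?G q u"
      unfolding gram_poly_lincomb Gqq' by (simp add: d)
    then show "?G q ?y = t ^ d * ?G q w" by (simp add: wG d)
    have "?G ?y ?y = -2 * ?G q u * ?G q ?y + t\<^sup>2 * (-2 * ?G q u * ?G u q + t\<^sup>2 * ?G u u)"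
      unfolding gram_poly_lincomb(2) gram_poly_lincomb(1)[of a u] by (simp add: d)
    also have "\<dots> = t ^ (2 * d) * ?G w w"
      unfolding 1 wG by (simp add: d gram_poly_commute[of a u q] power2_eq_square algebra_simps eval_nat_numeral)
    finally show "?G ?y ?y = t ^ (2 * d) * ?G w w" .
  next
    fix i
    obtain k where k: "\<And>x y. poly (gram_poly a x y) (a $ i) = k * (x $ i * y $ i)"
      using gram_poly_at_eigenvalue by metis
    have kq: "k * (q $ i * q $ i) = (a $ i)\<^sup>2" using k Gqq' by metis
    have "(k * (q $ i * u $ i)) * q $ i = (k * (q $ i * q $ i)) * u $ i" by (simp only: mult_ac)
    also have "\<dots> = (a $ i)\<^sup>2 * u $ i" by (simp only: kq)
    finally have "(k * (q $ i * u $ i)) * q $ i = (a $ i)\<^sup>2 * u $ i" .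
    then have "-2 * ((k * (q $ i * u $ i)) * q $ i) + (a $ i)\<^sup>2 * u $ i = - ((a $ i)\<^sup>2 * u $ i)"
      by linarith
    then show "poly (smult (-2) (gram_poly a q u)) (a $ i) * q $ i + a $ i ^ d * u $ i = a $ i ^ d * w $ i"
      unfolding poly_smult k by (simp only: d w mult.assoc vector_uminus_component mult_minus_right)
  qed
qed

section \<open>One segment and one reflection\<close>

lemma lorentz_lincomb_left: "lorentz (c *\<^sub>R x + d *\<^sub>R y) z = c * lorentz x z + d * lorentz y z"
  by (simp add: lorentz_def algebra_simps)

lemma lorentz_lincomb_right: "lorentz z (c *\<^sub>R x + d *\<^sub>R y) = c * lorentz z x + d * lorentz z y"
  by (simp add: lorentz_def algebra_simps)

lemma diag_inv_lincomb: "diag_inv a (c *\<^sub>R x + d *\<^sub>R y) = c *\<^sub>R diag_inv a x + d *\<^sub>R diag_inv a y"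
  by (simp add: Finite_Cartesian_Product.vec_eq_iff add_divide_distrib)

text \<open>
The three kinds of geodesics at once. The bound on the length of space-like segments is what
makes \<open>s\<close> positive before the time of arrival.
\<close>

lemma geodesic_coordinates:
  obtains c s c' s' :: "real \<Rightarrow> real" where
    "\<And>p t. lorentz v v = L \<Longrightarrow> geodesic p v t = c t *\<^sub>R p + s t *\<^sub>R v"
    "\<And>p t. lorentz v v = L \<Longrightarrow> velocity p v t = c' t *\<^sub>R p + s' t *\<^sub>R v"
    "\<And>t. c t * s' t - s t * c' t = 1"
    "\<And>t. c t * c' t + s t * s' t * L = 0"
    "continuous_on UNIV c" "continuous_on UNIV s" "c 0 = 1" "s 0 = 0"
    "\<And>t T. (L > 0 \<Longrightarrow> T * sqrt L \<le> pi) \<Longrightarrow> 0 < t \<Longrightarrow> t < T \<Longrightarrow> s t > 0"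
    "\<And>T. (L > 0 \<Longrightarrow> T * sqrt L \<le> pi) \<Longrightarrow> 0 < T \<Longrightarrow> s T > 0 \<or> s T = 0 \<and> c T = -1"
proof -
  consider "L > 0" | "L < 0" | "L = 0" by linarith
  then show ?thesis
  proof cases
    case 1
    define r where "r = sqrt L"
    have r: "r > 0" "L = r\<^sup>2" using 1 by (auto simp: r_def)
    have e: "sin x * cos x * r\<^sup>2 / r = cos x * (r * sin x)" for x
      using r(1) by (simp add: power2_eq_square[of r])
    show ?thesis
    proof (rule that[of "\<lambda>t. cos (r * t)" "\<lambda>t. sin (r * t) / r" "\<lambda>t. - r * sin (r * t)" "\<lambda>t. cos (r * t)"])
      show "continuous_on UNIV (\<lambda>t. cos (r * t))" "continuous_on UNIV (\<lambda>t. sin (r * t) / r)"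
        using r by (auto intro!: continuous_intros)
      show "sin (r * t) / r > 0" if "L > 0 \<Longrightarrow> T * sqrt L \<le> pi" "0 < t" "t < T" for t T
      proof -
        have "T * r \<le> pi" using that(1) 1 by (simp add: r_def)
        moreover have "r * t < T * r" using that r by simp
        ultimately have "r * t < pi" by linarith
        then show ?thesis using that r by (auto intro!: divide_pos_pos sin_gt_zero)
      qed
      show "sin (r * T) / r > 0 \<or> sin (r * T) / r = 0 \<and> cos (r * T) = -1"
        if "L > 0 \<Longrightarrow> T * sqrt L \<le> pi" "0 < T" for T
      proof (cases "T * r = pi")
        case True
        then show ?thesis by (simp add: mult.commute)
      next
        case False
        then have "r * T < pi" using that(1) 1 by (simp add: r_def mult.commute)
        then show ?thesis using that r by (auto intro!: divide_pos_pos sin_gt_zero)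
      qed
    qed (use r 1 in \<open>auto simp: geodesic_def velocity_eq geodesic_vel_def Let_def power_divide
          power_mult_distrib r_def[symmetric] e simp flip: power2_eq_square\<close>)
  next
    case 2
    define r where "r = sqrt (- L)"
    have r: "r > 0" "L = - r\<^sup>2" using 2 by (auto simp: r_def)
    have e: "cosh x * (sinh x * r\<^sup>2) / r = r * (cosh x * sinh x)" for x
      using r(1) by (simp add: power2_eq_square[of r])
    have ch: "(cosh x)\<^sup>2 = (sinh x)\<^sup>2 + 1" for x :: real using cosh_square_eq by blast
    show ?thesis
    proof (rule that[of "\<lambda>t. cosh (r * t)" "\<lambda>t. sinh (r * t) / r" "\<lambda>t. r * sinh (r * t)" "\<lambda>t. cosh (r * t)"])
      show "continuous_on UNIV (\<lambda>t. cosh (r * t))" "continuous_on UNIV (\<lambda>t. sinh (r * t) / r)"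
        using r by (auto intro!: continuous_intros)
    qed (use r 2 in \<open>auto simp: geodesic_def velocity_eq geodesic_vel_def Let_def power_divide
          power_mult_distrib r_def[symmetric] ch e algebra_simps simp flip: power2_eq_square\<close>)
  next
    case 3
    show ?thesis
      by (rule that[of "\<lambda>t. 1" "\<lambda>t. t" "\<lambda>t. 0" "\<lambda>t. 1"])
        (use 3 in \<open>auto simp: geodesic_def velocity_eq geodesic_vel_def Let_def\<close>)
  qed
qed

lemma cone_form_lincomb:
  "cone_form a (c *\<^sub>R p + d *\<^sub>R v) =
     c\<^sup>2 * cone_form a p + 2 * c * d * lorentz v (diag_inv a p) + d\<^sup>2 * cone_form a v"
  unfolding cone_form_def diag_inv_lincomb lorentz_lincomb_left lorentz_lincomb_right
    lorentz_diag_inv_commute[of v a p, symmetric] lorentz_commute[of "diag_inv a p" v]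
  by (simp add: algebra_simps power2_eq_square)

text \<open>
The equation \<open>cone_form = 0\<close> along the geodesic has the factor \<open>s\<close>, which belongs to the
starting point, and a linear factor, which determines the next boundary point. Since the
form keeps its sign in between, the linear factor cannot vanish at the antipode of the
starting point: there it has the opposite value. The equation \<open>\<langle>u, n\<^sub>q\<rangle> = - \<langle>v, n\<^sub>p\<rangle>\<close> means that
\<open>\<langle>v, n\<rangle>\<close> at the beginning of a segment is preserved by the billiard map, since the reflection
at \<open>q\<close> reverses the sign once more.
\<close>

lemma billiard_segment_coordinates:
  assumes p: "boundary_state a p v" and seg: "billiard_segment a M p v q u"
    and M: "\<sigma> \<noteq> 0" "M \<subseteq> hyperboloid" "\<And>x. x \<in> M \<Longrightarrow> \<sigma> * cone_form a x \<ge> 0"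
  obtains c s c' s' where "q = c *\<^sub>R p + s *\<^sub>R v" "u = c' *\<^sub>R p + s' *\<^sub>R v" "c * s' - s * c' = 1" "s > 0"
    "lorentz q q = 1" "lorentz q (diag_inv a q) = 0" "lorentz q u = 0"
    "lorentz u (diag_inv a q) = - lorentz v (diag_inv a p)" "\<sigma> * lorentz v (diag_inv a p) \<ge> 0"
proof -
  let ?L = "lorentz v v" and ?\<alpha> = "lorentz v (diag_inv a p)" and ?\<beta> = "cone_form a v"
  from seg obtain T where T: "T > 0" "\<And>t. 0 < t \<Longrightarrow> t < T \<Longrightarrow> geodesic p v t \<in> M"
    "geodesic p v T = q" "q \<in> table_boundary a M" "velocity p v T = u"
    "?L > 0 \<Longrightarrow> T * sqrt ?L \<le> pi"
    unfolding billiard_segment_def by blast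
  obtain c s c' s' where
    g: "\<And>t. geodesic p v t = c t *\<^sub>R p + s t *\<^sub>R v" "\<And>t. velocity p v t = c' t *\<^sub>R p + s' t *\<^sub>R v"
    and id: "\<And>t. c t * s' t - s t * c' t = 1"
    "\<And>t. c t * c' t + s t * s' t * ?L = 0"
    and cont: "continuous_on UNIV c" "continuous_on UNIV s" and i0: "c 0 = 1" "s 0 = 0"
    and spos: "\<And>t. 0 < t \<Longrightarrow> t < T \<Longrightarrow> s t > 0" and sT: "s T > 0 \<or> s T = 0 \<and> c T = -1"
    by (rule geodesic_coordinates[of v ?L]) (use T in blast)
  have pp: "lorentz p p = 1" "lorentz p v = 0" "cone_form a p = 0" "?\<alpha> \<noteq> 0"
    using p by (auto simp: boundary_state_def cone_form_def lorentz_commute)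
  have F: "cone_form a (geodesic p v t) = s t * (2 * c t * ?\<alpha> + s t * ?\<beta>)" for t
    unfolding g cone_form_lincomb pp by (simp add: algebra_simps power2_eq_square)
  \<comment> \<open>Without the factor \<open>s t\<close> the sign can be carried over to both ends by continuity.\<close>
  define h where "h t = \<sigma> * (2 * c t * ?\<alpha> + s t * ?\<beta>)" for t
  have h: "h t \<ge> 0" if "t \<in> {0<..<T}" for t
  proof -
    have "s t * h t \<ge> 0" using M(3)[OF T(2)[of t]] that unfolding F by (simp add: h_def mult_ac)
    then show ?thesis using spos[of t] that by (simp add: zero_le_mult_iff)
  qed
  have conth: "continuous_on UNIV h"
    unfolding h_def[abs_def] by (intro continuous_intros cont)
  then have ch: "continuous_on {0..T} h" by (rule continuous_on_subset) simp
  have hcl: "h t \<ge> 0" if "t \<in> {0..T}" for t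
  proof (rule continuous_ge_on_closure[OF _ _ h])
    show "continuous_on (closure {0<..<T}) h" "t \<in> closure {0<..<T}" using ch that T(1) by simp_all
  qed
  have sa: "\<sigma> * ?\<alpha> \<ge> 0" using hcl[of 0] T(1) i0 by (simp add: h_def)
  have s: "s T > 0"
  proof (rule ccontr)
    assume "\<not> s T > 0"
    then have "s T = 0" "c T = -1" using sT by auto
    then have "\<sigma> * ?\<alpha> \<le> 0" using hcl[of T] T(1) by (simp add: h_def)
    then show False using sa pp(4) M(1) by (metis antisym mult_eq_0_iff)
  qed
  have cq: "cone_form a q = 0" using T(4) by (simp add: table_boundary_def)
  have q: "q = c T *\<^sub>R p + s T *\<^sub>R v" using T(3) g by simp
  have u: "u = c' T *\<^sub>R p + s' T *\<^sub>R v" using T(5) g by simp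
  have sb: "s T * ?\<beta> = - 2 * c T * ?\<alpha>"
    using F[of T] cq s unfolding T(3) by simp
  have qn: "lorentz u (diag_inv a q) = c T * s' T * ?\<alpha> + s T * c' T * ?\<alpha> + s T * s' T * ?\<beta>"
    unfolding q u diag_inv_lincomb lorentz_lincomb_left lorentz_lincomb_right
    using pp(3) by (simp add: cone_form_def lorentz_diag_inv_commute[of p a v] lorentz_commute algebra_simps)
  have "\<dots> = c T * s' T * ?\<alpha> + s T * c' T * ?\<alpha> + s' T * (s T * ?\<beta>)" by (simp add: mult_ac)
  also have "\<dots> = - (c T * s' T - s T * c' T) * ?\<alpha>" unfolding sb by (simp add: algebra_simps)
  finally have un: "lorentz u (diag_inv a q) = - ?\<alpha>" using qn id(1)[of T] by simp
  show ?thesis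
  proof (rule that[OF q u id(1) s _ _ _ un sa])
    show "lorentz q q = 1" using T(4) M(2) by (auto simp: table_boundary_def hyperboloid_def)
    show "lorentz q (diag_inv a q) = 0" using cq by (simp add: cone_form_def lorentz_commute)
    show "lorentz q u = 0" unfolding q u lorentz_lincomb using pp id(2)[of T] by simp
  qed
qed

text \<open>
The product of the constant change of basis from \<open>(p, v)\<close> to \<open>(q, u)\<close> and of the shear of
\<open>reflection_transfer\<close>. Here \<open>D(0) = s \<xi>(0)\<close>, so that it matters that the particle has moved
(\<open>s \<noteq> 0\<close>) and that it does not graze the boundary (\<open>\<xi>(0) \<noteq> 0\<close>).
\<close>

lemma step_transfer:
  assumes a: "\<forall>i. a $ i \<noteq> 0" and p: "boundary_state a p v"
    and q: "q = c *\<^sub>R p + s *\<^sub>R v" and u: "u = c' *\<^sub>R p + s' *\<^sub>R v" and det: "c * s' - s * c' = 1" "s \<noteq> 0"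
    and qq: "lorentz q q = 1" "lorentz q (diag_inv a q) = 0" "lorentz q u = 0"
    and un: "lorentz u (diag_inv a q) = - lorentz v (diag_inv a p)"
  shows "\<exists>A B C D. transfer a p v q (reflect a q u) (bounces a q) A B C D"
proof -
  define d where "d = bounces a q"
  define w where "w = reflect a q u"
  have un0: "lorentz u (diag_inv a q) \<noteq> 0" using p un by (simp add: boundary_state_def)
  obtain \<xi> where \<xi>: "degree \<xi> \<le> d" "poly \<xi> 0 \<noteq> 0"
    "\<And>t. poly (gram_poly a q (poly \<xi> t *\<^sub>R q + t ^ d *\<^sub>R u)) t = t ^ d * poly (gram_poly a q w) t"
    "\<And>t. poly (gram_poly a (poly \<xi> t *\<^sub>R q + t ^ d *\<^sub>R u) (poly \<xi> t *\<^sub>R q + t ^ d *\<^sub>R u)) t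
        = t ^ (2 * d) * poly (gram_poly a w w) t"
    "\<And>i. poly \<xi> (a $ i) * q $ i + a $ i ^ d * u $ i = a $ i ^ d * w $ i"
    unfolding d_def w_def by (rule reflection_transfer[OF a qq un0]) blast
  define A B C D where ABCD: "A = monom c d" "B = smult c \<xi> + monom c' d" "C = monom s d" "D = smult s \<xi> + monom s' d"
  have d0: "d > 0" by (simp add: d_def bounces_def)
  have G: "(poly A t)\<^sup>2 * poly (gram_poly a p p) t + 2 * poly A t * poly C t * poly (gram_poly a p v) t
        + (poly C t)\<^sup>2 * poly (gram_poly a v v) t
      = poly (gram_poly a (poly A t *\<^sub>R p + poly C t *\<^sub>R v) (poly A t *\<^sub>R p + poly C t *\<^sub>R v)) t"
    "poly A t * poly B t * poly (gram_poly a p p) t + (poly A t * poly D t + poly B t * poly C t) * poly (gram_poly a p v) t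
        + poly C t * poly D t * poly (gram_poly a v v) t
      = poly (gram_poly a (poly A t *\<^sub>R p + poly C t *\<^sub>R v) (poly B t *\<^sub>R p + poly D t *\<^sub>R v)) t"
    "(poly B t)\<^sup>2 * poly (gram_poly a p p) t + 2 * poly B t * poly D t * poly (gram_poly a p v) t
        + (poly D t)\<^sup>2 * poly (gram_poly a v v) t
      = poly (gram_poly a (poly B t *\<^sub>R p + poly D t *\<^sub>R v) (poly B t *\<^sub>R p + poly D t *\<^sub>R v)) t" for t
    unfolding gram_poly_lincomb gram_poly_commute[of a v p] by (simp_all add: algebra_simps power2_eq_square)
  have V: "poly A t *\<^sub>R p + poly C t *\<^sub>R v = t ^ d *\<^sub>R q"
    "poly B t *\<^sub>R p + poly D t *\<^sub>R v = poly \<xi> t *\<^sub>R q + t ^ d *\<^sub>R u" for t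
    by (simp_all add: ABCD poly_monom q u algebra_simps)
  have sc: "poly (gram_poly a (x *\<^sub>R q) y) t = x * poly (gram_poly a q y) t"
    "poly (gram_poly a q (x *\<^sub>R q)) t = x * poly (gram_poly a q q) t" for x y t
    unfolding poly_gram_poly by (simp_all add: algebra_simps)
  have pd: "t ^ (2 * d) = t ^ d * t ^ d" for t :: real by (simp add: mult_2 power_add)
  have "transfer a p v q w d A B C D"
    unfolding transfer_def
  proof (intro conjI allI)
    show "degree A \<le> d" "degree B \<le> d" "degree C \<le> d" "degree D \<le> d"
      using \<xi>(1) unfolding ABCD
      by (auto intro!: degree_add_le degree_monom_le order_trans[OF degree_smult_le])
    define X where "X = (monom 1 d :: real poly)"
    have "A = smult c X" "B = smult c \<xi> + smult c' X" "C = smult s X" "D = smult s \<xi> + smult s' X"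
      by (simp_all add: ABCD X_def smult_monom)
    then have "A * D - B * C = smult (c * s' - s * c') (X * X)"
      by (simp add: algebra_simps smult_diff_left)
    then show "A * D - B * C = monom 1 (2 * d)" using det by (simp add: X_def mult_monom mult_2)
    show "poly C 0 = 0" using d0 by (simp add: ABCD poly_monom)
    show "poly D 0 \<noteq> 0" using \<xi>(2) det by (simp add: ABCD poly_monom zero_power[OF d0])
    show "A\<^sup>2 * gram_poly a p p + 2 * A * C * gram_poly a p v + C\<^sup>2 * gram_poly a v v = monom 1 (2 * d) * gram_poly a q q"
      by (rule poly_ext) (simp add: G V sc poly_monom pd)
    show "A * B * gram_poly a p p + (A * D + B * C) * gram_poly a p v + C * D * gram_poly a v v = monom 1 (2 * d) * gram_poly a q w"
      by (rule poly_ext) (simp add: G V sc \<xi>(3) poly_monom pd)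
    show "B\<^sup>2 * gram_poly a p p + 2 * B * D * gram_poly a p v + D\<^sup>2 * gram_poly a v v = monom 1 (2 * d) * gram_poly a w w"
      by (rule poly_ext) (simp add: G V \<xi>(4) poly_monom)
    have "lorentz q (diag_inv a w) = - lorentz u (diag_inv a q)"
      using reflect_props(2)[OF a qq, folded w_def] by (metis lorentz_diag_inv_commute lorentz_commute)
    then show "poly (gram_poly a q w) 0 = poly (gram_poly a p v) 0"
      unfolding poly_gram_poly_0[OF a] using un by (metis lorentz_diag_inv_commute lorentz_commute minus_minus)
  next
    fix i
    show "poly A (a $ i) * p $ i + poly C (a $ i) * v $ i = a $ i ^ d * q $ i"
      using arg_cong[OF V(1)[of "a $ i"], of "\<lambda>x. x $ i"] by simp
    show "poly B (a $ i) * p $ i + poly D (a $ i) * v $ i = a $ i ^ d * w $ i"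
      using arg_cong[OF V(2)[of "a $ i"], of "\<lambda>x. x $ i"] \<xi>(5)[of i] by simp
  qed
  then show ?thesis unfolding d_def w_def by blast
qed

section \<open>From Pell equations to closed trajectories\<close>

text \<open>
Write \<open>\<surd>S q + \<surd>T r\<close> for a solution of the Pell equation \<open>S q\<^sup>2 - T r\<^sup>2 = c X\<^sup>n\<close>. Its square divided
by \<open>c\<close> is \<open>f - g Y\<close> with \<open>f\<close> and \<open>g\<close> polynomials, and has norm \<open>X\<^sup>2\<^sup>n\<close>. The order condition on \<open>S T\<close>
prevents \<open>c = 0\<close>, since \<open>S q\<^sup>2\<close> and \<open>T r\<^sup>2\<close> have zeros of different parity at \<open>x\<close>.
\<close>

lemma pell_polynomials:
  fixes S T q r :: "real poly" and F :: "real fps" and \<Delta> :: "real poly"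
  assumes \<Delta>: "\<Delta> = smult \<kappa> (S * T)" "poly \<Delta> 0 = b\<^sup>2" "b \<noteq> 0"
    and ord: "order x (S * T) = 1"
    and F: "fps_of_poly S * F\<^sup>2 = fps_of_poly T" "fps_nth F 0 \<noteq> 0"
    and "r \<noteq> 0" and deg: "degree (S * q\<^sup>2) \<le> n" "degree (T * r\<^sup>2) \<le> n" "degree q + degree r + 2 \<le> n"
    and X: "fps_X ^ n dvd fps_of_poly q + F * fps_of_poly r"
  obtains f g Y where "degree f \<le> n" "degree g + 2 \<le> n" "Y\<^sup>2 = fps_of_poly \<Delta>" "fps_nth Y 0 = b"
    "fps_X ^ (2 * n) dvd fps_of_poly f - fps_of_poly g * Y"
    "f\<^sup>2 - g\<^sup>2 * \<Delta> = monom 1 (2 * n)" "\<And>t. poly T t = 0 \<Longrightarrow> poly f t = t ^ n"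
proof -
  let ?F = "fps_of_poly :: real poly \<Rightarrow> real fps"
  note FP = fps_of_poly_add fps_of_poly_diff fps_of_poly_uminus fps_of_poly_mult fps_of_poly_power
    fps_of_poly_monom' fps_of_poly_smult
  have ST0: "S * T \<noteq> 0" using \<Delta> by (metis poly_0 power_not_zero smult_0_right)
  have nth0: "fps_nth (?F p) 0 = poly p 0" for p by (simp add: poly_0_coeff_0)
  have T0: "poly T 0 = poly S 0 * (fps_nth F 0)\<^sup>2"
    using F(1) nth0 by (metis fps_mult_nth_0 fps_power_zeroth)
  have S0: "poly S 0 \<noteq> 0" using \<Delta> T0 by auto
  \<comment> \<open>This choice among the two square roots of \<open>\<kappa>\<close> makes the constant term of \<open>Y\<close> equal to \<open>b\<close>.\<close>
  define \<rho> where "\<rho> = b / (poly S 0 * fps_nth F 0)"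
  have \<rho>: "\<rho>\<^sup>2 = \<kappa>" "\<rho> \<noteq> 0"
    using \<Delta> T0 S0 F(2) by (simp_all add: \<rho>_def field_simps power2_eq_square)
  define Y where "Y = fps_const \<rho> * (?F S * F)"
  have Y2: "Y\<^sup>2 = ?F \<Delta>"
  proof -
    have "Y\<^sup>2 = fps_const (\<rho>\<^sup>2) * (?F S * (?F S * F\<^sup>2))"
      by (simp add: Y_def power2_eq_square mult_ac flip: fps_const_mult)
    then show ?thesis unfolding F \<Delta> \<rho> by (simp add: FP)
  qed
  have Y0: "fps_nth Y 0 = b"
    using S0 F(2) by (simp add: Y_def \<rho>_def nth0 del: fps_of_poly_nth)
  have "?F (S * q\<^sup>2 - T * r\<^sup>2) = ?F S * (?F q - F * ?F r) * (?F q + F * ?F r)"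
    unfolding FP F(1)[symmetric] by (simp add: algebra_simps power2_eq_square)
  then have "fps_X ^ n dvd ?F (S * q\<^sup>2 - T * r\<^sup>2)" using X by simp
  then have "monom 1 n dvd S * q\<^sup>2 - T * r\<^sup>2" by (simp add: fps_X_power_dvd_fps_of_poly_iff)
  then obtain w where w: "S * q\<^sup>2 - T * r\<^sup>2 = monom 1 n * w" by (auto elim: dvdE)
  have degd: "degree (S * q\<^sup>2 - T * r\<^sup>2) \<le> n" using deg by (intro degree_diff_le)
  have w0: "w \<noteq> 0"
  proof
    assume "w = 0"
    then have e: "S * q\<^sup>2 = T * r\<^sup>2" using w by simp
    have "q \<noteq> 0" using e \<open>r \<noteq> 0\<close> ST0 by auto
    have "(S * T) * q\<^sup>2 = (T * r)\<^sup>2" using e by (simp add: power2_eq_square mult_ac)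
    then have "order x (S * T) + 2 * order x q = 2 * order x (T * r)"
      using ST0 \<open>q \<noteq> 0\<close> \<open>r \<noteq> 0\<close> order_mult[of "S * T" "q\<^sup>2" x]
      by (metis order_power_n_n order_mult mult_2 mult_eq_0_iff power2_eq_square)
    then show False using ord by presburger
  qed
  have "degree w = 0"
    using degd w0 by (simp add: w degree_mult_eq degree_monom_eq)
  then obtain c where c: "w = [:c:]" by (metis degree_0_id)
  have c0: "c \<noteq> 0" using w0 c by simp
  have pell: "S * q\<^sup>2 - T * r\<^sup>2 = monom c n" unfolding w c by (simp add: smult_monom)
  define f where "f = smult (1 / c) (S * q\<^sup>2 + T * r\<^sup>2)"
  define g where "g = smult (- 2 / (c * \<rho>)) (q * r)"
  show ?thesis
  proof (rule that[OF _ _ Y2 Y0])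
    show "degree f \<le> n" unfolding f_def using deg
      by (intro order_trans[OF degree_smult_le] degree_add_le)
    show "degree g + 2 \<le> n" unfolding g_def using deg(3) degree_mult_le[of q r]
        degree_smult_le[of "- 2 / (c * \<rho>)" "q * r"] by linarith
    have "?F f - ?F g * Y = fps_const (1 / c) * (?F S * (?F q)\<^sup>2 + ?F T * (?F r)\<^sup>2) +
         fps_const (2 / (c * \<rho>) * \<rho>) * (?F q * ?F r * (?F S * F))"
      by (simp add: f_def g_def Y_def FP mult_ac flip: fps_const_neg fps_const_mult)
    also have "2 / (c * \<rho>) * \<rho> = 1 / c * 2" using \<rho> by simp
    also have "fps_const (1 / c) * (?F S * (?F q)\<^sup>2 + ?F T * (?F r)\<^sup>2) + fps_const (1 / c * 2) * (?F q * ?F r * (?F S * F))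
       = fps_const (1 / c) * (?F S * (?F q + F * ?F r)\<^sup>2)"
      unfolding F(1)[symmetric] fps_const_mult[symmetric] fps_numeral_fps_const[symmetric]
      by (simp add: algebra_simps power2_eq_square)
    finally have e: "?F f - ?F g * Y = fps_const (1 / c) * (?F S * (?F q + F * ?F r)\<^sup>2)" .
    have "fps_X ^ (2 * n) dvd (?F q + F * ?F r)\<^sup>2"
      using X by (metis dvd_power_same mult.commute power_mult)
    then show "fps_X ^ (2 * n) dvd ?F f - ?F g * Y" unfolding e by simp
    have "f\<^sup>2 - g\<^sup>2 * \<Delta> = smult (1 / c\<^sup>2) ((S * q\<^sup>2 + T * r\<^sup>2)\<^sup>2 - smult 4 (q\<^sup>2 * r\<^sup>2 * (S * T)))"
      using c0 \<rho>(2) unfolding f_def g_def \<Delta>(1) \<rho>(1)[symmetric]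
      by (simp add: power2_eq_square smult_diff_right field_simps)
    also have "(S * q\<^sup>2 + T * r\<^sup>2)\<^sup>2 - smult 4 (q\<^sup>2 * r\<^sup>2 * (S * T)) = (S * q\<^sup>2 - T * r\<^sup>2)\<^sup>2"
      by (rule poly_ext) (simp add: power2_eq_square algebra_simps)
    also have "smult (1 / c\<^sup>2) \<dots> = monom 1 (2 * n)"
      unfolding pell using c0 by (simp add: power2_eq_square mult_monom smult_monom mult_2)
    finally show "f\<^sup>2 - g\<^sup>2 * \<Delta> = monom 1 (2 * n)" .
    fix t assume t: "poly T t = 0"
    have "poly (S * q\<^sup>2 - T * r\<^sup>2) t = c * t ^ n" unfolding pell by (simp add: poly_monom)
    then show "poly f t = t ^ n" using t c0 by (simp add: f_def)
  qed
qed

lemma boundary_state_gram: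
  assumes a: "\<forall>i. a $ i \<noteq> 0" and p: "boundary_state a p v"
  shows "poly (gram_poly a p p) 0 = 0" "poly (gram_poly a p v) 0 \<noteq> 0"
    "poly (gram_poly a p v) 0 = a $ 0 * a $ 1 * a $ 2 * lorentz v (diag_inv a p)"
    "gram_poly a p p = [:0, a $ 0 * a $ 1 * a $ 2 * lorentz (diag_inv a p) (diag_inv a p), 1:]"
proof -
  note p' = p[unfolded boundary_state_def]
  show "poly (gram_poly a p v) 0 = a $ 0 * a $ 1 * a $ 2 * lorentz v (diag_inv a p)"
    unfolding poly_gram_poly_0[OF a] by (metis lorentz_diag_inv_commute lorentz_commute)
  then show "poly (gram_poly a p v) 0 \<noteq> 0" using p' a by simp
  show N: "gram_poly a p p = [:0, a $ 0 * a $ 1 * a $ 2 * lorentz (diag_inv a p) (diag_inv a p), 1:]"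
    using gram_poly_boundary_point[OF a] p' by blast
  then show "poly (gram_poly a p p) 0 = 0" by simp
qed

text \<open>
The matrix \<open>f + g J N\<close> acts on the row \<open>(p\<^sub>i, v\<^sub>i)\<close> at \<open>X = a\<^sub>i\<close> as the scalar \<open>f(a\<^sub>i)\<close>, because this
row is annihilated by \<open>J N(a\<^sub>i)\<close>. The last two equations combine this with the factorisation
\<open>\<Theta>' = \<Theta> W\<close>.
\<close>

lemma pell_imp_transfer_factor:
  assumes a: "\<forall>i. a $ i \<noteq> 0" and p: "boundary_state a p v" and p': "boundary_state a p' v'"
    and tr: "transfer a p v p' v' l A B C D" and "l \<le> n"
    and fg: "degree f \<le> n" "degree g + 2 \<le> n" "fps_nth Y 0 = poly (gram_poly a p v) 0"
      "Y\<^sup>2 = fps_of_poly ((gram_poly a p v)\<^sup>2 - gram_poly a p p * gram_poly a v v)"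
      "fps_X ^ (2 * n) dvd fps_of_poly f - fps_of_poly g * Y" "\<And>i. poly f (a $ i) = a $ i ^ n"
  obtains W11 W12 W21 W22 :: "real poly" and H Z H' Z' :: "real fps" where
    "degree W11 \<le> n - l" "degree W12 \<le> n - l" "degree W21 \<le> n - l" "degree W22 \<le> n - l"
    "f - g * gram_poly a p v = A * W11 + B * W21" "- g * gram_poly a v v = A * W12 + B * W22"
    "g * gram_poly a p p = C * W11 + D * W21" "f + g * gram_poly a p v = C * W12 + D * W22"
    "(fps_of_poly (gram_poly a p v) + Y) * H = - fps_of_poly (gram_poly a p p)" "fps_nth H' 0 = 0"
    "fps_X ^ (2 * (n - l)) dvd fps_of_poly W11 + fps_of_poly W12 * H"
    "fps_of_poly W21 + fps_of_poly W22 * H = (fps_of_poly W11 + fps_of_poly W12 * H) * H'"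
    "fps_of_poly W11 * Z + fps_of_poly W12 = (fps_of_poly W21 * Z + fps_of_poly W22) * Z'"
    "\<And>i. a $ i ^ n * p $ i = a $ i ^ l * (poly W11 (a $ i) * p' $ i + poly W21 (a $ i) * v' $ i)"
    "\<And>i. a $ i ^ n * v $ i = a $ i ^ l * (poly W12 (a $ i) * p' $ i + poly W22 (a $ i) * v' $ i)"
proof -
  note T = tr[unfolded transfer_def]
  note G = boundary_state_gram[OF a p] and G' = boundary_state_gram[OF a p']
  have dm: "degree (g * x) \<le> n" if "degree x \<le> 2" for x :: "real poly"
    using degree_mult_le[of g x] that fg(2) by linarith
  have d: "degree (f - g * gram_poly a p v) \<le> n" "degree (g * gram_poly a p p) \<le> n"
    "degree (g * gram_poly a v v) \<le> n" "degree (f + g * gram_poly a p v) \<le> n"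
    using fg(1) by (intro degree_diff_le degree_add_le dm degree_gram_poly; simp)+
  have T': "A * D - B * C = monom 1 (2 * l)" "poly D 0 \<noteq> 0"
      "A\<^sup>2 * gram_poly a p p + 2 * A * C * gram_poly a p v + C\<^sup>2 * gram_poly a v v = monom 1 (2 * l) * gram_poly a p' p'"
      "A * B * gram_poly a p p + (A * D + B * C) * gram_poly a p v + C * D * gram_poly a v v = monom 1 (2 * l) * gram_poly a p' v'"
      "B\<^sup>2 * gram_poly a p p + 2 * B * D * gram_poly a p v + D\<^sup>2 * gram_poly a v v = monom 1 (2 * l) * gram_poly a v' v'"
      "poly (gram_poly a p' v') 0 = poly (gram_poly a p v) 0" "degree A \<le> l" "degree B \<le> l" "degree C \<le> l" "degree D \<le> l"
    using T by blast+
  obtain W11 W12 W21 W22 :: "real poly" and H H' Z Z' :: "real fps" where W: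
    "degree W11 \<le> n - l" "degree W12 \<le> n - l" "degree W21 \<le> n - l" "degree W22 \<le> n - l"
    "f - g * gram_poly a p v = A * W11 + B * W21" "- g * gram_poly a v v = A * W12 + B * W22"
    "g * gram_poly a p p = C * W11 + D * W21" "f + g * gram_poly a p v = C * W12 + D * W22"
    "(fps_of_poly (gram_poly a p v) + Y) * H = - fps_of_poly (gram_poly a p p)" "fps_nth H' 0 = 0"
    "fps_X ^ (2 * (n - l)) dvd fps_of_poly W11 + fps_of_poly W12 * H"
    "fps_of_poly W21 + fps_of_poly W22 * H = (fps_of_poly W11 + fps_of_poly W12 * H) * H'"
    "fps_of_poly W11 * Z + fps_of_poly W12 = (fps_of_poly W21 * Z + fps_of_poly W22) * Z'"
    using factor_through_transfer[OF T'(1,2,3,4,5) G(1,2) G'(1) T'(6) fg(4,3,5) T'(7-10) d \<open>l \<le> n\<close>]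
    by metis
  have rows: "a $ i ^ n * p $ i = a $ i ^ l * (poly W11 (a $ i) * p' $ i + poly W21 (a $ i) * v' $ i) \<and>
     a $ i ^ n * v $ i = a $ i ^ l * (poly W12 (a $ i) * p' $ i + poly W22 (a $ i) * v' $ i)" for i
  proof -
    let ?t = "a $ i"
    obtain k where k: "\<And>x y. poly (gram_poly a x y) ?t = k * (x $ i * y $ i)"
      using gram_poly_at_eigenvalue by metis
    have r: "poly A ?t * p $ i + poly C ?t * v $ i = ?t ^ l * p' $ i"
      "poly B ?t * p $ i + poly D ?t * v $ i = ?t ^ l * v' $ i"
      using T by blast+
    have w: "poly f ?t - poly g ?t * poly (gram_poly a p v) ?t = poly A ?t * poly W11 ?t + poly B ?t * poly W21 ?t"
      "- poly g ?t * poly (gram_poly a v v) ?t = poly A ?t * poly W12 ?t + poly B ?t * poly W22 ?t"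
      "poly g ?t * poly (gram_poly a p p) ?t = poly C ?t * poly W11 ?t + poly D ?t * poly W21 ?t"
      "poly f ?t + poly g ?t * poly (gram_poly a p v) ?t = poly C ?t * poly W12 ?t + poly D ?t * poly W22 ?t"
      using W(5-8)[THEN arg_cong[where f="\<lambda>x. poly x ?t"]] by simp_all
    have "?t ^ l * (poly W11 ?t * p' $ i + poly W21 ?t * v' $ i) =
        poly W11 ?t * (?t ^ l * p' $ i) + poly W21 ?t * (?t ^ l * v' $ i)" by (simp add: algebra_simps)
    also have "\<dots> = (poly A ?t * poly W11 ?t + poly B ?t * poly W21 ?t) * p $ i +
        (poly C ?t * poly W11 ?t + poly D ?t * poly W21 ?t) * v $ i"
      unfolding r[symmetric] by (simp add: algebra_simps)
    also have "\<dots> = ?t ^ n * p $ i" unfolding w[symmetric] k fg(6) by (simp add: algebra_simps)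
    finally have 1: "?t ^ n * p $ i = ?t ^ l * (poly W11 ?t * p' $ i + poly W21 ?t * v' $ i)" ..
    have "?t ^ l * (poly W12 ?t * p' $ i + poly W22 ?t * v' $ i) =
        poly W12 ?t * (?t ^ l * p' $ i) + poly W22 ?t * (?t ^ l * v' $ i)" by (simp add: algebra_simps)
    also have "\<dots> = (poly A ?t * poly W12 ?t + poly B ?t * poly W22 ?t) * p $ i +
        (poly C ?t * poly W12 ?t + poly D ?t * poly W22 ?t) * v $ i"
      unfolding r[symmetric] by (simp add: algebra_simps)
    also have "\<dots> = ?t ^ n * v $ i" unfolding w[symmetric] k fg(6) by (simp add: algebra_simps)
    finally have 2: "?t ^ n * v $ i = ?t ^ l * (poly W12 ?t * p' $ i + poly W22 ?t * v' $ i)" ..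
    from 1 2 show ?thesis ..
  qed
  show ?thesis by (rule that[OF W]) (use rows in blast)+
qed

text \<open>
Here \<open>W\<close> is constant, so the coordinates of \<open>(p, v)\<close> are obtained from those of \<open>(p', v')\<close> by one
\<open>2 \<times> 2\<close> matrix that does not depend on \<open>i\<close>. It is triangular because \<open>W\<close> preserves the null
direction \<open>(1, H)\<close> at \<open>X = 0\<close>, and the normalisation of states leaves only \<open>\<plusminus>1\<close>.
\<close>

lemma transfer_closes:
  assumes a: "\<forall>i. a $ i \<noteq> 0" and p: "boundary_state a p v" and p': "boundary_state a p' v'"
    and tr: "transfer a p v p' v' n A B C D"
    and fg: "degree f \<le> n" "degree g + 2 \<le> n" "fps_nth Y 0 = poly (gram_poly a p v) 0"
      "Y\<^sup>2 = fps_of_poly ((gram_poly a p v)\<^sup>2 - gram_poly a p p * gram_poly a v v)"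
      "fps_X ^ (2 * n) dvd fps_of_poly f - fps_of_poly g * Y" "\<And>i. poly f (a $ i) = a $ i ^ n"
    and det: "f\<^sup>2 - g\<^sup>2 * ((gram_poly a p v)\<^sup>2 - gram_poly a p p * gram_poly a v v) = monom 1 (2 * n)"
  shows "\<exists>\<tau>. \<tau>\<^sup>2 = 1 \<and> p' = \<tau> *\<^sub>R p \<and> v' = \<tau> *\<^sub>R v"
proof -
  obtain W11 W12 W21 W22 :: "real poly" and H H' Z Z' :: "real fps" where W:
    "degree W11 \<le> n - n" "degree W12 \<le> n - n" "degree W21 \<le> n - n" "degree W22 \<le> n - n"
    "f - g * gram_poly a p v = A * W11 + B * W21" "- g * gram_poly a v v = A * W12 + B * W22"
    "g * gram_poly a p p = C * W11 + D * W21" "f + g * gram_poly a p v = C * W12 + D * W22"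
    "(fps_of_poly (gram_poly a p v) + Y) * H = - fps_of_poly (gram_poly a p p)" "fps_nth H' 0 = 0"
    "fps_X ^ (2 * (n - n)) dvd fps_of_poly W11 + fps_of_poly W12 * H"
    "fps_of_poly W21 + fps_of_poly W22 * H = (fps_of_poly W11 + fps_of_poly W12 * H) * H'"
    "fps_of_poly W11 * Z + fps_of_poly W12 = (fps_of_poly W21 * Z + fps_of_poly W22) * Z'"
    "\<And>i. a $ i ^ n * p $ i = a $ i ^ n * (poly W11 (a $ i) * p' $ i + poly W21 (a $ i) * v' $ i)"
    "\<And>i. a $ i ^ n * v $ i = a $ i ^ n * (poly W12 (a $ i) * p' $ i + poly W22 (a $ i) * v' $ i)"
    using pell_imp_transfer_factor[OF a p p' tr order_refl fg] by metis
  note G = boundary_state_gram[OF a p]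
  obtain w11 w12 w21 w22 where w: "W11 = [:w11:]" "W12 = [:w12:]" "W21 = [:w21:]" "W22 = [:w22:]"
    using W(1-4) by (metis diff_self_eq_0 degree_0_id le_zero_eq)
  have H0: "fps_nth H 0 = 0"
    using arg_cong[OF W(9), of "\<lambda>x. fps_nth x 0"] G(1,2) fg(3) by (simp add: poly_0_coeff_0)
  have w21: "w21 = 0"
    using arg_cong[OF W(12), of "\<lambda>x. fps_nth x 0"] H0 W(10) by (simp add: w)
  have "monom 1 (2 * n) = (f - g * gram_poly a p v) * (f + g * gram_poly a p v) - (- g * gram_poly a v v) * (g * gram_poly a p p)"
    unfolding det[symmetric] by (simp add: algebra_simps power2_eq_square)
  also have "\<dots> = (A * D - B * C) * (W11 * W22 - W12 * W21)"
    unfolding W(5-8) by (simp add: algebra_simps)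
  also have "A * D - B * C = monom 1 (2 * n)" using tr unfolding transfer_def by blast
  finally have "W11 * W22 - W12 * W21 = 1" by simp
  then have ww: "w11 * w22 = 1" by (simp add: w w21 one_pCons mult.commute)
  have pw: "p = w11 *\<^sub>R p'" "v = w12 *\<^sub>R p' + w22 *\<^sub>R v'"
    using W(14,15) a by (simp_all add: w w21 Finite_Cartesian_Product.vec_eq_iff)
  note P = p[unfolded boundary_state_def] and P' = p'[unfolded boundary_state_def]
  have "w11 * w11 = 1"
  proof -
    have "lorentz p p = w11 * w11 * lorentz p' p'"
      unfolding pw(1) by (simp add: lorentz_def algebra_simps)
    then show ?thesis using P P' by simp
  qed
  moreover have "w12 = 0"
  proof -
    have "lorentz p v = w11 * (w12 * lorentz p' p' + w22 * lorentz p' v')"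
      unfolding pw by (simp add: lorentz_def algebra_simps)
    then show ?thesis using P P' ww by auto
  qed
  moreover have "w22 = w11" using ww \<open>w11 * w11 = 1\<close> by (metis mult.left_commute mult.right_neutral)
  ultimately show ?thesis
    using pw by (intro exI[of _ w11]) (simp add: power2_eq_square)
qed

text \<open>
The point \<open>q\<close> is the next boundary point, one with a light-like tangent, and the count \<open>l + 1\<close>
would end in the middle of the double reflection at \<open>q\<close>. Now \<open>W\<close> is linear in \<open>X\<close>, and the
comparison at \<open>X = a\<^sub>i\<close> shows that \<open>p\<close> is a multiple of \<open>q\<close>. Then \<open>p\<close> has a light-like tangent as
well, so that \<open>H = O(X\<^sup>2)\<close>, and the factor of proportionality turns out to be \<open>0\<close>.
\<close>

lemma transfer_skip_impossible:
  assumes a: "\<forall>i. a $ i \<noteq> 0" and p: "boundary_state a p v" and p': "boundary_state a p' v'"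
    and tr: "transfer a p v p' v' l A B C D"
    and fg: "degree f \<le> Suc l" "degree g + 2 \<le> Suc l" "fps_nth Y 0 = poly (gram_poly a p v) 0"
      "Y\<^sup>2 = fps_of_poly ((gram_poly a p v)\<^sup>2 - gram_poly a p p * gram_poly a v v)"
      "fps_X ^ (2 * Suc l) dvd fps_of_poly f - fps_of_poly g * Y" "\<And>i. poly f (a $ i) = a $ i ^ Suc l"
    and q: "q = c *\<^sub>R p' + s *\<^sub>R v'" "s \<noteq> 0" "lorentz q (diag_inv a q) = 0"
    and light: "lorentz (diag_inv a q) (diag_inv a q) = 0"
  shows False
proof -
  have e: "Suc l - l = 1" by simp
  obtain W11 W12 W21 W22 :: "real poly" and H H' Z Z' :: "real fps" where W:
    "degree W11 \<le> 1" "degree W12 \<le> 1" "degree W21 \<le> 1" "degree W22 \<le> 1"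
    "(fps_of_poly (gram_poly a p v) + Y) * H = - fps_of_poly (gram_poly a p p)" "fps_nth H' 0 = 0"
    "fps_X ^ (2 * 1) dvd fps_of_poly W11 + fps_of_poly W12 * H"
    "fps_of_poly W21 + fps_of_poly W22 * H = (fps_of_poly W11 + fps_of_poly W12 * H) * H'"
    "fps_of_poly W11 * Z + fps_of_poly W12 = (fps_of_poly W21 * Z + fps_of_poly W22) * Z'"
    "\<And>i. a $ i ^ Suc l * p $ i = a $ i ^ l * (poly W11 (a $ i) * p' $ i + poly W21 (a $ i) * v' $ i)"
    using pell_imp_transfer_factor[OF a p p' tr _ fg, unfolded e] by (metis le_SucI order_refl)
  note G = boundary_state_gram[OF a p]
  note P = p[unfolded boundary_state_def] and P' = p'[unfolded boundary_state_def]
  define N where "N = fps_of_poly (gram_poly a p v) + Y"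
  have N0: "fps_nth N 0 \<noteq> 0" using G(2) fg(3) by (simp add: N_def poly_0_coeff_0)
  have NH: "N * H = - fps_of_poly (gram_poly a p p)" using W(5) by (simp add: N_def)
  have H0: "fps_nth H 0 = 0"
    using arg_cong[OF NH, of "\<lambda>x. fps_nth x 0"] N0 G(1) by (simp add: poly_0_coeff_0)
  define \<eta> where "\<eta> = fps_nth H 1"
  have H1: "fps_nth N 0 * \<eta> = - coeff (gram_poly a p p) 1"
    using arg_cong[OF NH, of "\<lambda>x. fps_nth x 1"] H0 by (simp add: \<eta>_def fps_mult_nth_1)
  define \<omega>1 \<omega>2 where "\<omega>1 = coeff W12 0" "\<omega>2 = coeff W22 0"
  \<comment> \<open>Divisibility by \<open>X\<^sup>2\<close> in the first two coefficients, where \<open>H = \<eta> X + \<dots>\<close>.\<close>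
  have low: "coeff W 0 = 0 \<and> coeff W 1 = - \<eta> * coeff W' 0"
    if "fps_X ^ (2 * 1) dvd fps_of_poly W + fps_of_poly W' * H" for W W'
  proof -
    have "fps_nth (fps_of_poly W + fps_of_poly W' * H) 0 = 0" "fps_nth (fps_of_poly W + fps_of_poly W' * H) 1 = 0"
      using that[unfolded fps_X_power_dvd_iff, rule_format] by (simp_all only: mult_1_right zero_less_numeral one_less_numeral_iff semiring_norm)
    then show ?thesis using H0 by (simp add: \<eta>_def add_eq_0_iff mult.commute)
  qed
  have d2: "fps_X ^ (2 * 1) dvd fps_of_poly W21 + fps_of_poly W22 * H"
    unfolding W(8) using W(7) by (rule dvd_mult2)
  have pl: "poly W t = coeff W 0 + coeff W 1 * t" if "degree W \<le> 1" for W :: "real poly" and t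
  proof -
    have "W = [:coeff W 0, coeff W 1:]"
      using that by (intro poly_eqI) (auto simp: coeff_pCons coeff_eq_0 split: nat.splits)
    then have "poly W t = poly [:coeff W 0, coeff W 1:] t" by (rule arg_cong)
    then show ?thesis by (simp add: mult.commute)
  qed
  have "p $ i = - \<eta> * (\<omega>1 * p' $ i + \<omega>2 * v' $ i)" for i
  proof -
    have "a $ i ^ Suc l * p $ i = a $ i ^ Suc l * (- \<eta> * (\<omega>1 * p' $ i + \<omega>2 * v' $ i))"
      unfolding W(10) pl[OF W(1)] pl[OF W(3)] using low[OF W(7)] low[OF d2]
      by (simp add: \<omega>1_\<omega>2_def algebra_simps)
    then show ?thesis using a by (metis mult_left_cancel power_not_zero)
  qed
  then have pw: "p = (- \<eta>) *\<^sub>R (\<omega>1 *\<^sub>R p' + \<omega>2 *\<^sub>R v')"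
    by (simp add: Finite_Cartesian_Product.vec_eq_iff)
  have p0: "p \<noteq> 0" using P by (auto simp: lorentz_def)
  have \<eta>0: "\<eta> \<noteq> 0" using p0 pw by auto
  have "\<omega>1 = \<omega>2 * fps_nth Z' 0"
    using arg_cong[OF W(9), of "\<lambda>x. fps_nth x 0"] low[OF W(7)] low[OF d2] by (simp add: \<omega>1_\<omega>2_def)
  then have \<omega>2: "\<omega>2 \<noteq> 0" using p0 pw by auto
  let ?\<alpha> = "lorentz v' (diag_inv a p')" and ?\<beta> = "cone_form a v'"
  have cf: "cone_form a (x *\<^sub>R p' + y *\<^sub>R v') = y * (2 * x * ?\<alpha> + y * ?\<beta>)" for x y
    unfolding cone_form_lincomb using P' by (simp add: cone_form_def lorentz_commute algebra_simps power2_eq_square)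
  have hom: "diag_inv a (k *\<^sub>R x) = k *\<^sub>R diag_inv a x" "lorentz (k *\<^sub>R x) (k *\<^sub>R y) = k\<^sup>2 * lorentz x y" for k x y
    by (simp_all add: Finite_Cartesian_Product.vec_eq_iff lorentz_def power2_eq_square algebra_simps)
  have "\<eta>\<^sup>2 * cone_form a (\<omega>1 *\<^sub>R p' + \<omega>2 *\<^sub>R v') = 0"
  proof -
    have "cone_form a p = 0" using P by (simp add: cone_form_def lorentz_commute)
    then show ?thesis unfolding pw cone_form_def hom by simp
  qed
  then have 1: "2 * \<omega>1 * ?\<alpha> + \<omega>2 * ?\<beta> = 0" using \<eta>0 \<omega>2 unfolding cf by simp
  have "cone_form a q = 0" using q(3) by (simp add: cone_form_def lorentz_commute)
  then have 2: "2 * c * ?\<alpha> + s * ?\<beta> = 0" using q(2) unfolding q(1) cf by simp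
  have "2 * ?\<alpha> * (\<omega>1 * s - c * \<omega>2) = s * (2 * \<omega>1 * ?\<alpha> + \<omega>2 * ?\<beta>) - \<omega>2 * (2 * c * ?\<alpha> + s * ?\<beta>)"
    by (simp add: algebra_simps)
  then have "\<omega>1 * s = c * \<omega>2" unfolding 1 2 using P' by simp
  then have "\<omega>1 *\<^sub>R p' + \<omega>2 *\<^sub>R v' = (\<omega>2 / s) *\<^sub>R q"
    using q(2) by (simp add: q(1) Finite_Cartesian_Product.vec_eq_iff field_simps)
  then have "lorentz (diag_inv a p) (diag_inv a p) = 0"
    using light unfolding pw by (simp only: hom mult_zero_right)
  then have "coeff (gram_poly a p p) 1 = 0" unfolding G(4) by simp
  then show False using H1 N0 \<eta>0 by simp
qed

section \<open>From closed trajectories to Pell equations\<close>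

text \<open>
Preserving a binary form up to the determinant \<open>\<Delta>\<close> means commuting with \<open>J N\<close>; the equations say
that the trace-free part of the matrix is proportional to \<open>J N\<close>.
\<close>

lemma transfer_commutes:
  fixes A B C D N11 N12 N22 :: "'a :: idom"
  assumes det: "A * D - B * C = \<Delta>" and \<Delta>: "\<Delta> \<noteq> 0"
    and form: "A\<^sup>2 * N11 + 2 * A * C * N12 + C\<^sup>2 * N22 = \<Delta> * N11"
      "A * B * N11 + (A * D + B * C) * N12 + C * D * N22 = \<Delta> * N12"
  shows "A * N11 + C * N12 = D * N11 - C * N12" "C * N22 = - (B * N11)"
proof -
  have "D * (A\<^sup>2 * N11 + 2 * A * C * N12 + C\<^sup>2 * N22) - C * (A * B * N11 + (A * D + B * C) * N12 + C * D * N22) =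
      (A * D - B * C) * (A * N11 + C * N12)"
    by (simp add: algebra_simps power2_eq_square)
  then have "\<Delta> * (A * N11 + C * N12) = \<Delta> * (D * N11 - C * N12)"
    unfolding form det by (simp add: algebra_simps)
  then show "A * N11 + C * N12 = D * N11 - C * N12" using \<Delta> by simp
  have "A * (A * B * N11 + (A * D + B * C) * N12 + C * D * N22) - B * (A\<^sup>2 * N11 + 2 * A * C * N12 + C\<^sup>2 * N22) =
      (A * D - B * C) * (A * N12 + C * N22)"
    by (simp add: algebra_simps power2_eq_square)
  then have "\<Delta> * (A * N12 + C * N22) = \<Delta> * (A * N12 - B * N11)"
    unfolding form det by (simp add: algebra_simps)
  then show "C * N22 = - (B * N11)" using \<Delta> by simp
qed

lemma coprime_difference_monom:
  fixes U V :: "real poly"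
  assumes "V - U = monom c n" "c \<noteq> 0" "poly V 0 \<noteq> 0"
  shows "coprime U V"
proof (rule coprimeI)
  fix x assume x: "x dvd U" "x dvd V"
  have X: "monom c n = smult c ([:0, 1:] ^ n)" by (simp add: monom_altdef)
  have "x dvd smult c ([:0, 1:] ^ n)" using x by (metis X assms(1) dvd_diff)
  then have "x dvd [:0, 1:] ^ n" using assms(2) by (simp add: dvd_smult_iff)
  moreover have "\<not> [:0, 1:] dvd V"
    using assms(3) poly_eq_0_iff_dvd[of V 0] by simp
  then have "coprime [:0, 1:] V"
    by (intro prime_elem_imp_coprime prime_elem_linear_field_poly) auto
  then have "coprime ([:0, 1:] ^ n) V" by simp
  ultimately show "is_unit x" using x(2) by (meson coprime_common_divisor)
qed

text \<open>
The order of the left-hand side at \<open>\<nu>\<close> is odd, so \<open>L\<close> divides \<open>U\<close> or \<open>V\<close>. When it is divided out,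
\<open>coprime_part_of_square\<close> applies to both factors.
\<close>

lemma linear_factor_parity:
  fixes U V N C L :: "real poly"
  assumes co: "coprime U V" and eq: "U * V * N\<^sup>2 = smult \<kappa> (L * C\<^sup>2)" and L: "L = [:- \<nu>, 1:]"
    and nz: "\<kappa> \<noteq> 0" "N \<noteq> 0" "U \<noteq> 0" "V \<noteq> 0"
  obtains (left) d e r q where "U = smult d (L * r\<^sup>2)" "V = smult e (q\<^sup>2)"
    | (right) d e r q where "U = smult d (r\<^sup>2)" "V = smult e (L * q\<^sup>2)"
proof -
  have L0: "L \<noteq> 0" by (simp add: L)
  have cancel: "x = y" if "L * x = L * y" for x y using that L0 by simp
  have LV: "L dvd V \<or> L dvd U"
  proof (rule ccontr)
    assume n: "\<not> (L dvd V \<or> L dvd U)"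
    have "poly U \<nu> \<noteq> 0" "poly V \<nu> \<noteq> 0" using n by (auto simp: L poly_eq_0_iff_dvd)
    then have o: "order \<nu> U = 0" "order \<nu> V = 0" by (simp_all add: order_0I)
    have C0: "C \<noteq> 0" using eq nz by auto
    have "order \<nu> L = 1" using order_power_n_n[of \<nu> 1] by (simp add: L)
    then have "order \<nu> (smult \<kappa> (L * C\<^sup>2)) = 1 + 2 * order \<nu> C"
      using nz L0 C0 by (simp add: order_smult order_mult power2_eq_square)
    moreover have "order \<nu> (U * V * N\<^sup>2) = 2 * order \<nu> N"
      using nz o by (simp add: order_mult power2_eq_square)
    ultimately show False unfolding eq by presburger
  qed
  then consider V1 where "V = L * V1" | U1 where "U = L * U1" by (auto elim: dvdE)
  then show ?thesis
  proof cases
    case (1 V1)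
    have "L * (U * V1 * N\<^sup>2) = U * V * N\<^sup>2" by (simp only: 1 mult_ac)
    also have "\<dots> = L * smult \<kappa> (C\<^sup>2)" by (simp only: eq mult_smult_right)
    finally have "U * V1 * N\<^sup>2 = smult \<kappa> (C\<^sup>2)" by (rule cancel)
    moreover have "coprime U V1" using co by (simp add: 1)
    ultimately have "\<exists>d r. d \<noteq> 0 \<and> U = smult d (r\<^sup>2)" "\<exists>e q. e \<noteq> 0 \<and> V1 = smult e (q\<^sup>2)"
      using coprime_part_of_square[of U V1 N \<kappa> C] coprime_part_of_square[of V1 U N \<kappa> C] nz
      by (simp_all add: mult.commute coprime_commute)
    then show ?thesis using right 1 by (metis mult_smult_right)
  next
    case (2 U1)
    have "L * (U1 * V * N\<^sup>2) = U * V * N\<^sup>2" by (simp only: 2 mult_ac)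
    also have "\<dots> = L * smult \<kappa> (C\<^sup>2)" by (simp only: eq mult_smult_right)
    finally have "U1 * V * N\<^sup>2 = smult \<kappa> (C\<^sup>2)" by (rule cancel)
    moreover have "coprime U1 V" using co by (simp add: 2)
    ultimately have "\<exists>d r. d \<noteq> 0 \<and> U1 = smult d (r\<^sup>2)" "\<exists>e q. e \<noteq> 0 \<and> V = smult e (q\<^sup>2)"
      using coprime_part_of_square[of U1 V N \<kappa> C] coprime_part_of_square[of V U1 N \<kappa> C] nz
      by (simp_all add: mult.commute coprime_commute)
    then show ?thesis using left 2 by (metis mult_smult_right)
  qed
qed

text \<open>
The characteristic polynomial of the transfer matrix at \<open>X = a\<^sub>i\<close> has a double root: its
determinant is \<open>a\<^sub>i\<^sup>2\<^sup>n\<close> and \<open>\<tau> a\<^sub>i\<^sup>n\<close> is an eigenvalue. So with \<open>2 f\<close> the trace, \<open>U = f - \<tau> X\<^sup>n\<close> vanishes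
at the \<open>a\<^sub>i\<close>. It is coprime to \<open>V = f + \<tau> X\<^sup>n\<close> since \<open>V - U = 2 \<tau> X\<^sup>n\<close> and \<open>V(0) \<noteq> 0\<close>; and \<open>U V N11\<^sup>2\<close> is
a multiple of \<open>(N12\<^sup>2 - N11 N22) C\<^sup>2\<close>, because the trace-free part of the matrix is proportional
to \<open>J N\<close>.
\<close>

lemma closed_imp_pell:
  fixes a p v :: "real^3"
  defines "R \<equiv> [:- a $ 0, 1:] * [:- a $ 1, 1:] * [:- a $ 2, 1:]"
  assumes a: "\<forall>i. a $ i \<noteq> 0" "a $ 0 \<noteq> a $ 1" "a $ 0 \<noteq> a $ 2" "a $ 1 \<noteq> a $ 2"
    and p: "boundary_state a p v"
    and tr: "transfer a p v p' v' n A B C D" and closed: "p' = \<tau> *\<^sub>R p" "v' = \<tau> *\<^sub>R v" "\<tau>\<^sup>2 = 1" and n: "n \<ge> 1"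
    and disc: "(gram_poly a p v)\<^sup>2 - gram_poly a p p * gram_poly a v v = smult \<kappa> (R * [:- \<nu>, 1:])" "\<kappa> \<noteq> 0"
    and row: "\<forall>i. p $ i \<noteq> 0 \<or> v $ i \<noteq> 0"
  obtains S T q r d e where "S = 1 \<and> T = R * [:- \<nu>, 1:] \<or> S = [:- \<nu>, 1:] \<and> T = R" "0 < d * e * \<kappa>"
    "smult d (S * q\<^sup>2) - smult e (T * r\<^sup>2) = monom (2 * \<tau>) n" "degree (S * q\<^sup>2) \<le> n" "degree (T * r\<^sup>2) \<le> n"
    "r \<noteq> 0" "poly (S * q\<^sup>2) 0 \<noteq> 0"
proof -
  note T = tr[unfolded transfer_def]
  define N11 N12 N22 where N: "N11 = gram_poly a p p" "N12 = gram_poly a p v" "N22 = gram_poly a v v"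
  have N11: "N11 \<noteq> 0" unfolding N boundary_state_gram(4)[OF a(1) p] by simp
  have \<tau>: "\<tau> = 1 \<or> \<tau> = -1" using closed(3) by (simp add: power2_eq_1_iff)
  then have \<tau>0: "\<tau> \<noteq> 0" by auto
  have inv: "gram_poly a p' p' = N11" "gram_poly a p' v' = N12"
    using \<tau> unfolding closed N by (auto simp: gram_poly_def)
  have det: "A * D - B * C = monom 1 (2 * n)" using T by blast
  have "A\<^sup>2 * N11 + 2 * A * C * N12 + C\<^sup>2 * N22 = monom 1 (2 * n) * N11"
    "A * B * N11 + (A * D + B * C) * N12 + C * D * N22 = monom 1 (2 * n) * N12"
    using T inv unfolding N by simp_all
  from transfer_commutes[OF det _ this] have com: "A * N11 + C * N12 = D * N11 - C * N12" "C * N22 = - (B * N11)"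
    by simp_all
  define f where "f = smult (1 / 2) (A + D)"
  define U V where UV: "U = f - monom \<tau> n" "V = f + monom \<tau> n"
  have f2: "A + D = smult 2 f" by (simp add: f_def)
  have "V - U = monom \<tau> n + monom \<tau> n" by (simp add: UV)
  then have VU: "V - U = monom (2 * \<tau>) n" by (simp add: add_monom)
  have degUV: "degree U \<le> n" "degree V \<le> n"
    using T unfolding UV f_def
    by (auto intro!: degree_diff_le degree_add_le degree_monom_le order_trans[OF degree_smult_le])
  have f0: "poly f 0 \<noteq> 0"
  proof -
    have CD: "poly C 0 = 0" "poly D 0 \<noteq> 0" using T by blast+
    have "poly (A * D - B * C) 0 = 0" unfolding det using n by (simp add: poly_monom power_0_left)
    then have "poly A 0 = 0" using CD by simp
    then show ?thesis using CD by (simp add: f_def)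
  qed
  have V0: "poly V 0 \<noteq> 0" and U0: "poly U 0 \<noteq> 0" using f0 n by (simp_all add: UV poly_monom power_0_left)
  have nz: "U \<noteq> 0" "V \<noteq> 0" using V0 U0 by auto
  have key: "U * V * N11\<^sup>2 = smult \<kappa> (R * [:- \<nu>, 1:] * C\<^sup>2)"
  proof -
    have "monom \<tau> n * monom \<tau> n = monom 1 (2 * n)"
      using closed(3) by (simp add: mult_monom mult_2 power2_eq_square)
    then have UV2: "U * V = f * f - (A * D - B * C)"
      unfolding det by (simp add: UV algebra_simps)
    have "smult 4 ((f * f - E) * N11\<^sup>2) = (smult 2 f * N11)\<^sup>2 - smult 4 (E * N11\<^sup>2)" for E
      by (simp add: algebra_simps power2_eq_square smult_diff_right)
    then have "smult 4 (U * V * N11\<^sup>2) = ((A + D) * N11)\<^sup>2 - smult 4 ((A * D - B * C) * N11\<^sup>2)"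
      unfolding UV2 f2 .
    also have "\<dots> = ((A + D) * N11)\<^sup>2 - 4 * ((A * D - B * C) * N11\<^sup>2)"
      by (simp add: numeral_poly)
    also have "\<dots> = (D * N11 - A * N11)\<^sup>2 + 4 * (C * N11 * (B * N11))"
      by (simp add: algebra_simps power2_eq_square)
    also have "D * N11 - A * N11 = 2 * (C * N12)"
      using com(1) by (simp add: algebra_simps)
    also have "B * N11 = - (C * N22)" using com(2) by simp
    also have "(2 * (C * N12))\<^sup>2 + 4 * (C * N11 * (- (C * N22))) = 4 * ((N12\<^sup>2 - N11 * N22) * C\<^sup>2)"
      by (simp add: algebra_simps power2_eq_square)
    also have "\<dots> = smult 4 (smult \<kappa> (R * [:- \<nu>, 1:] * C\<^sup>2))"
      unfolding disc(1)[folded N] by (simp only: mult_smult_left numeral_poly mult_pCons_left pCons_0_0 add_0_right mult_zero_left)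
    finally show ?thesis by (metis smult_cancel zero_neq_numeral)
  qed
  have Ua: "poly U (a $ i) = 0" for i
  proof -
    let ?t = "a $ i"
    define z where "z = \<tau> * ?t ^ n"
    have z0: "z \<noteq> 0" using \<tau>0 a by (simp add: z_def)
    have r: "poly A ?t * p $ i + poly C ?t * v $ i = z * p $ i" "poly B ?t * p $ i + poly D ?t * v $ i = z * v $ i"
      using T closed by (simp_all add: z_def mult_ac)
    have dt: "poly A ?t * poly D ?t - poly B ?t * poly C ?t = z * z"
    proof -
      have "z * z = \<tau>\<^sup>2 * ?t ^ (2 * n)" by (simp add: z_def power2_eq_square mult_2 power_add)
      then show ?thesis using arg_cong[OF det, of "\<lambda>x. poly x ?t"] closed(3) by (simp add: poly_monom)
    qed
    define P where "P = (poly A ?t - z) * (poly D ?t - z) - poly B ?t * poly C ?t"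
    have "P * p $ i = (poly D ?t - z) * (poly A ?t * p $ i + poly C ?t * v $ i - z * p $ i)
        - poly C ?t * (poly B ?t * p $ i + poly D ?t * v $ i - z * v $ i)"
      "P * v $ i = (poly A ?t - z) * (poly B ?t * p $ i + poly D ?t * v $ i - z * v $ i)
        - poly B ?t * (poly A ?t * p $ i + poly C ?t * v $ i - z * p $ i)"
      by (simp_all add: P_def algebra_simps)
    then have "P * p $ i = 0" "P * v $ i = 0" unfolding r by simp_all
    then have "P = 0" using row by auto
    then have "z * (2 * z - (poly A ?t + poly D ?t)) = 0"
      using dt unfolding P_def by (simp add: algebra_simps)
    then have "poly A ?t + poly D ?t = 2 * z" using z0 by simp
    then show ?thesis by (simp add: UV f_def poly_monom z_def)
  qed
  have "R dvd U"
  proof -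
    obtain U1 where U1: "U = [:- a $ 0, 1:] * U1" using Ua[of 0] by (auto simp: poly_eq_0_iff_dvd elim: dvdE)
    have "poly U1 (a $ 1) = 0" using Ua[of 1] a by (simp add: U1)
    then obtain U2 where U2: "U1 = [:- a $ 1, 1:] * U2" by (auto simp: poly_eq_0_iff_dvd elim: dvdE)
    have "poly U2 (a $ 2) = 0" using Ua[of 2] a by (simp add: U1 U2)
    then obtain U3 where "U2 = [:- a $ 2, 1:] * U3" by (auto simp: poly_eq_0_iff_dvd elim: dvdE)
    then have "U = R * U3" unfolding U1 U2 R_def by (simp only: mult.assoc)
    then show ?thesis by simp
  qed
  then obtain U' where U': "U = R * U'" by (elim dvdE)
  define L where "L = [:- \<nu>, 1:]"
  have R0: "R \<noteq> 0" by (simp add: R_def)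
  have "R * (U' * V * N11\<^sup>2) = R * smult \<kappa> (L * C\<^sup>2)"
    using key by (simp add: U' L_def mult_ac del: mult_pCons_left mult_pCons_right)
  then have key': "U' * V * N11\<^sup>2 = smult \<kappa> (L * C\<^sup>2)" using R0 mult_left_cancel by blast
  have "coprime U V" using coprime_difference_monom[OF VU _ V0] \<tau>0 by simp
  then have co: "coprime U' V" by (simp add: U')
  have U'0: "U' \<noteq> 0" using nz U' by auto
  have sign: "0 < d * e * \<kappa>"
    if "U = smult e (T * r\<^sup>2)" "V = smult d (S * q\<^sup>2)" "S * T = R * L" for S T q r d e
  proof -
    have "smult (d * e) ((S * T) * (q * r * N11)\<^sup>2) = U * V * N11\<^sup>2"
      unfolding that(1,2) by (simp add: power2_eq_square mult_ac)
    also have "\<dots> = smult \<kappa> ((S * T) * C\<^sup>2)"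
      unfolding key that(3) L_def ..
    finally have "(S * T) * smult (d * e) ((q * r * N11)\<^sup>2) = (S * T) * smult \<kappa> (C\<^sup>2)" by simp
    moreover have "L \<noteq> 0" by (simp add: L_def)
    then have "S * T \<noteq> 0" unfolding that(3) using R0 mult_eq_0_iff by blast
    ultimately have e: "smult (d * e) ((q * r * N11)\<^sup>2) = smult \<kappa> (C\<^sup>2)"
      using mult_left_cancel by blast
    have "d * e \<noteq> 0" "q * r * N11 \<noteq> 0" using nz N11 that by auto
    define x y where "x = lead_coeff (q * r * N11)" "y = lead_coeff C"
    have "d * e * x\<^sup>2 = \<kappa> * y\<^sup>2"
      using arg_cong[OF e, of lead_coeff] unfolding x_y_def lead_coeff_smult lead_coeff_power .
    then have "d * e * \<kappa> * x\<^sup>2 = (\<kappa> * y)\<^sup>2"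
      by (simp add: power2_eq_square mult_ac)
    moreover have x: "x \<noteq> 0" using \<open>q * r * N11 \<noteq> 0\<close> leading_coeff_0_iff unfolding x_y_def by blast
    then have "d * e * \<kappa> * x\<^sup>2 \<noteq> 0"
      using \<open>d * e \<noteq> 0\<close> disc(2) by simp
    ultimately have "0 < d * e * \<kappa> * x\<^sup>2" by simp
    then show ?thesis by (rule zero_less_mult_pos2) (use x in simp)
  qed
  note conclude = that
  have final: thesis
    if "U = smult e (T * r\<^sup>2)" "V = smult d (S * q\<^sup>2)" "S = 1 \<and> T = R * L \<or> S = L \<and> T = R" for S T q r d e
  proof (rule conclude)
    show "S = 1 \<and> T = R * [:- \<nu>, 1:] \<or> S = [:- \<nu>, 1:] \<and> T = R"
      using that(3) by (simp only: L_def)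
    show "0 < d * e * \<kappa>" by (rule sign[OF that(1,2)]) (use that(3) in auto)
    show "smult d (S * q\<^sup>2) - smult e (T * r\<^sup>2) = monom (2 * \<tau>) n" using VU that by simp
    show "degree (S * q\<^sup>2) \<le> n" "degree (T * r\<^sup>2) \<le> n" using degUV nz that by (auto split: if_splits)
    show "r \<noteq> 0" using nz that by auto
    show "poly (S * q\<^sup>2) 0 \<noteq> 0" using V0 that by auto
  qed
  show thesis
  proof (rule linear_factor_parity[OF co key' L_def disc(2) N11 U'0 nz(2)])
    fix d e r q assume "U' = smult d (L * r\<^sup>2)" "V = smult e (q\<^sup>2)"
    then show thesis by (intro final[of d "R * L" r e 1 q]) (simp_all add: U' mult_ac)
  next
    fix d e r q assume "U' = smult d (r\<^sup>2)" "V = smult e (L * q\<^sup>2)"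
    then show thesis by (intro final[of d R r e L q]) (simp_all add: U' mult_ac)
  qed
qed

text \<open>
The product \<open>S (q - F r)(q + F r)\<close> is divisible by \<open>X\<^sup>n\<close>. The two factors with \<open>F\<close> add up to \<open>2 q\<close>,
which does not vanish at \<open>0\<close>, so one of them is a unit and the other one takes all of \<open>X\<^sup>n\<close>.
\<close>

lemma pell_imp_fps_root:
  fixes S T q r :: "real poly" and F :: "real fps"
  assumes F: "fps_of_poly S * F\<^sup>2 = fps_of_poly T"
    and pell: "smult d (S * q\<^sup>2) - smult e (T * r\<^sup>2) = monom c n" "0 < d * e" "n \<ge> 1"
    and nz: "r \<noteq> 0" "poly (S * q\<^sup>2) 0 \<noteq> 0"
  shows "\<exists>q' r'. r' \<noteq> 0 \<and> degree q' = degree q \<and> degree r' = degree r \<and>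
     fps_X ^ n dvd fps_of_poly q' + F * fps_of_poly r'"
proof -
  let ?F = "fps_of_poly :: real poly \<Rightarrow> real fps"
  note FP = fps_of_poly_add fps_of_poly_diff fps_of_poly_uminus fps_of_poly_mult fps_of_poly_power
    fps_of_poly_monom fps_of_poly_smult
  define \<mu> where "\<mu> = sqrt (e / d)"
  have de: "d \<noteq> 0" "e \<noteq> 0" "e / d > 0" using pell(2) by (auto simp: zero_less_mult_iff zero_less_divide_iff)
  have \<mu>: "\<mu>\<^sup>2 = e / d" "\<mu> \<noteq> 0" using de by (simp_all add: \<mu>_def)
  define r' where "r' = smult \<mu> r"
  have "S * q\<^sup>2 - T * r'\<^sup>2 = smult (1 / d) (smult d (S * q\<^sup>2) - smult e (T * r\<^sup>2))"
    using de by (simp add: r'_def smult_diff_right \<mu>(1)[symmetric] power2_eq_square[of "smult \<mu> r"])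
      (simp add: \<mu>(1)[unfolded power2_eq_square] power2_eq_square)
  then have p: "S * q\<^sup>2 - T * r'\<^sup>2 = monom (c / d) n" unfolding pell(1) by (simp add: smult_monom)
  have "?F S * ((?F q - F * ?F r') * (?F q + F * ?F r')) = ?F (S * q\<^sup>2 - T * r'\<^sup>2)"
    unfolding FP F[symmetric] by (simp add: algebra_simps power2_eq_square)
  also have "\<dots> = fps_X ^ n * fps_const (c / d)" unfolding p FP by (simp add: mult.commute)
  finally have prod: "((?F q - F * ?F r') * (?F q + F * ?F r')) * ?F S = fps_X ^ n * fps_const (c / d)"
    by (simp only: mult_ac)
  have nth0: "fps_nth (?F p) 0 = poly p 0" for p by (simp add: poly_0_coeff_0)
  have S0: "fps_nth (?F S) 0 \<noteq> 0" and q0: "poly q 0 \<noteq> 0" using nz(2) unfolding nth0 by auto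
  have X: "fps_X ^ n dvd (?F q - F * ?F r') * (?F q + F * ?F r')"
    by (rule fps_X_power_dvd_mult_unit[OF _ S0]) (simp add: prod)
  have sum0: "fps_nth (?F q - F * ?F r') 0 + fps_nth (?F q + F * ?F r') 0 \<noteq> 0"
    using q0 by (simp add: nth0 del: fps_of_poly_nth)
  then consider "fps_nth (?F q - F * ?F r') 0 \<noteq> 0" | "fps_nth (?F q + F * ?F r') 0 \<noteq> 0" by fastforce
  then show ?thesis
  proof cases
    case 1
    then have "fps_X ^ n dvd ?F q + F * ?F r'"
      using X fps_X_power_dvd_mult_unit by (metis mult.commute)
    then show ?thesis using nz \<mu>
      by (intro exI[of _ q] exI[of _ r']) (simp add: r'_def)
  next
    case 2
    then have "fps_X ^ n dvd ?F q - F * ?F r'"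
      using X fps_X_power_dvd_mult_unit by metis
    then show ?thesis using nz \<mu>
      by (intro exI[of _ q] exI[of _ "- r'"]) (simp add: r'_def FP)
  qed
qed

section \<open>Trajectories and their caustics\<close>

text \<open>
The parameter \<open>\<sigma>\<close> is the sign of \<open>cone_form\<close> on the table: positive inside the collar and on the
transverse domain, negative outside the collar.
\<close>

locale billiard =
  fixes a :: "real^3" and M :: "(real^3) set" and p v :: "nat \<Rightarrow> real^3" and \<sigma> :: real
  assumes nonzero: "\<forall>i. a $ i \<noteq> 0"
    and distinct: "a $ 0 \<noteq> a $ 1" "a $ 0 \<noteq> a $ 2" "a $ 1 \<noteq> a $ 2"
    and traj: "billiard_trajectory a M p v"
    and table: "\<sigma> \<noteq> 0" "M \<subseteq> hyperboloid" "\<And>x. x \<in> M \<Longrightarrow> \<sigma> * cone_form a x \<ge> 0"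
begin

lemma state: "boundary_state a (p k) (v k)"
  using traj table unfolding billiard_trajectory_def boundary_state_def table_boundary_def hyperboloid_def cone_form_def
  by (auto simp: lorentz_commute)

lemma step:
  obtains c s c' s' u where "p (Suc k) = c *\<^sub>R p k + s *\<^sub>R v k" "u = c' *\<^sub>R p k + s' *\<^sub>R v k"
    "c * s' - s * c' = 1" "s > 0" "v (Suc k) = reflect a (p (Suc k)) u"
    "lorentz (p (Suc k)) u = 0" "lorentz u (diag_inv a (p (Suc k))) = - lorentz (v k) (diag_inv a (p k))"
    "\<sigma> * lorentz (v k) (diag_inv a (p k)) > 0"
proof -
  from traj obtain u where u: "billiard_segment a M (p k) (v k) (p (Suc k)) u" "v (Suc k) = reflect a (p (Suc k)) u"
    unfolding billiard_trajectory_def by blast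
  have nz: "lorentz (v k) (diag_inv a (p k)) \<noteq> 0" using state[of k] by (simp add: boundary_state_def)
  obtain c s c' s' where C: "p (Suc k) = c *\<^sub>R p k + s *\<^sub>R v k" "u = c' *\<^sub>R p k + s' *\<^sub>R v k"
    "c * s' - s * c' = 1" "s > 0" "lorentz (p (Suc k)) u = 0"
    "lorentz u (diag_inv a (p (Suc k))) = - lorentz (v k) (diag_inv a (p k))"
    "\<sigma> * lorentz (v k) (diag_inv a (p k)) \<ge> 0"
    using billiard_segment_coordinates[OF state u(1) table] by metis
  have "\<sigma> * lorentz (v k) (diag_inv a (p k)) > 0"
    using C(7) nz table(1) by (simp add: less_le)
  then show ?thesis by (rule that[OF C(1-4) u(2) C(5,6)])
qed

lemma reflections_Suc: "reflections a p (Suc N) = reflections a p N + bounces a (p (Suc N))"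
  by (simp add: reflections_def bounces_def)

lemma transfer_step: "\<exists>A B C D. transfer a (p k) (v k) (p (Suc k)) (v (Suc k)) (bounces a (p (Suc k))) A B C D"
proof -
  obtain c s c' s' u where s: "p (Suc k) = c *\<^sub>R p k + s *\<^sub>R v k" "u = c' *\<^sub>R p k + s' *\<^sub>R v k"
    "c * s' - s * c' = 1" "s > 0" "v (Suc k) = reflect a (p (Suc k)) u"
    "lorentz (p (Suc k)) u = 0" "lorentz u (diag_inv a (p (Suc k))) = - lorentz (v k) (diag_inv a (p k))"
    by (rule step)
  have "lorentz (p (Suc k)) (p (Suc k)) = 1" "lorentz (p (Suc k)) (diag_inv a (p (Suc k))) = 0"
    using state[of "Suc k"] by (simp_all add: boundary_state_def)
  from step_transfer[OF nonzero state s(1-3) _ this s(6,7)] s(4,5) show ?thesis by simp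
qed

lemma transfer_iterate: "\<exists>A B C D. transfer a (p 0) (v 0) (p N) (v N) (reflections a p N) A B C D"
proof (induction N)
  case 0
  have "reflections a p 0 = 0" by (simp add: reflections_def)
  then show ?case using transfer_refl by metis
next
  case (Suc N)
  then obtain A B C D where 1: "transfer a (p 0) (v 0) (p N) (v N) (reflections a p N) A B C D" by blast
  obtain A' B' C' D' where "transfer a (p N) (v N) (p (Suc N)) (v (Suc N)) (bounces a (p (Suc N))) A' B' C' D'"
    using transfer_step by blast
  from transfer_trans[OF 1 this] show ?case unfolding reflections_Suc by blast
qed

text \<open>
The count grows by one or two, so every number is reached or jumped over at a double
reflection.
\<close>

lemma reflections_hit:
  "\<exists>N. reflections a p N = n \<or> Suc (reflections a p N) = n \<and> lightlike_tangent a (p (Suc N))"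
proof (induction n)
  case 0
  then show ?case by (intro exI[of _ 0]) (simp add: reflections_def)
next
  case (Suc n)
  then obtain N where "reflections a p N = n \<or> Suc (reflections a p N) = n \<and> lightlike_tangent a (p (Suc N))" by blast
  then show ?case
  proof
    assume n: "reflections a p N = n"
    show ?thesis
    proof (cases "lightlike_tangent a (p (Suc N))")
      case False
      then have "reflections a p (Suc N) = Suc n" using n by (simp add: reflections_Suc bounces_def)
      then show ?thesis by blast
    qed (use n in blast)
  next
    assume "Suc (reflections a p N) = n \<and> lightlike_tangent a (p (Suc N))"
    then have "reflections a p (Suc N) = Suc n" by (auto simp: reflections_Suc bounces_def)
    then show ?thesis by blast
  qed
qed

abbreviation "R \<equiv> [:- a $ 0, 1:] * [:- a $ 1, 1:] * [:- a $ 2, 1:]"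

end

text \<open>
The last assumption on \<open>\<epsilon>\<close> says that the radicands of the two Taylor series are positive at \<open>0\<close>.
\<close>

locale billiard_caustic = billiard +
  fixes \<nu> \<epsilon> :: real
  assumes \<nu>: "\<nu> \<notin> {0, a $ 0, a $ 1, a $ 2}" and caustic: "has_caustic a \<nu> p v"
    and \<epsilon>: "\<epsilon>\<^sup>2 = 1" "\<epsilon> * (a $ 0 * a $ 1 * a $ 2 * \<nu>) > 0"
begin

abbreviation "L \<equiv> [:- \<nu>, 1:]"
abbreviation "\<kappa> \<equiv> - lorentz (v 0) (v 0)"

lemma nu: "\<forall>i. a $ i \<noteq> \<nu>" using \<nu> by (auto simp: all_3)

lemma disc:
  "(gram_poly a (p 0) (v 0))\<^sup>2 - gram_poly a (p 0) (p 0) * gram_poly a (v 0) (v 0) = smult \<kappa> (R * L)" "\<kappa> \<noteq> 0"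
proof -
  have c: "lorentz (v 0) (v 0) \<noteq> 0" "tangent_to_cone (confocal a \<nu>) (span {p 0, v 0})"
    using caustic by (auto simp: has_caustic_def)
  have s: "lorentz (p 0) (p 0) = 1" "lorentz (p 0) (v 0) = 0"
    using state[of 0] by (auto simp: boundary_state_def)
  show "(gram_poly a (p 0) (v 0))\<^sup>2 - gram_poly a (p 0) (p 0) * gram_poly a (v 0) (v 0) = smult \<kappa> (R * L)"
    by (rule caustic_discriminant[OF s c(2) nu])
  show "\<kappa> \<noteq> 0" using c(1) by simp
qed

lemma poly_RL: "poly (R * L) t = (t - a $ 0) * (t - a $ 1) * (t - a $ 2) * (t - \<nu>)"
  unfolding poly_mult by simp

text \<open>
At \<open>X = 0\<close> the point \<open>p\<close> is a null vector, so the discriminant is a square there.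
\<close>

lemma kappa_sign: "\<kappa> * \<epsilon> > 0"
proof -
  have "poly (smult \<kappa> (R * L)) 0 = (poly (gram_poly a (p 0) (v 0)) 0)\<^sup>2"
    unfolding disc(1)[symmetric] using boundary_state_gram(1)[OF nonzero state] by simp
  moreover have "poly (gram_poly a (p 0) (v 0)) 0 \<noteq> 0" using boundary_state_gram(2)[OF nonzero state] .
  ultimately have "poly (smult \<kappa> (R * L)) 0 > 0" by simp
  then have "\<kappa> * (a $ 0 * a $ 1 * a $ 2 * \<nu>) > 0"
    unfolding poly_smult poly_RL by (simp add: mult_ac)
  from mult_pos_pos[OF this \<epsilon>(2)] have "\<kappa> * \<epsilon> * (a $ 0 * a $ 1 * a $ 2 * \<nu>)\<^sup>2 > 0"
    by (simp only: power2_eq_square mult_ac)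
  then show ?thesis by (rule zero_less_mult_pos2) (use nonzero \<nu> in simp)
qed

text \<open>
If \<open>p\<^sub>i = v\<^sub>i = 0\<close>, then the segment lies in a coordinate plane, and the discriminant vanishes
to second order at \<open>a\<^sub>i\<close>. But its zeros \<open>a\<^sub>0, a\<^sub>1, a\<^sub>2, \<nu>\<close> are simple.
\<close>

lemma rows: "\<forall>i. p 0 $ i \<noteq> 0 \<or> v 0 $ i \<noteq> 0"
proof -
  let ?w = "cross (p 0) (v 0)"
  have D: "smult \<kappa> (R * L) \<noteq> 0" using disc(2) by simp
  have "(a $ 0 - \<nu>) * (a $ 1 - \<nu>) * (a $ 2 - \<nu>) *
     (- (?w $ 0)\<^sup>2 * (a $ 0 - \<nu>) + (?w $ 1)\<^sup>2 * (a $ 1 - \<nu>) + (?w $ 2)\<^sup>2 * (a $ 2 - \<nu>)) = 0"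
    unfolding gram_det[symmetric] disc poly_smult poly_RL by simp
  then have b: "- (?w $ 0)\<^sup>2 * (a $ 0 - \<nu>) + (?w $ 1)\<^sup>2 * (a $ 1 - \<nu>) + (?w $ 2)\<^sup>2 * (a $ 2 - \<nu>) = 0"
    using nu by simp
  have nz: "?w \<noteq> 0"
  proof
    assume "?w = 0"
    then have "poly (smult \<kappa> (R * L)) t = poly 0 t" for t
      unfolding disc(1)[symmetric] gram_det by simp
    then show False using D poly_ext by blast
  qed
  show ?thesis
    unfolding all_3 using b nz nu by (auto simp: vec3_eq_iff all_3)
qed

lemma order_RL: "order (a $ 0) (R * L) = 1"
proof -
  have "R * L = [:- a $ 0, 1:] ^ 1 * ([:- a $ 1, 1:] * [:- a $ 2, 1:] * L)"
    by (simp only: power_one_right mult.assoc)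
  moreover have "poly ([:- a $ 1, 1:] * [:- a $ 2, 1:] * L) (a $ 0) \<noteq> 0"
    unfolding poly_mult using distinct nu by simp
  moreover from this have "order (a $ 0) ([:- a $ 1, 1:] * [:- a $ 2, 1:] * L) = 0" by (rule order_0I)
  moreover have "R * L \<noteq> 0" by simp
  ultimately show ?thesis using order_mult order_power_n_n by (metis add.right_neutral)
qed

lemma hankel_zero_imp_closed:
  assumes ST: "S * T = smult \<epsilon> (R * L)" "fps_of_poly S * F\<^sup>2 = fps_of_poly T" "fps_nth F 0 \<noteq> 0" "\<And>i. poly T (a $ i) = 0"
    and sk: "s \<ge> 1" "k \<ge> 1" "n = s + 2 * k - 1" "degree S + 2 * (s + k - 2) \<le> n" "degree T + 2 * (k - 1) \<le> n"
    and hankel: "hankel_det (fps_nth F) s k = 0"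
  obtains N \<tau> where "reflections a p N = n" "\<tau>\<^sup>2 = 1" "p N = \<tau> *\<^sub>R p 0" "v N = \<tau> *\<^sub>R v 0"
proof -
  obtain q r where qr: "r \<noteq> 0" "degree r < k" "degree q < s + k - 1" "fps_X ^ n dvd fps_of_poly q + F * fps_of_poly r"
    using hankel unfolding hankel_det_eq_0_iff[OF sk(2,1)] sk(3) by blast
  let ?\<Delta> = "(gram_poly a (p 0) (v 0))\<^sup>2 - gram_poly a (p 0) (p 0) * gram_poly a (v 0) (v 0)"
  let ?b = "poly (gram_poly a (p 0) (v 0)) 0"
  note G = boundary_state_gram[OF nonzero state[of 0]]
  have e0: "\<epsilon> \<noteq> 0" using \<epsilon> by auto
  have D: "?\<Delta> = smult (\<kappa> / \<epsilon>) (S * T)" unfolding disc ST using e0 by simp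
  have D0: "poly ?\<Delta> 0 = ?b\<^sup>2" using G(1) by simp
  have ord: "order (a $ 0) (S * T) = 1" unfolding ST order_smult[OF e0] by (rule order_RL)
  have d: "degree (S * q\<^sup>2) \<le> n" "degree (T * r\<^sup>2) \<le> n" "degree q + degree r + 2 \<le> n"
  proof -
    have "degree (x\<^sup>2) \<le> 2 * degree x" for x :: "real poly" by (metis degree_power_le mult.commute)
    then have "degree (y * x\<^sup>2) \<le> degree y + 2 * degree x" for x y :: "real poly"
      using degree_mult_le[of y "x\<^sup>2"] by (meson add_left_mono order_trans)
    from this[of S q] this[of T r] show "degree (S * q\<^sup>2) \<le> n" "degree (T * r\<^sup>2) \<le> n"
      using qr sk by linarith+
    show "degree q + degree r + 2 \<le> n" using qr sk by linarith
  qed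
  obtain f g Y where fg: "degree f \<le> n" "degree g + 2 \<le> n" "Y\<^sup>2 = fps_of_poly ?\<Delta>" "fps_nth Y 0 = ?b"
    "fps_X ^ (2 * n) dvd fps_of_poly f - fps_of_poly g * Y"
    "f\<^sup>2 - g\<^sup>2 * ?\<Delta> = monom 1 (2 * n)" "\<And>t. poly T t = 0 \<Longrightarrow> poly f t = t ^ n"
    using pell_polynomials[OF D D0 G(2) ord ST(2,3) qr(1) d qr(4)] by metis
  have fa: "poly f (a $ i) = a $ i ^ n" for i using fg(7) ST(4) by blast
  obtain N where N: "reflections a p N = n \<or> Suc (reflections a p N) = n \<and> lightlike_tangent a (p (Suc N))"
    using reflections_hit by blast
  obtain A B C D where tr: "transfer a (p 0) (v 0) (p N) (v N) (reflections a p N) A B C D"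
    using transfer_iterate by blast
  from N show ?thesis
  proof
    assume n: "reflections a p N = n"
    from transfer_closes[OF nonzero state state tr[unfolded n] fg(1,2,4,3,5) fa fg(6)] show ?thesis
      using that n by blast
  next
    assume n: "Suc (reflections a p N) = n \<and> lightlike_tangent a (p (Suc N))"
    obtain c s where q: "p (Suc N) = c *\<^sub>R p N + s *\<^sub>R v N" "s > 0" by (rule step[of N])
    have b: "lorentz (p (Suc N)) (p (Suc N)) = 1" "lorentz (p (Suc N)) (diag_inv a (p (Suc N))) = 0"
      using state[of "Suc N"] by (simp_all add: boundary_state_def)
    have "lorentz (diag_inv a (p (Suc N))) (diag_inv a (p (Suc N))) = 0"
      using n lightlike_tangent_iff[OF b nonzero] by blast
    with transfer_skip_impossible[OF nonzero state state tr _ _ fg(4,3) _ _ q(1) _ b(2)] n fg fa q(2)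
    show ?thesis by auto
  qed
qed

text \<open>
Which of the two Pell equations occurs is decided by degrees: one of the two terms on the
left must have degree \<open>n\<close>, and both have the parity of the degree of \<open>S\<close>.
\<close>

lemma closed_imp_hankel_zero:
  assumes closed: "reflections a p N = n" "\<tau>\<^sup>2 = 1" "p N = \<tau> *\<^sub>R p 0" "v N = \<tau> *\<^sub>R v 0"
    and ST: "S = 1 \<and> T0 = R * L \<and> even n \<or> S = L \<and> T0 = R \<and> odd n"
    and F: "fps_of_poly S * F\<^sup>2 = fps_of_poly (smult \<epsilon> T0)"
    and sk: "s \<ge> 1" "k \<ge> 1" "n = s + 2 * k - 1" "s = (if even n then 3 else 2)"
  shows "hankel_det (fps_nth F) s k = 0"
proof -
  have n1: "n \<ge> 1" using sk(1-3) by linarith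
  obtain A B C D where tr: "transfer a (p 0) (v 0) (p N) (v N) n A B C D"
    using transfer_iterate closed(1) by metis
  show ?thesis
  proof (rule closed_imp_pell[OF nonzero distinct state tr closed(3,4,2) n1 disc rows])
    fix S' T' q r d e
    assume P: "S' = 1 \<and> T' = R * L \<or> S' = L \<and> T' = R" "0 < d * e * \<kappa>"
      "smult d (S' * q\<^sup>2) - smult e (T' * r\<^sup>2) = monom (2 * \<tau>) n" "degree (S' * q\<^sup>2) \<le> n" "degree (T' * r\<^sup>2) \<le> n"
      "r \<noteq> 0" "poly (S' * q\<^sup>2) 0 \<noteq> 0"
    have q0: "q \<noteq> 0" using P(7) by auto
    have deg1: "degree L = 1" "degree R = 3" "degree (R * L) = 4" "degree (1 :: real poly) = 0"
      by (simp_all add: degree_mult_eq del: mult_pCons_left mult_pCons_right)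
    have dq: "degree (S' * q\<^sup>2) = degree S' + 2 * degree q"
      using P(1) q0 by (auto simp: degree_mult_eq degree_power_eq simp del: mult_pCons_left mult_pCons_right)
    have dr: "degree (T' * r\<^sup>2) = degree T' + 2 * degree r"
      using P(1,6) by (auto simp: degree_mult_eq degree_power_eq simp del: mult_pCons_left mult_pCons_right)
    have \<tau>0: "\<tau> \<noteq> 0" using closed(2) by auto
    have top: "degree (S' * q\<^sup>2) = n \<or> degree (T' * r\<^sup>2) = n"
    proof (rule ccontr)
      assume "\<not> ?thesis"
      then have "coeff (S' * q\<^sup>2) n = 0" "coeff (T' * r\<^sup>2) n = 0" using P(4,5) by (auto intro!: coeff_eq_0)
      then have "coeff (smult d (S' * q\<^sup>2) - smult e (T' * r\<^sup>2)) n = 0" by simp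
      then show False unfolding P(3) using \<tau>0 by simp
    qed
    have par: "even n \<longleftrightarrow> S' = 1"
    proof -
      have "L \<noteq> 1" by (simp add: one_pCons)
      then show ?thesis using P(1) top deg1 unfolding dq dr by auto
    qed
    have "L \<noteq> 1" by (simp add: one_pCons)
    with ST P(1) par have ST': "S' = S" "T' = T0" by auto
    have "smult e (T0 * r\<^sup>2) = smult (e * \<epsilon>) (smult \<epsilon> T0 * r\<^sup>2)"
      using \<epsilon>(1) by (simp add: power2_eq_square mult.assoc)
    then have pell: "smult d (S * q\<^sup>2) - smult (e * \<epsilon>) (smult \<epsilon> T0 * r\<^sup>2) = monom (2 * \<tau>) n"
      using P(3) ST' by simp
    have "0 < (d * e * \<kappa>) * (\<kappa> * \<epsilon>)" using P(2) kappa_sign by (rule mult_pos_pos)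
    then have "0 < d * (e * \<epsilon>) * \<kappa>\<^sup>2" by (simp only: power2_eq_square mult_ac)
    then have "0 < d * (e * \<epsilon>)" by (rule zero_less_mult_pos2) (use disc(2) in simp)
    from pell_imp_fps_root[OF F pell this n1 P(6)] P(7) ST'
    obtain q' r' where qr: "r' \<noteq> 0" "degree q' = degree q" "degree r' = degree r" "fps_X ^ n dvd fps_of_poly q' + F * fps_of_poly r'"
      by auto
    have "degree q < s + k - 1 \<and> degree r < k"
    proof (cases "even n")
      case True
      then have "s = 3" "S' = 1" using sk(4) par by auto
      then have "2 * degree q \<le> n" "4 + 2 * degree r \<le> n" "n = 2 * k + 2"
        using P(1,4,5) deg1 sk(3) \<open>L \<noteq> 1\<close> unfolding dq dr by auto
      then show ?thesis using \<open>s = 3\<close> by linarith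
    next
      case False
      then have "s = 2" "S' = L" "T' = R" using sk(4) par P(1) by auto
      then have "1 + 2 * degree q \<le> n" "3 + 2 * degree r \<le> n" "n = 2 * k + 1"
        using P(4,5) sk(3) unfolding dq dr by (simp_all only: deg1)
      then show ?thesis using \<open>s = 2\<close> by linarith
    qed
    then show ?thesis
      unfolding hankel_det_eq_0_iff[OF sk(2,1)] using qr sk(3) by metis
  qed
qed

end

section \<open>Two-periodic trajectories\<close>

lemma reflect_zero_component: "q $ i = 0 \<Longrightarrow> u $ i = 0 \<Longrightarrow> reflect a q u $ i = 0"
  by (simp add: reflect_def Let_def)

lemma geodesic_zero_component: "p $ i = 0 \<Longrightarrow> v $ i = 0 \<Longrightarrow> geodesic p v t $ i = 0"
  by (simp add: geodesic_def Let_def)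

lemma cross_eq_0_imp_parallel:
  assumes "cross x y = 0" "x \<noteq> 0"
  shows "\<exists>r. y = r *\<^sub>R x"
proof -
  have "\<forall>i j. x $ i * y $ j = x $ j * y $ i"
    using assms(1) unfolding all_3 by (simp add: vec3_eq_iff)
  moreover obtain i where "x $ i \<noteq> 0" using assms(2) by (auto simp: Finite_Cartesian_Product.vec_eq_iff)
  ultimately have "y = (y $ i / x $ i) *\<^sub>R x"
    by (simp add: Finite_Cartesian_Product.vec_eq_iff field_simps)
  then show ?thesis ..
qed

context billiard
begin

text \<open>
Two consecutive boundary points are never orthogonal for the form of the cone; the sign says
on which side of the cone the segment between them runs.
\<close>

lemma chord_sign: "\<sigma> * lorentz (p (Suc k)) (diag_inv a (p k)) > 0"
proof -
  obtain c s where q: "p (Suc k) = c *\<^sub>R p k + s *\<^sub>R v k" "s > 0" "\<sigma> * lorentz (v k) (diag_inv a (p k)) > 0"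
    by (rule step[of k])
  have "lorentz (p k) (diag_inv a (p k)) = 0" using state[of k] by (simp add: boundary_state_def)
  then have e: "\<sigma> * lorentz (p (Suc k)) (diag_inv a (p k)) = s * (\<sigma> * lorentz (v k) (diag_inv a (p k)))"
    unfolding q(1) lorentz_lincomb_left by simp
  show ?thesis unfolding e using q(2,3) by (rule mult_pos_pos)
qed

lemma reflections_ge: "reflections a p N \<ge> N"
  by (induction N) (auto simp: reflections_Suc bounces_def)

text \<open>
The segment is run through forwards and backwards, so the velocity is normal to the boundary
at both ends. The linear form \<open>E\<close> of its plane then vanishes at \<open>p\<^sub>0, p\<^sub>1\<close> and at the normals
\<open>A\<^sup>-\<^sup>1p\<^sub>0, A\<^sup>-\<^sup>1p\<^sub>1\<close>, that is, its coefficients form an eigenvector of \<open>A\<^sup>-\<^sup>1\<close>.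
\<close>

lemma two_periodic_in_symmetry_plane:
  assumes "periodic a p v 2"
  shows "in_symmetry_plane p v"
proof -
  obtain N where N: "reflections a p N = 2" "p N = p 0" "v N = v 0"
    using assms by (auto simp: periodic_def)
  have "N \<noteq> 0"
  proof
    assume "N = 0"
    then show False using N(1) by (simp add: reflections_def)
  qed
  moreover have "N \<noteq> 1"
  proof
    assume "N = 1"
    then have "\<sigma> * lorentz (p 0) (diag_inv a (p 0)) > 0" using chord_sign[of 0] N(2) by simp
    then show False using state[of 0] by (simp add: boundary_state_def)
  qed
  moreover have "N \<le> 2" using reflections_ge[of N] N(1) by simp
  ultimately have N2: "N = Suc (Suc 0)" by linarith
  have "bounces a (p (Suc 0)) + bounces a (p (Suc (Suc 0))) = 2"
    using N(1) unfolding N2 reflections_Suc by (simp add: reflections_def)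
  moreover have ge: "bounces a x \<ge> 1" and nl': "bounces a x = 1 \<Longrightarrow> \<not> lightlike_tangent a x" for x
    by (cases "lightlike_tangent a x"; simp add: bounces_def)+
  ultimately have "bounces a (p (Suc 0)) = 1" "bounces a (p (Suc (Suc 0))) = 1"
    using ge[of "p (Suc 0)"] ge[of "p (Suc (Suc 0))"] by linarith+
  then have nl: "\<not> lightlike_tangent a (p (Suc 0))" "\<not> lightlike_tangent a (p (Suc (Suc 0)))"
    using nl' by blast+
  note p2 = N(2)[unfolded N2] and v2 = N(3)[unfolded N2]
  define w where "w = cross (p 0) (p (Suc 0))"
  \<comment> \<open>The linear form whose zero set is the plane of the segment.\<close>
  define E where "E x = w $ 0 * x $ 0 + w $ 1 * x $ 1 + w $ 2 * x $ 2" for x :: "real^3"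
  have lin: "E (c *\<^sub>R x + d *\<^sub>R y) = c * E x + d * E y" "E (x - d *\<^sub>R y) = E x - d * E y" for c d x y
    by (simp_all add: E_def algebra_simps)
  have E0: "E (p 0) = 0" "E (p (Suc 0)) = 0"
    by (simp_all add: E_def w_def algebra_simps)
  have flat: "E (v k) = 0 \<and> E (v (Suc k)) = 0 \<longrightarrow> E (diag_inv a (p (Suc k))) = 0" "E (v k) = 0"
    if E: "E (p k) = 0" "E (p (Suc k)) = 0" and nl: "\<not> lightlike_tangent a (p (Suc k))" for k
  proof -
    obtain c s c' s' u where q: "p (Suc k) = c *\<^sub>R p k + s *\<^sub>R v k" "u = c' *\<^sub>R p k + s' *\<^sub>R v k"
      "s > 0" "v (Suc k) = reflect a (p (Suc k)) u"
      "lorentz u (diag_inv a (p (Suc k))) = - lorentz (v k) (diag_inv a (p k))"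
      by (rule step[of k])
    show Ev: "E (v k) = 0" using E q(3) unfolding q(1) lin(1) by simp
    have Eu: "E u = 0" unfolding q(2) lin(1) using E Ev by simp
    let ?n = "diag_inv a (p (Suc k))"
    define m where "m = 2 * lorentz u ?n / lorentz ?n ?n"
    have b: "lorentz (p (Suc k)) (p (Suc k)) = 1" "lorentz (p (Suc k)) ?n = 0" "lorentz (v k) (diag_inv a (p k)) \<noteq> 0"
      using state[of "Suc k"] state[of k] by (simp_all add: boundary_state_def)
    have "m \<noteq> 0" using nl lightlike_tangent_iff[OF b(1,2) nonzero] q(5) b(3) by (simp add: m_def)
    moreover have "v (Suc k) = u - m *\<^sub>R ?n" using q(4) nl by (simp add: reflect_def Let_def m_def)
    ultimately show "E (v k) = 0 \<and> E (v (Suc k)) = 0 \<longrightarrow> E ?n = 0" using Eu lin(2)[of u m ?n] by simp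
  qed
  have Ev0: "E (v 0) = 0" using flat(2)[of 0] E0 nl by simp
  have Ev1: "E (v (Suc 0)) = 0" using flat(2)[of "Suc 0"] E0 nl p2 by simp
  have n1: "E (diag_inv a (p (Suc 0))) = 0" using flat(1)[of 0] E0 nl Ev0 Ev1 by simp
  have n0: "E (diag_inv a (p 0)) = 0" using flat(1)[of "Suc 0"] E0 nl Ev0 Ev1 p2 v2 by simp
  have p0: "p 0 \<noteq> 0" using state[of 0] by (auto simp: boundary_state_def lorentz_def)
  have w0: "w \<noteq> 0"
  proof
    assume "w = 0"
    then obtain r where "p (Suc 0) = r *\<^sub>R p 0"
      using cross_eq_0_imp_parallel p0 unfolding w_def by blast
    then have "lorentz (p (Suc 0)) (diag_inv a (p 0)) = r * lorentz (p 0) (diag_inv a (p 0))"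
      by (simp add: lorentz_def algebra_simps)
    then show False using chord_sign[of 0] state[of 0] by (simp add: boundary_state_def)
  qed
  \<comment> \<open>The coefficients of \<open>E\<close> composed with \<open>A\<^sup>-\<^sup>1\<close>; they are proportional to \<open>w\<close>.\<close>
  define y :: "real^3" where "y = (\<chi> i. w $ i / a $ i)"
  have "y \<noteq> 0" using w0 nonzero by (auto simp: y_def Finite_Cartesian_Product.vec_eq_iff)
  moreover have "y $ 0 * x $ 0 + y $ 1 * x $ 1 + y $ 2 * x $ 2 = E (diag_inv a x)" for x
    by (simp add: y_def E_def)
  ultimately obtain r where "w = r *\<^sub>R y"
    using parallel_to_cross[of y "p 0" "p (Suc 0)"] n0 n1 unfolding w_def by auto
  then have wr: "w $ i = 0 \<or> a $ i = r" for i
  proof -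
    have "w $ i = r * (w $ i / a $ i)" using \<open>w = r *\<^sub>R y\<close> by (metis y_def vec_lambda_beta vector_scaleR_component real_scaleR_def)
    then show ?thesis using nonzero by (auto simp: field_simps)
  qed
  obtain i where i: "p 0 $ i = 0" "p (Suc 0) $ i = 0"
  proof -
    have "w $ 0 \<noteq> 0 \<or> w $ 1 \<noteq> 0 \<or> w $ 2 \<noteq> 0" using w0 by (simp add: vec3_eq_iff)
    then have "(w $ 0 \<noteq> 0 \<and> w $ 1 = 0 \<and> w $ 2 = 0) \<or> (w $ 0 = 0 \<and> w $ 1 \<noteq> 0 \<and> w $ 2 = 0) \<or> (w $ 0 = 0 \<and> w $ 1 = 0 \<and> w $ 2 \<noteq> 0)"
      using wr[of 0] wr[of 1] wr[of 2] distinct by auto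
    then show thesis using E0 that[of 0] that[of 1] that[of 2] unfolding E_def by auto
  qed
  have "p k $ i = 0 \<and> v k $ i = 0" for k
  proof (induction k)
    case 0
    obtain c s where q: "p (Suc 0) = c *\<^sub>R p 0 + s *\<^sub>R v 0" "s > 0" by (rule step[of 0])
    have "s * v 0 $ i = 0" using i q(1) by (simp add: Finite_Cartesian_Product.vec_eq_iff)
    then show ?case using i q(2) by simp
  next
    case (Suc k)
    obtain c s c' s' u where q: "p (Suc k) = c *\<^sub>R p k + s *\<^sub>R v k" "u = c' *\<^sub>R p k + s' *\<^sub>R v k"
      "v (Suc k) = reflect a (p (Suc k)) u"
      by (rule step[of k])
    have "p (Suc k) $ i = 0" "u $ i = 0" using Suc unfolding q(1,2) by simp_all
    then show ?case using q(3) reflect_zero_component by simp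
  qed
  then show ?thesis unfolding in_symmetry_plane_def using geodesic_zero_component by blast
qed

end

section \<open>Closing up to sign and Hankel determinants\<close>

definition closes_up_to_sign :: "real^3 \<Rightarrow> (nat \<Rightarrow> real^3) \<Rightarrow> (nat \<Rightarrow> real^3) \<Rightarrow> nat \<Rightarrow> bool" where
  "closes_up_to_sign a p v n \<longleftrightarrow>
     (\<exists>N \<tau>. reflections a p N = n \<and> \<tau>\<^sup>2 = 1 \<and> p N = \<tau> *\<^sub>R p 0 \<and> v N = \<tau> *\<^sub>R v 0)"

context billiard_caustic
begin

lemma closes_iff_even:
  assumes m: "m \<ge> 2"
    and B: "(\<lambda>X. sqrt (\<epsilon> * (X - a $ 0) * (X - a $ 1) * (X - a $ 2) * (X - \<nu>))) has_fps_expansion B"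
  shows "closes_up_to_sign a p v (2 * m) \<longleftrightarrow> hankel_det (fps_nth B) 3 (m - 1) = 0"
proof -
  let ?g = "\<lambda>X. \<epsilon> * (X - a $ 0) * (X - a $ 1) * (X - a $ 2) * (X - \<nu>)"
  have g0: "?g 0 > 0" using \<epsilon>(2) by (simp add: mult_ac)
  have cont: "isCont ?g 0" by (intro continuous_intros)
  have T: "poly (smult \<epsilon> (R * L)) t = ?g t" for t unfolding poly_smult poly_RL by (simp add: mult_ac)
  have F: "fps_of_poly 1 * B\<^sup>2 = fps_of_poly (smult \<epsilon> (R * L))" "fps_nth B 0 > 0"
    using sqrt_expansion[OF B, of 1 "smult \<epsilon> (R * L)"] cont g0 unfolding T by simp_all
  have deg: "degree (smult \<epsilon> (R * L)) \<le> 4"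
    by (intro order_trans[OF degree_smult_le]) (simp add: degree_mult_eq del: mult_pCons_left mult_pCons_right)
  have Ta: "poly (smult \<epsilon> (R * L)) (a $ i) = 0" for i
  proof -
    have "\<forall>i. ?g (a $ i) = 0" unfolding all_3 by simp
    then show ?thesis unfolding T by blast
  qed
  show ?thesis
  proof
    assume "closes_up_to_sign a p v (2 * m)"
    then obtain N \<tau> where N: "reflections a p N = 2 * m" "\<tau>\<^sup>2 = 1" "p N = \<tau> *\<^sub>R p 0" "v N = \<tau> *\<^sub>R v 0"
      unfolding closes_up_to_sign_def by blast
    show "hankel_det (fps_nth B) 3 (m - 1) = 0"
      by (rule closed_imp_hankel_zero[OF N _ F(1)]) (use m in auto)
  next
    assume h: "hankel_det (fps_nth B) 3 (m - 1) = 0"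
    have "2 * m = 3 + 2 * (m - 1) - 1" using m by simp
    have F0: "fps_nth B 0 \<noteq> 0" using F(2) by simp
    show "closes_up_to_sign a p v (2 * m)"
      by (rule hankel_zero_imp_closed[OF _ F(1) F0 Ta, of 3 "m - 1" "2 * m"])
        (use m h deg in \<open>auto simp: closes_up_to_sign_def\<close>)
  qed
qed

lemma closes_iff_odd:
  assumes m: "m \<ge> 1"
    and D: "(\<lambda>X. sqrt (\<epsilon> * (X - a $ 0) * (X - a $ 1) * (X - a $ 2) / (X - \<nu>))) has_fps_expansion D"
  shows "closes_up_to_sign a p v (2 * m + 1) \<longleftrightarrow> hankel_det (fps_nth D) 2 m = 0"
proof -
  let ?g = "\<lambda>X. \<epsilon> * (X - a $ 0) * (X - a $ 1) * (X - a $ 2) / (X - \<nu>)"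
  have \<nu>0: "\<nu> \<noteq> 0" using \<nu> by simp
  have "?g 0 = \<epsilon> * (a $ 0 * a $ 1 * a $ 2 * \<nu>) / \<nu>\<^sup>2" using \<nu>0 by (simp add: power2_eq_square)
  then have g0: "?g 0 > 0" using \<epsilon>(2) \<nu>0 by (simp del: times_divide_eq_right)
  have cont: "isCont ?g 0" using \<nu>0 by (intro continuous_intros) simp
  have R: "poly (smult \<epsilon> R) t = \<epsilon> * (t - a $ 0) * (t - a $ 1) * (t - a $ 2)" for t
    unfolding poly_smult poly_mult by simp
  have "eventually (\<lambda>X. X \<noteq> \<nu>) (nhds 0)" using \<nu>0 by (intro t1_space_nhds) simp
  then have "eventually (\<lambda>X. poly L X * ?g X = poly (smult \<epsilon> R) X) (nhds 0)"
    unfolding R by eventually_elim simp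
  from sqrt_expansion[OF D this cont g0]
  have F: "fps_of_poly L * D\<^sup>2 = fps_of_poly (smult \<epsilon> R)" "fps_nth D 0 > 0" by simp_all
  have deg: "degree (smult \<epsilon> R) \<le> 3"
    by (intro order_trans[OF degree_smult_le]) (simp add: degree_mult_eq del: mult_pCons_left mult_pCons_right)
  have Ta: "poly (smult \<epsilon> R) (a $ i) = 0" for i
  proof -
    have "\<forall>i. \<epsilon> * (a $ i - a $ 0) * (a $ i - a $ 1) * (a $ i - a $ 2) = 0" unfolding all_3 by simp
    then show ?thesis unfolding R by blast
  qed
  have ST: "L * smult \<epsilon> R = smult \<epsilon> (R * L)" by (simp only: mult_smult_right mult.commute)
  show ?thesis
  proof
    assume "closes_up_to_sign a p v (2 * m + 1)"
    then obtain N \<tau> where N: "reflections a p N = 2 * m + 1" "\<tau>\<^sup>2 = 1" "p N = \<tau> *\<^sub>R p 0" "v N = \<tau> *\<^sub>R v 0"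
      unfolding closes_up_to_sign_def by blast
    show "hankel_det (fps_nth D) 2 m = 0"
      by (rule closed_imp_hankel_zero[OF N _ F(1)]) (use m in auto)
  next
    assume h: "hankel_det (fps_nth D) 2 m = 0"
    have F0: "fps_nth D 0 \<noteq> 0" using F(2) by simp
    show "closes_up_to_sign a p v (2 * m + 1)"
      by (rule hankel_zero_imp_closed[OF ST F(1) F0 Ta, of 2 m "2 * m + 1"])
        (use m h deg in \<open>auto simp: closes_up_to_sign_def\<close>)
  qed
qed

end

section \<open>Antipodal points and projection\<close>

text \<open>
The Cauchy-Schwarz inequality in the coordinates \<open>x\<^sub>1, x\<^sub>2\<close>: the cone is convex on either side
of \<open>x\<^sub>0 = 0\<close>.
\<close>

lemma cone_points_sign:
  assumes a: "0 < a $ 0" "0 < a $ 1" "0 < a $ 2"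
    and x: "lorentz x (diag_inv a x) = 0" and y: "lorentz y (diag_inv a y) = 0"
  shows "x $ 0 * y $ 0 > 0 \<Longrightarrow> lorentz x (diag_inv a y) \<le> 0"
    "x $ 0 * y $ 0 < 0 \<Longrightarrow> lorentz x (diag_inv a y) \<ge> 0"
proof -
  define b where "b i = 1 / a $ i" for i
  have b: "b 0 > 0" "b 1 > 0" "b 2 > 0" using a by (simp_all add: b_def)
  have lor: "lorentz z (diag_inv a w) = - (b 0 * z $ 0 * w $ 0) + (b 1 * z $ 1 * w $ 1 + b 2 * z $ 2 * w $ 2)" for z w
    by (simp add: lorentz_def b_def)
  define Y where "Y = b 1 * x $ 1 * y $ 1 + b 2 * x $ 2 * y $ 2"
  have "Y\<^sup>2 + b 1 * b 2 * (x $ 1 * y $ 2 - x $ 2 * y $ 1)\<^sup>2 =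
      (b 1 * x $ 1 * x $ 1 + b 2 * x $ 2 * x $ 2) * (b 1 * y $ 1 * y $ 1 + b 2 * y $ 2 * y $ 2)"
    by (simp add: Y_def power2_eq_square algebra_simps)
  also have "\<dots> = (b 0 * x $ 0 * x $ 0) * (b 0 * y $ 0 * y $ 0)"
    using x y unfolding lor by simp
  also have "\<dots> = (b 0 * (x $ 0 * y $ 0))\<^sup>2" by (simp add: power2_eq_square)
  finally have "Y\<^sup>2 + b 1 * b 2 * (x $ 1 * y $ 2 - x $ 2 * y $ 1)\<^sup>2 = (b 0 * (x $ 0 * y $ 0))\<^sup>2" .
  moreover have "b 1 * b 2 * (x $ 1 * y $ 2 - x $ 2 * y $ 1)\<^sup>2 \<ge> 0" using b by simp
  ultimately have "Y\<^sup>2 \<le> (b 0 * (x $ 0 * y $ 0))\<^sup>2" by linarith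
  then have "\<bar>Y\<bar> \<le> b 0 * \<bar>x $ 0 * y $ 0\<bar>"
    using b(1) by (metis abs_le_square_iff abs_mult abs_of_pos)
  moreover have "lorentz x (diag_inv a y) = - (b 0 * (x $ 0 * y $ 0)) + Y"
    unfolding lor Y_def by simp
  ultimately show "x $ 0 * y $ 0 > 0 \<Longrightarrow> lorentz x (diag_inv a y) \<le> 0"
    "x $ 0 * y $ 0 < 0 \<Longrightarrow> lorentz x (diag_inv a y) \<ge> 0"
    by (simp_all add: abs_if split: if_splits)
qed

lemma cone_point_nonzero:
  assumes a: "0 < a $ 0" "0 < a $ 1" "0 < a $ 2"
    and x: "lorentz x (diag_inv a x) = 0" "lorentz x x = 1"
  shows "x $ 0 \<noteq> 0"
proof
  assume "x $ 0 = 0"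
  then have "(x $ 1)\<^sup>2 / a $ 1 + (x $ 2)\<^sup>2 / a $ 2 = 0" using x(1) by (simp add: lorentz_def power2_eq_square)
  then have "x $ 1 = 0" "x $ 2 = 0" using a by (simp_all add: add_nonneg_eq_0_iff)
  then show False using x(2) \<open>x $ 0 = 0\<close> by (simp add: lorentz_def)
qed

text \<open>
The point lies on the cone, which gives \<open>x\<^sub>0\<^sup>2\<close> for \<open>x = A\<^sup>-\<^sup>1p\<close> in terms of the other coordinates;
then \<open>a\<^sub>0 < a\<^sub>1 < a\<^sub>2\<close> makes the norm of the normal negative.
\<close>

lemma collared_not_lightlike:
  assumes "collared a" and p: "lorentz p p = 1" "lorentz p (diag_inv a p) = 0"
  shows "\<not> lightlike_tangent a p"
proof -
  have a: "0 < a $ 0" "a $ 0 < a $ 1" "a $ 1 < a $ 2" using assms(1) by (auto simp: collared_def)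
  have p0: "p $ 0 \<noteq> 0" by (rule cone_point_nonzero[OF _ _ _ p(2,1)]) (use a in auto)
  define x where "x i = p $ i / a $ i" for i
  have n: "lorentz (diag_inv a p) (diag_inv a p) = - (x 0)\<^sup>2 + (x 1)\<^sup>2 + (x 2)\<^sup>2"
    by (simp add: lorentz_def x_def power2_eq_square)
  have "- a $ 0 * (x 0)\<^sup>2 + a $ 1 * (x 1)\<^sup>2 + a $ 2 * (x 2)\<^sup>2 = 0"
    using p(2) a by (simp add: lorentz_def x_def power2_eq_square)
  then have "a $ 0 * (- (x 0)\<^sup>2 + (x 1)\<^sup>2 + (x 2)\<^sup>2) = - ((a $ 1 - a $ 0) * (x 1)\<^sup>2 + (a $ 2 - a $ 0) * (x 2)\<^sup>2)"
    by (simp add: algebra_simps)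
  moreover have "(a $ 1 - a $ 0) * (x 1)\<^sup>2 + (a $ 2 - a $ 0) * (x 2)\<^sup>2 > 0"
  proof (rule ccontr)
    assume "\<not> ?thesis"
    moreover have "(a $ 1 - a $ 0) * (x 1)\<^sup>2 \<ge> 0" "(a $ 2 - a $ 0) * (x 2)\<^sup>2 \<ge> 0" using a by simp_all
    ultimately have "(a $ 1 - a $ 0) * (x 1)\<^sup>2 = 0" "(a $ 2 - a $ 0) * (x 2)\<^sup>2 = 0" by linarith+
    then have "x 1 = 0" "x 2 = 0" using a by auto
    then have "x 0 = 0" using \<open>- a $ 0 * (x 0)\<^sup>2 + a $ 1 * (x 1)\<^sup>2 + a $ 2 * (x 2)\<^sup>2 = 0\<close> a by simp
    then show False using p0 a by (simp add: x_def)
  qed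
  ultimately have "a $ 0 * lorentz (diag_inv a p) (diag_inv a p) < 0" unfolding n by linarith
  then have "lorentz (diag_inv a p) (diag_inv a p) \<noteq> 0" by auto
  moreover have "\<forall>i. a $ i \<noteq> 0" unfolding all_3 using a by auto
  ultimately show ?thesis using lightlike_tangent_iff[OF p] by blast
qed

lemma proj_scale:
  assumes "\<tau>\<^sup>2 = 1"
  shows "proj (\<tau> *\<^sub>R p) = proj p" "proj_velocity (\<tau> *\<^sub>R p) (\<tau> *\<^sub>R v) = proj_velocity p v"
proof -
  have \<tau>: "\<tau> = 1 \<or> \<tau> = -1" using assms by (simp add: power2_eq_1_iff)
  show pr: "proj (\<tau> *\<^sub>R p) = proj p" for p using \<tau> by (auto simp: proj_def)
  have "lorentz (\<tau> *\<^sub>R v) (\<tau> *\<^sub>R v) = lorentz v v" using \<tau> by (auto simp: lorentz_def)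
  then have "geodesic (\<tau> *\<^sub>R p) (\<tau> *\<^sub>R v) t = \<tau> *\<^sub>R geodesic p v t" for t
    by (simp add: geodesic_def Let_def algebra_simps)
  then show "proj_velocity (\<tau> *\<^sub>R p) (\<tau> *\<^sub>R v) = proj_velocity p v"
    unfolding proj_velocity_def by (simp only: pr)
qed

lemma proj_velocity_eq:
  assumes "p $ 0 \<noteq> 0"
  shows "proj_velocity p v = ((v $ 1 * p $ 0 - p $ 1 * v $ 0) / (p $ 0)\<^sup>2, (v $ 2 * p $ 0 - p $ 2 * v $ 0) / (p $ 0)\<^sup>2)"
proof -
  have d: "((\<lambda>t. geodesic p v t $ i) has_real_derivative v $ i) (at 0)" for i
  proof -
    have "(geodesic p v has_vector_derivative v) (at 0)"
      using geodesic_has_vector_derivative[of p v 0] by (metis velocity_0 velocity_eq)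
    from bounded_linear.has_vector_derivative[OF bounded_linear_vec_nth this] show ?thesis
      by (simp add: has_real_derivative_iff_has_vector_derivative)
  qed
  have q: "((\<lambda>t. geodesic p v t $ i / geodesic p v t $ 0) has_vector_derivative
      (v $ i * p $ 0 - p $ i * v $ 0) / (p $ 0)\<^sup>2) (at 0)" for i
    using DERIV_divide[OF d[of i] d[of 0]] assms
    by (simp add: has_real_derivative_iff_has_vector_derivative power2_eq_square)
  show ?thesis
    unfolding proj_velocity_def proj_def
    by (rule vector_derivative_at) (intro has_vector_derivative_Pair q)
qed

text \<open>
Equal projections mean proportional points, and by \<open>proj_velocity_eq\<close> equal projected
velocities mean that \<open>\<tau> v' - v\<close> is a multiple of \<open>p\<close>; it is also orthogonal to \<open>p\<close>.
\<close>

lemma proj_eq_imp: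
  assumes p: "lorentz p p = 1" "lorentz p v = 0" "p $ 0 \<noteq> 0"
    and p': "lorentz p' p' = 1" "lorentz p' v' = 0" "p' $ 0 \<noteq> 0"
    and eq: "proj p' = proj p" "proj_velocity p' v' = proj_velocity p v"
  shows "\<exists>\<tau>. \<tau>\<^sup>2 = 1 \<and> p' = \<tau> *\<^sub>R p \<and> v' = \<tau> *\<^sub>R v"
proof -
  define \<tau> where "\<tau> = p' $ 0 / p $ 0"
  have pt: "p' = \<tau> *\<^sub>R p"
    using eq(1) p(3) p'(3) by (simp add: vec3_eq_iff proj_def \<tau>_def field_simps)
  have "lorentz p' p' = \<tau>\<^sup>2 * lorentz p p"
    unfolding pt by (simp add: lorentz_def power2_eq_square algebra_simps)
  then have \<tau>2: "\<tau>\<^sup>2 = 1" using p p' by simp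
  define w where "w = \<tau> *\<^sub>R v' - v"
  have "(p' $ 0)\<^sup>2 = (p $ 0)\<^sup>2" unfolding pt using \<tau>2 by (simp add: power_mult_distrib)
  then have "v' $ 1 * p' $ 0 - p' $ 1 * v' $ 0 = v $ 1 * p $ 0 - p $ 1 * v $ 0"
    "v' $ 2 * p' $ 0 - p' $ 2 * v' $ 0 = v $ 2 * p $ 0 - p $ 2 * v $ 0"
    using eq(2) p(3) unfolding proj_velocity_eq[OF p(3)] proj_velocity_eq[OF p'(3)] by simp_all
  then have "w $ 1 * p $ 0 = p $ 1 * w $ 0" "w $ 2 * p $ 0 = p $ 2 * w $ 0"
    by (simp_all add: w_def pt algebra_simps)
  then have w: "w = (w $ 0 / p $ 0) *\<^sub>R p"
    using p(3) by (simp add: vec3_eq_iff field_simps)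
  have "lorentz p w = \<tau> * lorentz p v' - lorentz p v" by (simp add: w_def lorentz_def algebra_simps)
  also have "\<tau> * lorentz p v' = lorentz p' v'" by (simp add: pt lorentz_def algebra_simps)
  finally have "lorentz p w = 0" using p p' by simp
  moreover have "lorentz p (k *\<^sub>R p) = k * lorentz p p" for k by (simp add: lorentz_def algebra_simps)
  ultimately have "w $ 0 / p $ 0 = 0" using p(1) w by (metis mult.right_neutral)
  then have "w = 0" using w by (metis scaleR_zero_left)
  then have "\<tau> *\<^sub>R v' = v" by (simp add: w_def)
  then have "v' = \<tau> *\<^sub>R v" using \<tau>2 by (metis power2_eq_square scaleR_one scaleR_scaleR)
  with pt \<tau>2 show ?thesis by blast
qed

lemma table_parameters_distinct:
  assumes "collared a \<or> transverse a"
  shows "\<forall>i. a $ i \<noteq> 0" "a $ 0 \<noteq> a $ 1" "a $ 0 \<noteq> a $ 2" "a $ 1 \<noteq> a $ 2"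
  using assms unfolding all_3 collared_def transverse_def by auto

lemma billiard_collar: "collared_trajectory a p v \<Longrightarrow> billiard a (collar a) p v 1"
  unfolding billiard_def collared_trajectory_def using table_parameters_distinct[of a]
  by (auto simp: collar_def)

lemma billiard_exterior: "exterior_trajectory a p v \<Longrightarrow> billiard a (collar_exterior a) p v (-1)"
  unfolding billiard_def exterior_trajectory_def using table_parameters_distinct[of a]
  by (auto simp: collar_exterior_def)

lemma billiard_transverse: "transverse_trajectory a p v \<Longrightarrow> billiard a (transverse_domain a) p v 1"
  unfolding billiard_def transverse_trajectory_def using table_parameters_distinct[of a]
  by (auto simp: transverse_domain_def)

context billiard
begin

lemma point: "lorentz (p k) (p k) = 1" "lorentz (p k) (diag_inv a (p k)) = 0" "lorentz (p k) (v k) = 0"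
  using state[of k] by (simp_all add: boundary_state_def)

lemma periodic_iff_closes:
  assumes "\<And>N \<tau>. reflections a p N = n \<Longrightarrow> \<tau>\<^sup>2 = 1 \<Longrightarrow> p N = \<tau> *\<^sub>R p 0 \<Longrightarrow> \<tau> = 1"
  shows "periodic a p v n \<longleftrightarrow> closes_up_to_sign a p v n"
proof
  assume "periodic a p v n"
  then obtain N where N: "reflections a p N = n" "p N = p 0" "v N = v 0"
    by (auto simp: periodic_def)
  then show "closes_up_to_sign a p v n"
    unfolding closes_up_to_sign_def by (intro exI[of _ N] exI[of _ 1]) simp
next
  assume "closes_up_to_sign a p v n"
  then obtain N \<tau> where N: "reflections a p N = n" "\<tau>\<^sup>2 = 1" "p N = \<tau> *\<^sub>R p 0" "v N = \<tau> *\<^sub>R v 0"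
    unfolding closes_up_to_sign_def by blast
  have "\<tau> = 1" using assms N by blast
  then show "periodic a p v n" using N by (auto simp: periodic_def)
qed

lemma proj_periodic_iff_closes:
  assumes "\<And>k. p k $ 0 \<noteq> 0"
  shows "proj_periodic a p v n \<longleftrightarrow> closes_up_to_sign a p v n"
proof
  assume "proj_periodic a p v n"
  then obtain N where N: "reflections a p N = n" "proj (p N) = proj (p 0)"
    "proj_velocity (p N) (v N) = proj_velocity (p 0) (v 0)"
    by (auto simp: proj_periodic_def)
  have "\<exists>\<tau>. \<tau>\<^sup>2 = 1 \<and> p N = \<tau> *\<^sub>R p 0 \<and> v N = \<tau> *\<^sub>R v 0"
    by (rule proj_eq_imp) (use point assms N in auto)
  then show "closes_up_to_sign a p v n" unfolding closes_up_to_sign_def using N(1) by blast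
next
  assume "closes_up_to_sign a p v n"
  then obtain N \<tau> where N: "reflections a p N = n" "\<tau>\<^sup>2 = 1" "p N = \<tau> *\<^sub>R p 0" "v N = \<tau> *\<^sub>R v 0"
    unfolding closes_up_to_sign_def by blast
  show "proj_periodic a p v n"
    unfolding proj_periodic_def using N(1) proj_scale[OF N(2)] N(3,4) by auto
qed

text \<open>
A segment inside the collar joins the two boundary curves, and a segment outside of it
returns to the same curve.
\<close>

lemma first_coordinate_step:
  assumes a: "0 < a $ 0" "0 < a $ 1" "0 < a $ 2"
  shows "p k $ 0 \<noteq> 0" "\<sigma> * (p (Suc k) $ 0 * p k $ 0) < 0"
proof -
  show nz: "p k $ 0 \<noteq> 0" for k by (rule cone_point_nonzero[OF a point(2,1)])
  note s = cone_points_sign[OF a point(2) point(2), of "Suc k" k]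
  have "p (Suc k) $ 0 * p k $ 0 \<noteq> 0" using nz by simp
  then consider "p (Suc k) $ 0 * p k $ 0 > 0" | "p (Suc k) $ 0 * p k $ 0 < 0" by linarith
  then show "\<sigma> * (p (Suc k) $ 0 * p k $ 0) < 0"
  proof cases
    case 1
    then have "\<sigma> < 0" using s(1) chord_sign[of k] by (auto simp: zero_less_mult_iff)
    then show ?thesis using 1 by (simp add: mult_neg_pos)
  next
    case 2
    then have "\<sigma> > 0" using s(2) chord_sign[of k] by (auto simp: zero_less_mult_iff)
    then show ?thesis using 2 by (simp add: mult_pos_neg)
  qed
qed

lemma first_coordinate_sign:
  assumes a: "0 < a $ 0" "0 < a $ 1" "0 < a $ 2"
  shows "(- \<sigma>) ^ N * (p N $ 0 * p 0 $ 0) > 0"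
proof (induction N)
  case 0
  have "p 0 $ 0 * p 0 $ 0 > 0" using first_coordinate_step(1)[OF a, of 0] by (simp add: zero_less_mult_iff) linarith
  then show ?case by simp
next
  case (Suc N)
  have "0 < - (\<sigma> * (p (Suc N) $ 0 * p N $ 0))" using first_coordinate_step(2)[OF a, of N] by simp
  from mult_pos_pos[OF this Suc]
  have "0 < ((- \<sigma>) ^ Suc N * (p (Suc N) $ 0 * p 0 $ 0)) * (p N $ 0)\<^sup>2"
    by (simp add: power2_eq_square mult_ac)
  then show ?case by (rule zero_less_mult_pos2) (use first_coordinate_step(1)[OF a, of N] in simp)
qed

end

section \<open>The closing criterion\<close>

lemma billiard_caustic_intro:
  assumes "billiard a M p v \<sigma>" and a: "collared a \<or> transverse a"
    and \<nu>: "\<nu> \<notin> {0, a $ 0, a $ 1, a $ 2}" and "has_caustic a \<nu> p v" and \<epsilon>: "\<epsilon> = sgn (a $ 1 * \<nu>)"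
  shows "billiard_caustic a M p v \<sigma> \<nu> \<epsilon>"
proof -
  have nz: "a $ 1 * \<nu> \<noteq> 0" using a \<nu> by (auto simp: collared_def transverse_def)
  have "a $ 0 * a $ 2 > 0" using a by (auto simp: collared_def transverse_def)
  moreover have "\<epsilon> * (a $ 1 * \<nu>) > 0" using nz unfolding \<epsilon> by (metis abs_sgn mult.commute zero_less_abs_iff)
  ultimately have "(a $ 0 * a $ 2) * (\<epsilon> * (a $ 1 * \<nu>)) > 0" by (rule mult_pos_pos)
  then have "\<epsilon> * (a $ 0 * a $ 1 * a $ 2 * \<nu>) > 0" by (simp only: mult_ac)
  moreover have "\<epsilon>\<^sup>2 = 1" using nz unfolding \<epsilon> by (auto simp: sgn_if)
  ultimately show ?thesis
    using assms(1,4) \<nu> by (intro billiard_caustic.intro) (auto simp: billiard_caustic_axioms_def)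
qed

lemma pos_unit: "(\<tau> :: real)\<^sup>2 = 1 \<Longrightarrow> \<tau> > 0 \<Longrightarrow> \<tau> = 1"
  by (auto simp: power2_eq_1_iff)

lemma exterior_closing_sign:
  assumes ext: "exterior_trajectory a p v" and \<tau>: "\<tau>\<^sup>2 = 1" "p N = \<tau> *\<^sub>R p 0"
  shows "\<tau> = 1"
proof -
  interpret billiard a "collar_exterior a" p v "-1" by (rule billiard_exterior[OF ext])
  have a: "0 < a $ 0" "0 < a $ 1" "0 < a $ 2" using ext by (auto simp: exterior_trajectory_def collared_def)
  have "\<tau> * (p 0 $ 0)\<^sup>2 > 0"
    using first_coordinate_sign[OF a, of N] by (simp add: \<tau>(2) power2_eq_square mult_ac)
  then have "\<tau> > 0" by (rule zero_less_mult_pos2) (use first_coordinate_step(1)[OF a] in simp)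
  then show ?thesis using pos_unit \<tau>(1) by blast
qed

lemma transverse_closing_sign:
  assumes tr: "transverse_trajectory a p v" and \<tau>: "\<tau>\<^sup>2 = 1" "p N = \<tau> *\<^sub>R p 0"
  shows "\<tau> = 1"
proof -
  have "p k $ 2 > 0" for k
    using tr unfolding transverse_trajectory_def billiard_trajectory_def table_boundary_def transverse_domain_def by blast
  from this[of N] this[of 0] have "\<tau> > 0" by (simp add: \<tau>(2) zero_less_mult_iff)
  then show ?thesis using pos_unit \<tau>(1) by blast
qed

lemma collared_reflections:
  assumes "collared_trajectory a p v"
  shows "reflections a p N = N"
proof -
  interpret billiard a "collar a" p v 1 by (rule billiard_collar[OF assms])
  have "\<not> lightlike_tangent a (p k)" for k
    using collared_not_lightlike point assms by (auto simp: collared_trajectory_def)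
  then show ?thesis by (simp add: reflections_def)
qed

lemma collared_closing_sign:
  assumes col: "collared_trajectory a p v" and \<tau>: "\<tau>\<^sup>2 = 1" "p N = \<tau> *\<^sub>R p 0" and "even N"
  shows "\<tau> = 1"
proof -
  interpret billiard a "collar a" p v 1 by (rule billiard_collar[OF col])
  have a: "0 < a $ 0" "0 < a $ 1" "0 < a $ 2" using col by (auto simp: collared_trajectory_def collared_def)
  have "\<tau> * (p 0 $ 0)\<^sup>2 > 0"
    using first_coordinate_sign[OF a, of N] \<open>even N\<close> by (simp add: \<tau>(2) power2_eq_square mult_ac)
  then have "\<tau> > 0" by (rule zero_less_mult_pos2) (use first_coordinate_step(1)[OF a] in simp)
  then show ?thesis using pos_unit \<tau>(1) by blast
qed

text \<open>
Needed to continue a trajectory that is antipodal to its beginning after \<open>n\<close> reflections.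
\<close>

lemma collared_shift:
  assumes "collared_trajectory a p v"
  shows "collared_trajectory a (\<lambda>k. p (k + n)) (\<lambda>k. v (k + n))"
  using assms unfolding collared_trajectory_def billiard_trajectory_def by simp

lemma periodic_iff_closes_up_to_sign:
  assumes "transverse_trajectory a p v \<or> exterior_trajectory a p v \<or> collared_trajectory a p v \<and> even n"
  shows "periodic a p v n \<longleftrightarrow> closes_up_to_sign a p v n"
  using assms
proof (elim disjE conjE)
  assume t: "transverse_trajectory a p v"
  interpret billiard a "transverse_domain a" p v 1 by (rule billiard_transverse[OF t])
  show ?thesis by (rule periodic_iff_closes) (rule transverse_closing_sign[OF t])
next
  assume t: "exterior_trajectory a p v"
  interpret billiard a "collar_exterior a" p v "-1" by (rule billiard_exterior[OF t])
  show ?thesis by (rule periodic_iff_closes) (rule exterior_closing_sign[OF t])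
next
  assume t: "collared_trajectory a p v" "even n"
  interpret billiard a "collar a" p v 1 by (rule billiard_collar[OF t(1)])
  show ?thesis
    by (rule periodic_iff_closes) (use collared_closing_sign[OF t(1)] collared_reflections[OF t(1)] t(2) in metis)
qed

lemma proj_periodic_iff_closes_up_to_sign:
  assumes "collared_trajectory a p v \<or> exterior_trajectory a p v"
  shows "proj_periodic a p v n \<longleftrightarrow> closes_up_to_sign a p v n"
proof -
  have a: "0 < a $ 0" "0 < a $ 1" "0 < a $ 2"
    using assms by (auto simp: collared_trajectory_def exterior_trajectory_def collared_def)
  from assms obtain M \<sigma> where "billiard a M p v \<sigma>"
    using billiard_collar billiard_exterior by blast
  then interpret billiard a M p v \<sigma> .
  show ?thesis by (rule proj_periodic_iff_closes) (rule first_coordinate_step(1)[OF a])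
qed

text \<open>
The product of two signs is a sign, and after an even number of reflections the sign is \<open>1\<close>.
\<close>

lemma collared_periodic_double:
  assumes col: "collared_trajectory a p v" and closes: "\<And>j. closes_up_to_sign a (\<lambda>k. p (k + j)) (\<lambda>k. v (k + j)) n"
  shows "periodic a p v (2 * n)"
proof -
  have r: "reflections a (\<lambda>k. p (k + j)) N = N" for j N
    by (rule collared_reflections[OF collared_shift[OF col]])
  obtain \<tau> where 1: "\<tau>\<^sup>2 = 1" "p n = \<tau> *\<^sub>R p 0" "v n = \<tau> *\<^sub>R v 0"
    using closes[of 0] r[of 0] by (auto simp: closes_up_to_sign_def)
  obtain \<tau>' where 2: "\<tau>'\<^sup>2 = 1" "p (n + n) = \<tau>' *\<^sub>R p n" "v (n + n) = \<tau>' *\<^sub>R v n"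
    using closes[of n] r[of n] by (auto simp: closes_up_to_sign_def)
  have "(\<tau>' * \<tau>)\<^sup>2 = 1" using 1 2 by (simp add: power_mult_distrib)
  then have "closes_up_to_sign a p v (2 * n)"
    unfolding closes_up_to_sign_def using 1 2 r[of 0]
    by (intro exI[of _ "2 * n"] exI[of _ "\<tau>' * \<tau>"]) (simp add: mult_2)
  then show ?thesis using periodic_iff_closes_up_to_sign col by auto
qed

theorem theorem5p6:
  fixes a :: "real^3" and p v :: "nat \<Rightarrow> real^3"
  assumes "collared_trajectory a p v \<or> exterior_trajectory a p v \<or> transverse_trajectory a p v"
  shows
    "(\<forall>\<nu> \<epsilon> :: real. \<forall>B D :: real fps.
        \<nu> \<notin> {0, a $ 0, a $ 1, a $ 2} \<longrightarrow>
        has_caustic a \<nu> p v \<longrightarrow>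
        \<epsilon> = sgn (a $ 1 * \<nu>) \<longrightarrow>
        (\<lambda>X. sqrt (\<epsilon> * (X - a $ 0) * (X - a $ 1) * (X - a $ 2) * (X - \<nu>))) has_fps_expansion B \<longrightarrow>
        (\<lambda>X. sqrt (\<epsilon> * (X - a $ 0) * (X - a $ 1) * (X - a $ 2) / (X - \<nu>))) has_fps_expansion D \<longrightarrow>
        (\<forall>m\<ge>2. periodic a p v (2 * m) \<longleftrightarrow> hankel_det (fps_nth B) 3 (m - 1) = 0) \<and>
        (\<forall>m\<ge>1.
           (transverse_trajectory a p v \<or> exterior_trajectory a p v \<longrightarrow>
              (periodic a p v (2 * m + 1) \<longleftrightarrow> hankel_det (fps_nth D) 2 m = 0)) \<and>
           (collared_trajectory a p v \<or> exterior_trajectory a p v \<longrightarrow>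
              (proj_periodic a p v (2 * m + 1) \<longleftrightarrow> hankel_det (fps_nth D) 2 m = 0)) \<and>
           (collared_trajectory a p v \<and> hankel_det (fps_nth D) 2 m = 0 \<longrightarrow>
              periodic a p v (2 * (2 * m + 1))))) \<and>
     (periodic a p v 2 \<longrightarrow> in_symmetry_plane p v)"

proof (intro conjI allI impI)
  obtain M \<sigma> where bil: "billiard a M p v \<sigma>"
    using assms billiard_collar billiard_exterior billiard_transverse by blast
  have a: "collared a \<or> transverse a"
    using assms by (auto simp: collared_trajectory_def exterior_trajectory_def transverse_trajectory_def)
  show "in_symmetry_plane p v" if "periodic a p v 2"
    using billiard.two_periodic_in_symmetry_plane[OF bil that] .
  fix \<nu> \<epsilon> :: real and B D :: "real fps" and m :: nat
  assume \<nu>: "\<nu> \<notin> {0, a $ 0, a $ 1, a $ 2}" and caustic: "has_caustic a \<nu> p v" and \<epsilon>: "\<epsilon> = sgn (a $ 1 * \<nu>)"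
    and B: "(\<lambda>X. sqrt (\<epsilon> * (X - a $ 0) * (X - a $ 1) * (X - a $ 2) * (X - \<nu>))) has_fps_expansion B"
    and D: "(\<lambda>X. sqrt (\<epsilon> * (X - a $ 0) * (X - a $ 1) * (X - a $ 2) / (X - \<nu>))) has_fps_expansion D"
  note bc = billiard_caustic_intro[OF bil a \<nu> caustic \<epsilon>]
  show "periodic a p v (2 * m) \<longleftrightarrow> hankel_det (fps_nth B) 3 (m - 1) = 0" if "2 \<le> m"
    using billiard_caustic.closes_iff_even[OF bc that B] periodic_iff_closes_up_to_sign[of a p v "2 * m"] assms by auto
  assume m: "1 \<le> m"
  note odd = billiard_caustic.closes_iff_odd[OF bc m D]
  show "periodic a p v (2 * m + 1) \<longleftrightarrow> hankel_det (fps_nth D) 2 m = 0"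
    if "transverse_trajectory a p v \<or> exterior_trajectory a p v"
    using odd periodic_iff_closes_up_to_sign[of a p v "2 * m + 1"] that by auto
  show "proj_periodic a p v (2 * m + 1) \<longleftrightarrow> hankel_det (fps_nth D) 2 m = 0"
    if "collared_trajectory a p v \<or> exterior_trajectory a p v"
    using odd proj_periodic_iff_closes_up_to_sign[OF that] by auto
  assume c: "collared_trajectory a p v \<and> hankel_det (fps_nth D) 2 m = 0"
  show "periodic a p v (2 * (2 * m + 1))"
  proof (rule collared_periodic_double)
    fix j
    have "has_caustic a \<nu> (\<lambda>k. p (k + j)) (\<lambda>k. v (k + j))" using caustic by (simp add: has_caustic_def)
    from billiard_caustic_intro[OF billiard_collar[OF collared_shift] a \<nu> this \<epsilon>] c
    have "billiard_caustic a (collar a) (\<lambda>k. p (k + j)) (\<lambda>k. v (k + j)) 1 \<nu> \<epsilon>" by blast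
    from billiard_caustic.closes_iff_odd[OF this m D] c
    show "closes_up_to_sign a (\<lambda>k. p (k + j)) (\<lambda>k. v (k + j)) (2 * m + 1)" by blast
  qed (use c in blast)
qed

end
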